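(* Suppose that $\alpha_n\vee\beta_n\to0$ as $n\to\infty$, that the smoothness condition $[A_1]$ (stated in the context) holds for some $\varepsilon>0$, and that the density $f$ satisfies the regularity condition $[R]$ (stated in the context) with $0<\gamma\le2$ on the set $F^{-1}(U)$. Then: (i) there is a positive constant $C$ not depending on $n$ such that for all sufficiently large $n$ $$\sup_{x\in\mathbb R}\left|F_{T_n}(x)-\Phi(x)\right|\le C\Bigl(\frac1{\sqrt{k_n}}+\frac1{\sqrt{m_n}}\Bigr);$$ (ii) if in addition $\gamma=2$ and $\sigma^2=\sigma^2(0,1)<\infty$, then also, as $n\to\infty$, $$\sup_{x\in\mathbb R}\left|F_{T_n}(x)-\Phi(x)\right|=o\Bigl(\frac1{\sqrt{k_n}}+\frac1{\sqrt{m_n}}\Bigr).$$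
   Context: Setting. $X_1,X_2,\dots$ are i.i.d. real-valued nondegenerate random variables with distribution function $F$; $X_{1:n}\le\dots\le X_{n:n}$ are the order statistics of $X_1,\dots,X_n$. $F^{-1}(u)=\inf\{x:F(x)\ge u\}$ for $0<u\le 1$, $F^{-1}(0)=F^{-1}(0^+)$, and $\xi_\nu=F^{-1}(\nu)$ for $0<\nu<1$. $k_n,m_n$ are sequences of integers with $0\le k_n<n-m_n\le n$ and $\min(k_n,m_n)\to\infty$ as $n\to\infty$; $\alpha_n=k_n/n$, $\beta_n=m_n/n$. The trimmed sum is $T_n=\frac1n\sum_{i=k_n+1}^{n-m_n}X_{i:n}$. Put $\mu(u,1-v)=\int_u^{1-v}F^{-1}(s)\,ds$ and $\sigma^2(u,1-v)=\int_u^{1-v}\int_u^{1-v}(s\wedge t-st)\,dF^{-1}(s)\,dF^{-1}(t)$ for $0\le u<1-v\le1$; $\sigma^2(0,1)$ equals the variance of $X_1$ whenever $\mathbf EX_1^2<\infty$. We write $s\vee t=\max(s,t)$, $s\wedge t=\min(s,t)$. Winsorized scale: $Q_n(u)=\xi_{\alpha_n}\vee(F^{-1}(u)\wedge\xi_{1-\beta_n})$, $\mu_{W_{(n)}}=\int_0^1Q_n(u)\,du$, $\sigma^2_{W_{(n)}}=\int_0^1(Q_n(u)-\mu_{W_{(n)}})^2du$. $\Phi$ is the standard normal distribution function and $F_{T_n}(x)=\mathbf P\bigl(\sigma_{W_{(n)}}^{-1}n^{1/2}(T_n-\mu(\alpha_n,1-\beta_n))\le x\bigr)$. Standing assumption: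 $\liminf_{n\to\infty}\sigma_{W_{(n)}}>0$. Condition $[A_1]$ (in the present case $\alpha_n\to0$, $\beta_n\to0$) with a given $0<\varepsilon<1$: there exist two open sets $U_a,U_b\subset(0,1)$ such that $U_a\supset(0,\varepsilon)$, $U_b\supset(1-\varepsilon,1)$ and $F^{-1}$ is differentiable in $U=U_a\cup U_b$, i.e. the density $f=F'$ exists and is positive in $F^{-1}(U)$. Condition $[R]$: $f\in RV_\rho^\infty$ with $\rho=-(1+\gamma)$, $\gamma>0$, i.e. $f(x)=|x|^\rho L(x)$ for $|x|>x_0$ with some $x_0>0$, where $L$ is a positive function slowly varying at infinity ($L(tx)/L(x)\to1$ as $|x|\to\infty$ for every $t>0$, at both $+\infty$ and $-\infty$); and moreover $|f(x+\Delta x)-f(x)|=O\bigl(f(x)\,|\Delta x/x|\bigr)$ whenever $\Delta x=o(|x|)$, as $|x|\to\infty$. *)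

theory Defs
  imports "HOL-Probability.Probability" "HOL-Library.Landau_Symbols"
begin

text \<open>
  The left-continuous inverse of a distribution function.  The value is meaningful for
  \<open>0 < u < 1\<close>, where the infimum is over a nonempty set that is bounded below.  The values at
  \<open>0\<close> and \<open>1\<close> are immaterial: integrals over \<open>{0..1}\<close> do not see them, and the arguments
  \<open>\<alpha>\<^sub>n\<close> and \<open>1 - \<beta>\<^sub>n\<close> lie strictly between them once \<open>min (k n) (m n) > 0\<close>.
\<close>

definition quantile :: "(real \<Rightarrow> real) \<Rightarrow> real \<Rightarrow> real" where
  "quantile F u = Inf {x. u \<le> F x}"

text \<open>\<open>order_stat X n i\<close> is the \<open>i\<close>-th smallest of \<open>X 1, \<dots>, X n\<close>, for \<open>1 \<le> i \<le> n\<close>.\<close>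

definition order_stat :: "(nat \<Rightarrow> 'a \<Rightarrow> real) \<Rightarrow> nat \<Rightarrow> nat \<Rightarrow> 'a \<Rightarrow> real" where
  "order_stat X n i \<omega> = sort (map (\<lambda>j. X j \<omega>) [1..<Suc n]) ! (i - 1)"

definition trimmed_sum ::
    "(nat \<Rightarrow> 'a \<Rightarrow> real) \<Rightarrow> (nat \<Rightarrow> nat) \<Rightarrow> (nat \<Rightarrow> nat) \<Rightarrow> nat \<Rightarrow> 'a \<Rightarrow> real" where
  "trimmed_sum X k m n \<omega> = 1 / real n * (\<Sum>i = k n + 1..n - m n. order_stat X n i \<omega>)"

definition trimmed_mean :: "(real \<Rightarrow> real) \<Rightarrow> real \<Rightarrow> real \<Rightarrow> real" where
  "trimmed_mean F a b = (LBINT s:{a..b}. quantile F s)"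

text \<open>
  The Lebesgue--Stieltjes measure of the quantile function on the open unit interval.  As the
  quantile function is left-continuous, its increments are the masses of the intervals
  \<open>{a..<b}\<close>, whereas \<^const>\<open>interval_measure\<close> is for right-continuous functions and
  uses \<open>{a<..b}\<close>.  The lemma \<open>emeasure_quantile_measure\<close> below shows that the measure
  with these masses exists.
\<close>

definition quantile_measure :: "(real \<Rightarrow> real) \<Rightarrow> real measure" where
  "quantile_measure F =
     extend_measure {0<..<1} {(a, b). 0 < a \<and> a \<le> b \<and> b < 1} (\<lambda>(a, b). {a..<b})
       (\<lambda>(a, b). ennreal (quantile F b - quantile F a))"

text \<open>
  The integrand is nonnegative, so that the double integral always has a value in
  \<open>[0, \<infinity>]\<close>.
\<close>

definition trimmed_variance :: "(real \<Rightarrow> real) \<Rightarrow> real \<Rightarrow> real \<Rightarrow> ennreal" where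
  "trimmed_variance F a b =
     (\<integral>\<^sup>+s\<in>{a..<b}. (\<integral>\<^sup>+t\<in>{a..<b}. ennreal (min s t - s * t) \<partial>quantile_measure F)
        \<partial>quantile_measure F)"

text \<open>In the next three definitions \<open>a\<close> and \<open>b\<close> stand for \<open>\<alpha>\<^sub>n\<close> and \<open>1 - \<beta>\<^sub>n\<close>.\<close>

definition winsorized_quantile :: "(real \<Rightarrow> real) \<Rightarrow> real \<Rightarrow> real \<Rightarrow> real \<Rightarrow> real" where
  "winsorized_quantile F a b u = max (quantile F a) (min (quantile F u) (quantile F b))"

definition winsorized_mean :: "(real \<Rightarrow> real) \<Rightarrow> real \<Rightarrow> real \<Rightarrow> real" where
  "winsorized_mean F a b = (LBINT u:{0..1}. winsorized_quantile F a b u)"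

definition winsorized_sd :: "(real \<Rightarrow> real) \<Rightarrow> real \<Rightarrow> real \<Rightarrow> real" where
  "winsorized_sd F a b =
     sqrt (LBINT u:{0..1}. (winsorized_quantile F a b u - winsorized_mean F a b)\<^sup>2)"

definition trimmed_cdf ::
    "'a measure \<Rightarrow> (nat \<Rightarrow> 'a \<Rightarrow> real) \<Rightarrow> (real \<Rightarrow> real) \<Rightarrow> (nat \<Rightarrow> nat) \<Rightarrow> (nat \<Rightarrow> nat) \<Rightarrow> nat
      \<Rightarrow> real \<Rightarrow> real" where
  "trimmed_cdf M X F k m n x =
     (let \<alpha> = real (k n) / real n; \<beta> = real (m n) / real n in
      measure M {\<omega> \<in> space M.
        inverse (winsorized_sd F \<alpha> (1 - \<beta>)) * sqrt (real n)
          * (trimmed_sum X k m n \<omega> - trimmed_mean F \<alpha> (1 - \<beta>)) \<le> x})"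

definition smooth_tails :: "(real \<Rightarrow> real) \<Rightarrow> real \<Rightarrow> real set \<Rightarrow> real set \<Rightarrow> bool" where
  "smooth_tails F \<epsilon> Ua Ub \<longleftrightarrow>
     open Ua \<and> open Ub \<and> Ua \<subseteq> {0<..<1} \<and> Ub \<subseteq> {0<..<1} \<and>
     {0<..<\<epsilon>} \<subseteq> Ua \<and> {1 - \<epsilon><..<1} \<subseteq> Ub \<and>
     (\<forall>u \<in> Ua \<union> Ub. quantile F field_differentiable at u) \<and>
     (\<forall>x \<in> quantile F ` (Ua \<union> Ub). F field_differentiable at x \<and> 0 < deriv F x)"

text \<open>On the reals \<^const>\<open>at_infinity\<close> is the filter \<open>\<bar>x\<bar> \<rightarrow> \<infinity>\<close>, hence covers both tails.\<close>

definition slowly_varying :: "(real \<Rightarrow> real) \<Rightarrow> bool" where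
  "slowly_varying L \<longleftrightarrow> (\<forall>t>0. ((\<lambda>x. L (t * x) / L x) \<longlongrightarrow> 1) at_infinity)"

text \<open>
  \<open>f\<close> belongs to \<open>RV\<^sub>\<rho>\<^sup>\<infinity>\<close> on the set \<open>D\<close> on which it is
  meaningful.  The representation of \<open>f\<close> concerns all large \<open>\<bar>x\<bar>\<close>, so all these points must
  lie in \<open>D\<close>.  The \<open>o\<close> and \<open>O\<close> in the last line are with respect to \<open>\<bar>x\<bar> \<rightarrow> \<infinity>\<close>.
\<close>

definition RV_infinity_on :: "real set \<Rightarrow> real \<Rightarrow> (real \<Rightarrow> real) \<Rightarrow> bool" where
  "RV_infinity_on D \<rho> f \<longleftrightarrow>
     (\<exists>x0>0. \<exists>L. (\<forall>x. 0 < L x) \<and> slowly_varying L \<and>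
        (\<forall>x. x0 < \<bar>x\<bar> \<longrightarrow> x \<in> D \<and> f x = \<bar>x\<bar> powr \<rho> * L x)) \<and>
     (\<forall>\<Delta>. \<Delta> \<in> o[at_infinity](\<lambda>x. \<bar>x\<bar>) \<longrightarrow>
        (\<lambda>x. \<bar>f (x + \<Delta> x) - f x\<bar>) \<in> O[at_infinity](\<lambda>x. f x * \<bar>\<Delta> x / x\<bar>))"

lemma quantile_le_iff:
  assumes "real_distribution N" "0 < u" "u < 1"
  shows "quantile (cdf N) u \<le> x \<longleftrightarrow> u \<le> cdf N x"
proof -
  interpret N: cdf_distribution N
    using assms(1) by (simp add: cdf_distribution_def)
  show ?thesis
    using N.pseudoinverse[OF assms(2,3), of x] by (simp add: quantile_def)
qed

lemma emeasure_quantile_measure: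
  assumes N: "real_distribution N" and ab: "0 < a" "a \<le> b" "b < 1"
  shows "emeasure (quantile_measure (cdf N)) {a..<b}
    = ennreal (quantile (cdf N) b - quantile (cdf N) a)"
proof -
  interpret real_distribution N by fact
  define D where "D = distr lborel borel (cdf N)"
  have meas [measurable]: "cdf N \<in> borel_measurable borel"
    by (intro borel_measurable_mono monoI cdf_nondecreasing)
  have eq: "emeasure D {c..<d} = ennreal (quantile (cdf N) d - quantile (cdf N) c)"
    if "0 < c" "c \<le> d" "d < 1" for c d
  proof -
    have "cdf N -` {c..<d} = {quantile (cdf N) c..<quantile (cdf N) d}"
      using quantile_le_iff[OF N, of c] quantile_le_iff[OF N, of d] that
      by (auto simp: not_le[symmetric])
    moreover have "quantile (cdf N) c \<le> quantile (cdf N) d"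
      using quantile_le_iff[OF N, of c "quantile (cdf N) d"]
        quantile_le_iff[OF N, of d "quantile (cdf N) d"] that by auto
    ultimately show ?thesis
      by (simp add: D_def emeasure_distr)
  qed
  let ?I = "{(a, b). 0 < a \<and> a \<le> b \<and> b < (1::real)}"
  have sub: "sets (quantile_measure (cdf N)) \<subseteq> sets D"
  proof -
    have "sigma_sets {0<..<1} ((\<lambda>(a, b). {a..<b}) ` ?I) \<subseteq> sets (borel :: real measure)"
    proof
      fix A assume "A \<in> sigma_sets {0<..<1::real} ((\<lambda>(a, b). {a..<b}) ` ?I)"
      then show "A \<in> sets borel"
        by induction auto
    qed
    then show ?thesis
      unfolding quantile_measure_def D_def by (subst sets_extend_measure) auto
  qed
  have "countably_additive (sets (quantile_measure (cdf N))) (emeasure D)"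
    using sub emeasure_countably_additive[of D] unfolding countably_additive_def by blast
  then show ?thesis
    using emeasure_extend_measure[OF quantile_measure_def, of "emeasure D" "cdf N" "(a, b)"] ab eq
    by (force simp: positive_def)
qed

end

theory Submission
  imports Defs
begin

text \<open>
  Winsorizing linearizes the trimmed sum: \<open>T\<^sub>n\<close> differs from the mean of the variables clipped to
  \<open>[- A\<^sub>L, A\<^sub>R]\<close>, where \<open>A\<^sub>L = - \<xi>\<^bsub>\<alpha>\<^esub>\<close> and \<open>A\<^sub>R = \<xi>\<^bsub>1 - \<beta>\<^esub>\<close>, by one remainder for each tail, of the
  size of the fluctuations of the empirical distribution function near the respective quantile.
  The standardized clipped variables are bounded by \<open>b = (A\<^sub>L + A\<^sub>R) / (\<sigma>\<^sub>W sqrt n)\<close>, and Stein's method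
  with the randomized concentration inequality of Chen and Shao shows that the distance to the
  normal law is \<open>O(b + 1 / k + 1 / m)\<close>, provided that the remainders are well approximated by
  leave-one-out versions.  Chernoff bounds for the empirical counts on a grid of mesh
  \<open>A / sqrt k\<close> around the quantile give this; all that enters of the density is that the tail
  probability grows by a factor \<open>1 + c s\<close> at least on passing from \<open>a\<close> to \<open>a (1 - s)\<close>, and shrinks
  correspondingly at \<open>a (1 + s)\<close>, which follows from regular variation.

  Finally \<open>\<alpha> A\<^sub>L\<^sup>2 \<le> 32 \<sigma>\<^sub>W\<^sup>2\<close>, because the clipped variable has mass \<open>\<alpha>\<close> at \<open>- A\<^sub>L\<close>, so that
  \<open>A\<^sub>L / (\<sigma>\<^sub>W sqrt n) = O(1 / sqrt k)\<close>.  If the variance is finite, then \<open>\<alpha> A\<^sub>L\<^sup>2\<close> vanishes in the limit and \<open>O\<close>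
  becomes \<open>o\<close>.
\<close>

section \<open>Stein's equation for the normal distribution\<close>

text \<open>The obstacle is that the remainders are built from the same variables as the linear
  part, so they cannot be conditioned away, and a tail bound for their size alone would in general
  lose a factor in the rate. Their order is favourable: a count fluctuates by \<open>sqrt k\<close>
  and the empirical quantile by \<open>A / sqrt k\<close>, so the remainder, a product of the two,
  has the order \<open>A\<close> of a single clipped variable, hence \<open>b\<close> after
  standardization. Deleting one variable changes a count by at most one, and affects the remainder
  at a grid point only if the variable is counted there and the count of the others lies on the
  unlikely side of \<open>k\<close>. At the \<open>j\<close>-th grid point this is exponentially
  unlikely in \<open>j\<close>, so that all sums over the grid are geometric. The grid ends at a
  fixed relative distance \<delta>, up to which the tails are known to be regular; the probability
  of leaving it is exponentially small in \<open>sqrt k\<close>, of which only the order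
  \<open>1 / k\<close> is kept. As \<open>1 / k = o(1 / sqrt k)\<close>, the ratios of the quantiles
  to the scale alone decide between O and o.\<close>

abbreviation (input) Phi :: "real \<Rightarrow> real" ("\<Phi>") where
  "\<Phi> \<equiv> cdf std_normal_distribution"

abbreviation (input) phi :: "real \<Rightarrow> real" ("\<phi>") where
  "\<phi> \<equiv> std_normal_density"

interpretation std_normal: real_distribution std_normal_distribution
  by (rule real_dist_normal_dist)

section \<open>Calculus of the normal density and distribution function\<close>

lemma Phi_diff_eq_integral:
  assumes "x \<le> y"
  shows "\<Phi> y - \<Phi> x = integral {x..y} \<phi>"
proof -
  have cont: "continuous_on {x..y} \<phi>"
    unfolding normal_density_def by (intro continuous_intros) auto
  have int: "set_integrable lborel {x..y} \<phi>"
    by (rule borel_integrable_atLeastAtMost') (rule cont)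
  have "\<Phi> y - \<Phi> x = measure std_normal_distribution {x<..y}"
    using assms std_normal.cdf_diff_eq[of x y] by (cases "x = y") auto
  also have "\<dots> = enn2real (\<integral>\<^sup>+z\<in>{x<..y}. \<phi> z \<partial>lborel)"
    by (simp add: measure_def emeasure_density)
  also have "(\<integral>\<^sup>+z\<in>{x<..y}. \<phi> z \<partial>lborel)
      = (\<integral>\<^sup>+z\<in>{x..y}. \<phi> z \<partial>lborel)"
    using AE_lborel_singleton[of x]
    by (intro nn_integral_cong_AE) (auto split: split_indicator elim!: eventually_mono)
  also have "\<dots> = ennreal (LINT z:{x..y}|lborel. \<phi> z)"
    using int by (subst nn_integral_set_ennreal, unfold set_lebesgue_integral_def set_integrable_def,
      subst nn_integral_eq_integral) (auto simp: mult.commute)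
  also have "enn2real \<dots> = (LINT z:{x..y}|lborel. \<phi> z)"
    by (simp add: set_lebesgue_integral_def)
  also have "\<dots> = integral {x..y} \<phi>"
    using int by (rule set_borel_integral_eq_integral(2))
  finally show ?thesis .
qed

lemma Phi_has_derivative: "(\<Phi> has_real_derivative \<phi> x) (at x)"
proof -
  have cont: "continuous_on {x-1..x+1} \<phi>"
    unfolding normal_density_def by (intro continuous_intros) auto
  have "((\<lambda>y. \<Phi> (x-1) + integral {x-1..y} \<phi>) has_real_derivative
      0 + \<phi> x) (at x within {x-1..x+1})"
    by (intro DERIV_add DERIV_const integral_has_real_derivative[OF cont]) auto
  then have "((\<lambda>y. \<Phi> (x-1) + integral {x-1..y} \<phi>) has_real_derivative
      \<phi> x) (at x)"
    by (subst (asm) at_within_interior) (auto simp: interior_atLeastAtMost_real)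
  then show ?thesis
  proof (rule has_field_derivative_transform_within_open[where S="{x-1<..<x+1}"])
    fix y assume "y \<in> {x-1<..<x+1}"
    then show "\<Phi> (x-1) + integral {x-1..y} \<phi> = \<Phi> y"
      using Phi_diff_eq_integral[of "x-1" y] by auto
  qed auto
qed

lemma Phi_nonneg: "0 \<le> \<Phi> x" and Phi_le_1: "\<Phi> x \<le> 1"
  by (auto simp: std_normal.cdf_nonneg std_normal.cdf_bounded_prob)

lemma std_normal_density_eq: "\<phi> x = exp (- (x^2) / 2) / sqrt (2 * pi)"
  by (simp add: normal_density_def)

lemma std_normal_density_nonzero: "\<phi> x \<noteq> 0"
  by (rule less_imp_neq[THEN not_sym]) (simp add: normal_density_pos)

lemma std_normal_density_minus: "\<phi> (- x) = \<phi> x"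
  by (simp add: normal_density_def)

lemma std_normal_density_has_derivative:
  "(\<phi> has_real_derivative - x * \<phi> x) (at x)"
proof -
  have "\<phi> = (\<lambda>x. exp (- (x^2) / 2) / sqrt (2 * pi))"
    by (simp add: fun_eq_iff std_normal_density_eq)
  moreover have "((\<lambda>x. exp (- (x^2) / 2) / sqrt (2 * pi)) has_real_derivative
      - x * (exp (- (x^2) / 2) / sqrt (2 * pi))) (at x)"
  proof -
    have "((\<lambda>x. exp (- (x^2) / 2)) has_real_derivative - x * exp (- (x^2) / 2)) (at x)"
      by (rule derivative_eq_intros refl | simp)+
    from DERIV_cdivide[OF this, of "sqrt (2 * pi)"] show ?thesis by simp
  qed
  ultimately show ?thesis by metis
qed

lemma Phi_minus: "\<Phi> (- x) = 1 - \<Phi> x"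
proof -
  have "((\<lambda>y. \<Phi> y + \<Phi> (- y)) has_real_derivative 0) (at y)" for y
    by (rule derivative_eq_intros Phi_has_derivative DERIV_chain2[OF Phi_has_derivative] refl)+
      (simp add: std_normal_density_minus)
  then have const: "\<Phi> y + \<Phi> (- y) = \<Phi> x + \<Phi> (- x)" for y
    using DERIV_const_ratio_const2[of y x "\<lambda>y. \<Phi> y + \<Phi> (- y)" 0]
    by (cases "y = x") (auto simp: DERIV_isconst_all)
  have "((\<lambda>y. \<Phi> y + \<Phi> (- y)) \<longlongrightarrow> 1 + 0) at_top"
    by (intro tendsto_add std_normal.cdf_lim_at_top_prob
      filterlim_compose[OF std_normal.cdf_lim_at_bot filterlim_uminus_at_bot_at_top])
  moreover have "(\<lambda>y. \<Phi> y + \<Phi> (- y)) = (\<lambda>y. \<Phi> x + \<Phi> (- x))"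
    by (rule ext) (rule const)
  ultimately have "((\<lambda>y::real. \<Phi> x + \<Phi> (- x)) \<longlongrightarrow> 1) at_top"
    by (metis add_0_right)
  from LIMSEQ_unique[OF tendsto_const this[THEN filterlim_compose, OF filterlim_real_sequentially]]
  show ?thesis by simp
qed

text \<open>The gap \<open>h y = \<phi> y / y - (1 - \<Phi> y)\<close> has derivative
  \<open>- \<phi> y / y^2\<close> and tends to 0 at infinity; being nonincreasing, it is nonnegative
  on the positive half-line.\<close>

lemma Mills_ratio_le:
  assumes "0 \<le> x"
  shows "x * (1 - \<Phi> x) \<le> \<phi> x"
proof (cases "x = 0")
  case True
  then show ?thesis by (simp add: normal_density_nonneg)
next
  case False
  with assms have x: "0 < x" by simp
  define h where "h y = \<phi> y / y - (1 - \<Phi> y)" for y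
  have hd: "(h has_real_derivative - \<phi> y / y^2) (at y)" if "0 < y" for y
    unfolding h_def using that
    by (auto intro!: derivative_eq_intros std_normal_density_has_derivative Phi_has_derivative
      simp: field_simps power2_eq_square)
  have anti: "h z \<le> h y" if "0 < y" "y \<le> z" for y z
  proof (rule DERIV_nonpos_imp_nonincreasing[OF that(2)])
    fix v assume "y \<le> v"
    then have "(h has_real_derivative - \<phi> v / v^2) (at v)"
      using that(1) by (intro hd) simp
    moreover have "- \<phi> v / v^2 \<le> 0"
      by (simp add: normal_density_nonneg)
    ultimately show "\<exists>l. (h has_real_derivative l) (at v) \<and> l \<le> 0" by blast
  qed
  have d0: "((\<lambda>y. \<phi> y / y) \<longlongrightarrow> 0) at_top"
  proof (rule tendsto_sandwich[of "\<lambda>_. 0" _ _ "\<lambda>y. (1 / sqrt (2*pi)) / y"])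
    show "\<forall>\<^sub>F y in at_top. \<phi> y / y \<le> 1 / sqrt (2 * pi) / y"
      using eventually_gt_at_top[of 0]
      by eventually_elim (auto simp: std_normal_density_eq intro!: divide_right_mono)
    show "((\<lambda>y. 1 / sqrt (2 * pi) / y) \<longlongrightarrow> 0) at_top"
      by (rule tendsto_divide_0[OF tendsto_const])
        (simp add: filterlim_ident filterlim_at_top_imp_at_infinity)
    show "\<forall>\<^sub>F y in at_top. 0 \<le> \<phi> y / y"
      using eventually_gt_at_top[of 0] by eventually_elim (auto simp: normal_density_nonneg)
  qed auto
  have "(h \<longlongrightarrow> 0 - (1 - 1)) at_top"
    unfolding h_def by (intro tendsto_intros d0 std_normal.cdf_lim_at_top_prob)
  then have "(h \<longlongrightarrow> 0) at_top" by simp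
  then have "0 \<le> h x"
    by (rule tendsto_upperbound)
      (auto intro!: eventually_mono[OF eventually_ge_at_top[of x]] anti x)
  then show ?thesis
    using x by (simp add: h_def field_simps)
qed

text \<open>A bound for the Mills ratio \<open>(1 - \<Phi> x) / \<phi> x\<close> on the nonnegative
  half-line: on [0, 1] the density is at least its value at 1, and beyond 1 the ratio is at most
  1.\<close>

definition gauss_const :: real where
  "gauss_const = 1 / \<phi> 1"

lemma gauss_const_pos: "0 < gauss_const"
  by (simp add: gauss_const_def normal_density_pos)

lemma one_minus_Phi_le:
  assumes "0 \<le> x"
  shows "1 - \<Phi> x \<le> gauss_const * \<phi> x"
proof (cases "x \<le> 1")
  case True
  have "\<phi> 1 \<le> \<phi> x"
    using True assms by (auto simp: std_normal_density_eq power_le_one intro!: divide_right_mono)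
  then have "1 \<le> gauss_const * \<phi> x"
    by (simp add: gauss_const_def normal_density_pos)
  then show ?thesis using Phi_nonneg[of x] by linarith
next
  case False
  have "1 * 1 \<le> 1 / \<phi> 1"
  proof -
    have "exp (- (1^2) / 2) \<le> (1::real)" by simp
    moreover have "1 \<le> sqrt (2 * pi)" using pi_gt3 by simp
    ultimately have "exp (- (1^2) / 2) \<le> sqrt (2 * pi)" by linarith
    then have "\<phi> 1 \<le> 1"
      unfolding std_normal_density_eq by (simp add: divide_le_eq)
    then show ?thesis by (simp add: normal_density_pos)
  qed
  then have *: "1 \<le> gauss_const" by (simp add: gauss_const_def)
  have "1 - \<Phi> x \<le> x * (1 - \<Phi> x)"
    using False Phi_le_1[of x] by (simp add: mult_le_cancel_right1)
  also have "\<dots> \<le> \<phi> x" using Mills_ratio_le assms by simp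
  also have "\<dots> \<le> gauss_const * \<phi> x"
    using mult_right_mono[OF * normal_density_nonneg[of 0 1 x]] by simp
  finally show ?thesis .
qed

text \<open>The bounded solution of Stein's equation for the half-line up to \<open>z\<close>. The
  two branches agree at \<open>w = z\<close>, where the solution is continuous but has a
  kink.\<close>

definition stein_sol :: "real \<Rightarrow> real \<Rightarrow> real" where
  "stein_sol z w = (if w \<le> z then (1 - \<Phi> z) * \<Phi> w else \<Phi> z * (1 - \<Phi> w)) / \<phi> w"

text \<open>The derivative of \<^term>\<open>stein_sol z\<close> away from \<open>z\<close>; its value at \<open>z\<close> is chosen such that Stein's
  equation \<open>f' w - w * f w = of_bool (w \<le> z) - \<Phi> z\<close> holds everywhere.\<close>

definition stein_deriv :: "real \<Rightarrow> real \<Rightarrow> real" where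
  "stein_deriv z w = w * stein_sol z w + of_bool (w \<le> z) - \<Phi> z"

text \<open>Reflection exchanges the branches and so reduces the bounds to nonnegative
  \<open>w\<close>. A tie \<open>w = z\<close> selects the first branch on both sides, which is why
  it is excluded here and checked separately in the bounds.\<close>

lemma stein_sol_minus: "w \<noteq> z \<Longrightarrow> stein_sol (- z) (- w) = stein_sol z w"
  by (auto simp: stein_sol_def Phi_minus std_normal_density_minus)

lemma stein_sol_nonneg: "0 \<le> stein_sol z w"
  by (auto simp: stein_sol_def normal_density_nonneg Phi_nonneg Phi_le_1)

text \<open>This eliminates \<open>z\<close>: what remains is the Mills ratio, so that the bounds on
  the solution become uniform in \<open>z\<close>.\<close>

lemma stein_sol_le_ratio:
  assumes "0 \<le> w"
  shows "stein_sol z w \<le> (1 - \<Phi> w) / \<phi> w"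
proof -
  have "(if w \<le> z then (1 - \<Phi> z) * \<Phi> w else \<Phi> z * (1 - \<Phi> w)) \<le> 1 - \<Phi> w"
  proof (cases "w \<le> z")
    case True
    then have "\<Phi> w \<le> \<Phi> z" by (rule std_normal.cdf_nondecreasing)
    then have "(1 - \<Phi> z) * \<Phi> w \<le> (1 - \<Phi> w) * 1"
      using Phi_nonneg Phi_le_1 by (intro mult_mono) auto
    then show ?thesis using True by simp
  next
    case False
    then show ?thesis using Phi_nonneg[of z] Phi_le_1[of z] Phi_le_1[of w]
      by (auto intro!: mult_left_le_one_le)
  qed
  then show ?thesis
    unfolding stein_sol_def by (intro divide_right_mono) (auto simp: normal_density_nonneg)
qed

lemma stein_sol_bounds_nonneg:
  assumes "0 \<le> w"
  shows "stein_sol z w \<le> gauss_const" "w * stein_sol z w \<le> 1"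
proof -
  have pos: "0 < \<phi> w" by (simp add: normal_density_pos)
  have "(1 - \<Phi> w) / \<phi> w \<le> gauss_const"
    using one_minus_Phi_le[OF assms] pos by (simp add: divide_le_eq)
  then show "stein_sol z w \<le> gauss_const" using stein_sol_le_ratio[OF assms, of z] by linarith
  have "w * stein_sol z w \<le> w * ((1 - \<Phi> w) / \<phi> w)"
    using stein_sol_le_ratio[OF assms] assms by (intro mult_left_mono)
  also have "\<dots> \<le> 1" using Mills_ratio_le[OF assms] pos by simp
  finally show "w * stein_sol z w \<le> 1" .
qed

lemma stein_sol_bounds:
  shows stein_sol_bound: "\<bar>stein_sol z w\<bar> \<le> gauss_const"
    and stein_sol_mult_bound: "\<bar>w * stein_sol z w\<bar> \<le> 1"
proof -
  have "\<bar>stein_sol z w\<bar> \<le> gauss_const \<and> \<bar>w * stein_sol z w\<bar> \<le> 1"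
  proof (cases "0 \<le> w")
    case True
    then show ?thesis using stein_sol_bounds_nonneg[OF True, of z] stein_sol_nonneg[of z w]
      by (auto simp: abs_mult)
  next
    case False
    have "stein_sol z w = stein_sol (- z) (- w)" if "w \<noteq> z"
      using stein_sol_minus[OF that] by simp
    moreover have "stein_sol z w = stein_sol (- z) (- w)" if "w = z"
      using that by (simp add: stein_sol_def Phi_minus std_normal_density_minus)
    ultimately have eq: "stein_sol (- z) (- w) = stein_sol z w" by metis
    then show ?thesis
      using stein_sol_bounds_nonneg[of "-w" "-z", unfolded eq] stein_sol_nonneg[of z w] False
      by (simp add: abs_mult)
  qed
  then show "\<bar>stein_sol z w\<bar> \<le> gauss_const" "\<bar>w * stein_sol z w\<bar> \<le> 1" by blast+
qed

lemma stein_deriv_bound: "\<bar>stein_deriv z w\<bar> \<le> 2"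
proof -
  have "\<bar>stein_deriv z w\<bar> \<le> \<bar>w * stein_sol z w\<bar> + \<bar>of_bool (w \<le> z) - \<Phi> z\<bar>"
    unfolding stein_deriv_def by linarith
  moreover have "\<bar>of_bool (w \<le> z) - \<Phi> z\<bar> \<le> 1"
    using Phi_nonneg[of z] Phi_le_1[of z] by (cases "w \<le> z") auto
  ultimately show ?thesis using stein_sol_mult_bound[of w z] by linarith
qed

lemma stein_sol_has_derivative:
  assumes "w \<noteq> z"
  shows "(stein_sol z has_real_derivative stein_deriv z w) (at w)"
proof -
  have nz: "\<phi> w \<noteq> 0" by (rule std_normal_density_nonzero)
  have alg1: "(a * p * p - a * v * (- w * p)) / (p * p) = w * (a * v / p) + a"
    and alg2: "(- a * p * p - a * v * (- w * p)) / (p * p) = w * (a * v / p) - a"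
    if "p \<noteq> 0" for a p v :: real
    using that by (simp_all add: field_simps)
  have 1: "((\<lambda>y. (1 - \<Phi> z) * \<Phi> y / \<phi> y) has_real_derivative
      w * ((1 - \<Phi> z) * \<Phi> w / \<phi> w) + (1 - \<Phi> z)) (at w)"
    using DERIV_divide[OF DERIV_cmult[OF Phi_has_derivative] std_normal_density_has_derivative nz,
        of "1 - \<Phi> z"]
    unfolding alg1[OF nz] .
  have "((\<lambda>y. \<Phi> z * (1 - \<Phi> y)) has_real_derivative - \<Phi> z * \<phi> w) (at w)"
    using DERIV_cmult[OF DERIV_diff[OF DERIV_const Phi_has_derivative], of "\<Phi> z" 1 w] by simp
  from DERIV_divide[OF this std_normal_density_has_derivative nz]
  have 2: "((\<lambda>y. \<Phi> z * (1 - \<Phi> y) / \<phi> y) has_real_derivative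
      w * (\<Phi> z * (1 - \<Phi> w) / \<phi> w) - \<Phi> z) (at w)"
    unfolding alg2[OF nz] .
  show ?thesis
  proof (cases "w < z")
    case True
    have "(stein_sol z has_real_derivative
        w * ((1 - \<Phi> z) * \<Phi> w / \<phi> w) + (1 - \<Phi> z)) (at w)"
      by (rule has_field_derivative_transform_within_open[OF 1, of "{..<z}"])
        (use True in \<open>auto simp: stein_sol_def\<close>)
    moreover have "w * ((1 - \<Phi> z) * \<Phi> w / \<phi> w) + (1 - \<Phi> z) = stein_deriv z w"
      using True by (simp add: stein_deriv_def stein_sol_def)
    ultimately show ?thesis by simp
  next
    case False
    have "(stein_sol z has_real_derivative
        w * (\<Phi> z * (1 - \<Phi> w) / \<phi> w) - \<Phi> z) (at w)"
      by (rule has_field_derivative_transform_within_open[OF 2, of "{z<..}"])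
        (use False assms in \<open>auto simp: stein_sol_def\<close>)
    moreover have "w * (\<Phi> z * (1 - \<Phi> w) / \<phi> w) - \<Phi> z = stein_deriv z w"
      using False \<open>w \<noteq> z\<close> by (simp add: stein_deriv_def stein_sol_def)
    ultimately show ?thesis by simp
  qed
qed

lemma isCont_stein_sol: "isCont (stein_sol z) w"
proof (cases "w = z")
  case False
  then show ?thesis using stein_sol_has_derivative DERIV_isCont by blast
next
  case True
  have nz: "\<phi> y \<noteq> 0" for y by (rule std_normal_density_nonzero)
  \<comment> \<open>Written with \<open>min\<close>, the two branches become a single quotient of
    continuous functions, which settles continuity at \<open>z\<close>.\<close>
  have "stein_sol z = (\<lambda>w. (min (\<Phi> w) (\<Phi> z) - \<Phi> z * \<Phi> w) / \<phi> w)"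
  proof
    fix w
    show "stein_sol z w = (min (\<Phi> w) (\<Phi> z) - \<Phi> z * \<Phi> w) / \<phi> w"
      using std_normal.cdf_nondecreasing[of w z] std_normal.cdf_nondecreasing[of z w]
      by (auto simp: stein_sol_def min_def algebra_simps)
  qed
  moreover have "isCont \<Phi> y" "isCont \<phi> y" for y
    using Phi_has_derivative std_normal_density_has_derivative DERIV_isCont by blast+
  ultimately show ?thesis
    by (simp add: nz continuous_intros)
qed

lemma borel_measurable_stein_sol [measurable]: "stein_sol z \<in> borel_measurable borel"
  by (intro borel_measurable_continuous_onI continuous_at_imp_continuous_on)
    (simp add: isCont_stein_sol)

lemma borel_measurable_stein_deriv [measurable]: "stein_deriv z \<in> borel_measurable borel"
  unfolding stein_deriv_def[abs_def] by measurable

text \<open>The mean value theorem tolerates the kink at \<open>z\<close> as an endpoint, where it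
  asks for continuity only.\<close>

lemma stein_sol_mvt:
  assumes "u < v" "z \<notin> {u<..<v}"
  shows "\<exists>c. u < c \<and> c < v \<and> stein_sol z v - stein_sol z u = (v - u) * stein_deriv z c"
proof -
  have "\<exists>l. \<exists>c>u. c < v \<and> (stein_sol z has_real_derivative l) (at c) \<and>
      stein_sol z v - stein_sol z u = (v - u) * l"
    using assms
    by (intro MVT)
      (auto simp: real_differentiable_def intro!: continuous_at_imp_continuous_on isCont_stein_sol
        exI[of _ "stein_deriv z _"] stein_sol_has_derivative)
  then obtain l c where c: "u < c" "c < v" "(stein_sol z has_real_derivative l) (at c)"
    and eq: "stein_sol z v - stein_sol z u = (v - u) * l" by blast
  have "c \<noteq> z" using c assms by auto
  then have "l = stein_deriv z c"
    using c(3) stein_sol_has_derivative DERIV_unique by blast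
  then show ?thesis using c eq by blast
qed

lemma stein_sol_lipschitz: "\<bar>stein_sol z x - stein_sol z y\<bar> \<le> 2 * \<bar>x - y\<bar>"
proof -
  have *: "\<bar>stein_sol z v - stein_sol z u\<bar> \<le> 2 * (v - u)" if uv: "u < v" "z \<notin> {u<..<v}" for u v
  proof -
    obtain c where "stein_sol z v - stein_sol z u = (v - u) * stein_deriv z c"
      using stein_sol_mvt[OF uv] by blast
    then have "\<bar>stein_sol z v - stein_sol z u\<bar> = (v - u) * \<bar>stein_deriv z c\<bar>"
      using uv(1) by (simp add: abs_mult)
    also have "\<dots> \<le> (v - u) * 2"
      using stein_deriv_bound[of z c] uv(1) by (intro mult_left_mono) auto
    finally show ?thesis by simp
  qed
  have **: "\<bar>stein_sol z v - stein_sol z u\<bar> \<le> 2 * (v - u)" if "u < v" for u v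
  proof (cases "z \<in> {u<..<v}")
    case True
    then show ?thesis using *[of u z] *[of z v] by auto
  qed (use * that in auto)
  show ?thesis
    using **[of x y] **[of y x] by (cases x y rule: linorder_cases) (auto simp: abs_minus_commute)
qed

text \<open>By Stein's equation the derivative of the solution is \<open>x * stein_sol z x\<close>
  plus a step function, so this is the modulus of continuity of its continuous part.\<close>

lemma stein_sol_mult_lipschitz:
  "\<bar>x * stein_sol z x - y * stein_sol z y\<bar> \<le> (gauss_const + 2 * \<bar>x\<bar>) * \<bar>x - y\<bar>"
proof -
  have "x * stein_sol z x - y * stein_sol z y
      = x * (stein_sol z x - stein_sol z y) + stein_sol z y * (x - y)"
    by (simp add: algebra_simps)
  also have "\<bar>\<dots>\<bar> \<le> \<bar>x\<bar> * (2 * \<bar>x - y\<bar>) + gauss_const * \<bar>x - y\<bar>"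
    by (rule order_trans[OF abs_triangle_ineq], unfold abs_mult, intro add_mono mult_left_mono mult_right_mono
      stein_sol_lipschitz stein_sol_bound) auto
  finally show ?thesis by (simp add: algebra_simps)
qed

text \<open>Stein's equation splits the derivative into the locally Lipschitz part
  \<open>w * stein_sol z w\<close> and a unit step at \<open>z\<close>. The former gives the term of
  order \<open>b\<close>. The step matters only if \<open>z\<close> is within \<open>b\<close> of
  \<open>w\<close>, and there four times |y| is a trivial bound.\<close>

lemma stein_sol_taylor:
  assumes "\<bar>y\<bar> \<le> b"
  shows "\<bar>stein_sol z w - stein_sol z (w - y) - y * stein_deriv z w\<bar>
    \<le> \<bar>y\<bar> * (b * (gauss_const + 2 * \<bar>w\<bar>) + 4 * of_bool (\<bar>w - z\<bar> \<le> b))"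
proof (cases "\<bar>w - z\<bar> \<le> \<bar>y\<bar>")
  case True
  have "\<bar>stein_sol z w - stein_sol z (w - y) - y * stein_deriv z w\<bar>
      \<le> 2 * \<bar>y\<bar> + \<bar>y\<bar> * 2"
    using stein_sol_lipschitz[of z w "w - y"] mult_left_mono[OF stein_deriv_bound[of z w], of "\<bar>y\<bar>"]
    by (simp add: abs_mult[symmetric])
  also have "\<dots> \<le> \<bar>y\<bar> * (b * (gauss_const + 2 * \<bar>w\<bar>)
      + 4 * of_bool (\<bar>w - z\<bar> \<le> b))"
    using True assms gauss_const_pos
    by (simp add: distrib_left)
  finally show ?thesis .
next
  case False
  \<comment> \<open>The interval between \<open>w - y\<close> and \<open>w\<close> avoids
    \<open>z\<close>, so the intermediate point lies on the same side of \<open>z\<close> as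
    \<open>w\<close> and the step functions cancel.\<close>
  have "\<exists>c. \<bar>c - w\<bar> \<le> \<bar>y\<bar> \<and> (c \<le> z \<longleftrightarrow> w \<le> z) \<and>
     stein_sol z w - stein_sol z (w - y) = y * stein_deriv z c"
  proof -
    show ?thesis
    proof (cases y "0::real" rule: linorder_cases)
      case equal then show ?thesis by auto
    next
      case less
      then have "w < w - y" "z \<notin> {w<..<w - y}" using False by auto
      then obtain c where "w < c" "c < w - y"
          "stein_sol z (w - y) - stein_sol z w = ((w - y) - w) * stein_deriv z c"
        using stein_sol_mvt by blast
      then show ?thesis using less False by (intro exI[of _ c]) auto
    next
      case greater
      then have "w - y < w" "z \<notin> {w - y<..<w}" using False by auto
      then obtain c where "w - y < c" "c < w"
          "stein_sol z w - stein_sol z (w - y) = (w - (w - y)) * stein_deriv z c"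
        using stein_sol_mvt by blast
      then show ?thesis using greater False by (intro exI[of _ c]) auto
    qed
  qed
  then obtain c where c: "\<bar>c - w\<bar> \<le> \<bar>y\<bar>" "c \<le> z \<longleftrightarrow> w \<le> z"
     "stein_sol z w - stein_sol z (w - y) = y * stein_deriv z c" by blast
  have "stein_sol z w - stein_sol z (w - y) - y * stein_deriv z w
      = y * (c * stein_sol z c - w * stein_sol z w)"
    using c(2,3) by (simp add: stein_deriv_def algebra_simps)
  also have "\<bar>\<dots>\<bar> \<le> \<bar>y\<bar> * ((gauss_const + 2 * \<bar>w\<bar>) * b)"
    unfolding abs_mult
  proof (intro mult_left_mono)
    have "\<bar>c * stein_sol z c - w * stein_sol z w\<bar>
        \<le> (gauss_const + 2 * \<bar>w\<bar>) * \<bar>w - c\<bar>"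
      using stein_sol_mult_lipschitz[of w z c] by (simp add: abs_minus_commute)
    also have "\<dots> \<le> (gauss_const + 2 * \<bar>w\<bar>) * b"
      using c(1) assms gauss_const_pos by (intro mult_left_mono) auto
    finally show "\<bar>c * stein_sol z c - w * stein_sol z w\<bar> \<le> (gauss_const + 2 * \<bar>w\<bar>) * b" .
  qed auto
  also have "\<dots> \<le> \<bar>y\<bar> * (b * (gauss_const + 2 * \<bar>w\<bar>)
      + 4 * of_bool (\<bar>w - z\<bar> \<le> b))"
    by (intro mult_left_mono) (auto simp: mult.commute)
  finally show ?thesis .
qed

section \<open>Perturbed sums of bounded independent variables\<close>

context prob_space
begin

text \<open>Boundedness is required pointwise on the whole space; it is stable under the algebraic
  operations used below and turns integrability obligations into applications of closure
  rules.\<close>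

definition bdd_rv :: "('a \<Rightarrow> real) \<Rightarrow> bool" where
  "bdd_rv X \<longleftrightarrow> random_variable borel X
      \<and> (\<exists>c. \<forall>w\<in>space M. \<bar>X w\<bar> \<le> c)"

lemma bdd_rvI: "random_variable borel X \<Longrightarrow> (\<And>w. w \<in> space M
    \<Longrightarrow> \<bar>X w\<bar> \<le> c) \<Longrightarrow> bdd_rv X"
  unfolding bdd_rv_def by blast

lemma bdd_rv_measurable [measurable_dest]: "bdd_rv X \<Longrightarrow> random_variable borel X"
  by (simp add: bdd_rv_def)

lemma bdd_rv_integrable: "bdd_rv X \<Longrightarrow> integrable M X"
  unfolding bdd_rv_def by (auto intro!: integrable_const_bound AE_I2)

lemma bdd_rv_const: "bdd_rv (\<lambda>_. c)"
  by (rule bdd_rvI[of _ "\<bar>c\<bar>"]) auto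

lemma bdd_rv_add:
  assumes "bdd_rv X" "bdd_rv Y" shows "bdd_rv (\<lambda>w. X w + Y w)"
proof -
  from assms obtain c d where "\<forall>w\<in>space M. \<bar>X w\<bar>
      \<le> c" "\<forall>w\<in>space M. \<bar>Y w\<bar> \<le> d"
    and [measurable]: "random_variable borel X" "random_variable borel Y"
    unfolding bdd_rv_def by blast
  then show ?thesis by (intro bdd_rvI[of _ "c + d"]) (auto intro: abs_triangle_ineq[THEN order_trans] add_mono)
qed

lemma bdd_rv_mult:
  assumes "bdd_rv X" "bdd_rv Y" shows "bdd_rv (\<lambda>w. X w * Y w)"
proof -
  from assms obtain c d where *: "\<forall>w\<in>space M. \<bar>X w\<bar>
      \<le> c" "\<forall>w\<in>space M. \<bar>Y w\<bar> \<le> d"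
    and [measurable]: "random_variable borel X" "random_variable borel Y"
    unfolding bdd_rv_def by blast
  show ?thesis
  proof (rule bdd_rvI)
    fix w assume "w \<in> space M"
    then show "\<bar>X w * Y w\<bar> \<le> \<bar>c\<bar> * \<bar>d\<bar>"
      using * unfolding abs_mult by (intro mult_mono) (force intro: order_trans)+
  qed simp
qed

lemma bdd_rv_uminus: "bdd_rv X \<Longrightarrow> bdd_rv (\<lambda>w. - X w)"
  using bdd_rv_mult[OF bdd_rv_const, of X "-1"] by simp

lemma bdd_rv_diff: "bdd_rv X \<Longrightarrow> bdd_rv Y \<Longrightarrow> bdd_rv (\<lambda>w. X w - Y w)"
  using bdd_rv_add[of X "\<lambda>w. - Y w"] by (simp add: bdd_rv_uminus)

lemma bdd_rv_abs: "bdd_rv X \<Longrightarrow> bdd_rv (\<lambda>w. \<bar>X w\<bar>)"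
  by (auto simp: bdd_rv_def)

lemma bdd_rv_divide: "bdd_rv X \<Longrightarrow> bdd_rv (\<lambda>w. X w / c)"
  using bdd_rv_mult[OF _ bdd_rv_const, of X "1 / c"] by simp

lemma bdd_rv_max: "bdd_rv X \<Longrightarrow> bdd_rv Y \<Longrightarrow> bdd_rv (\<lambda>w. max (X w) (Y w))"
proof -
  have max_eq: "max x y = (x + y + \<bar>x - y\<bar>) / 2" for x y :: real by (simp add: max_def)
  show "bdd_rv X \<Longrightarrow> bdd_rv Y \<Longrightarrow> ?thesis"
    unfolding max_eq by (intro bdd_rv_divide bdd_rv_add bdd_rv_abs bdd_rv_diff)
qed

lemma bdd_rv_power: "bdd_rv X \<Longrightarrow> bdd_rv (\<lambda>w. X w ^ n)"
  by (induction n) (simp_all add: bdd_rv_const bdd_rv_mult)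

lemma bdd_rv_sum: "(\<And>i. i \<in> A \<Longrightarrow> bdd_rv (X i))
    \<Longrightarrow> bdd_rv (\<lambda>w. \<Sum>i\<in>A. X i w)"
  by (induction A rule: infinite_finite_induct) (simp_all add: bdd_rv_const bdd_rv_add)

lemma bdd_rv_of_bool: "Measurable.pred M P \<Longrightarrow> bdd_rv (\<lambda>w. of_bool (P w))"
  by (rule bdd_rvI[of _ 1]) auto

lemmas bdd_intros = bdd_rv_const bdd_rv_add bdd_rv_mult bdd_rv_uminus bdd_rv_diff bdd_rv_abs
  bdd_rv_divide bdd_rv_max bdd_rv_power bdd_rv_sum bdd_rv_of_bool

lemma expectation_of_bool:
  assumes [measurable]: "Measurable.pred M P"
  shows "expectation (\<lambda>w. of_bool (P w)) = prob {w\<in>space M. P w}"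
proof -
  have "expectation (\<lambda>w. of_bool (P w)) = expectation (indicator {w\<in>space M. P w})"
    by (intro Bochner_Integration.integral_cong) (auto simp: indicator_def)
  also have "\<dots> = prob ({w\<in>space M. P w} \<inter> space M)"
    by (rule Bochner_Integration.integral_indicator)
  also have "{w\<in>space M. P w} \<inter> space M = {w\<in>space M. P w}" by auto
  finally show ?thesis .
qed

lemma indep_expectation_zero:
  assumes indep: "indep_var borel Y borel Z" and "bdd_rv Y" "bdd_rv Z" "expectation Y = 0"
  shows "expectation (\<lambda>w. Y w * Z w) = 0"
proof -
  have "expectation (\<lambda>w. Y w * Z w) = expectation Y * expectation Z"
    by (rule indep_var_lebesgue_integral[OF indep]) (intro bdd_rv_integrable assms)+
  then show ?thesis using assms by simp
qed

text \<open>Pairing each variable with the sum of all others makes the cross terms vanish by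
  independence and centring.\<close>

lemma expectation_square_sum:
  assumes fin: "finite I" and indep: "indep_vars (\<lambda>_. borel) Z I"
    and bdd: "\<And>i. i \<in> I \<Longrightarrow> bdd_rv (Z i)" and mean: "\<And>i. i \<in> I
        \<Longrightarrow> expectation (Z i) = 0"
  shows "expectation (\<lambda>w. (\<Sum>i\<in>I. Z i w)^2) = (\<Sum>i\<in>I. expectation (\<lambda>w. (Z i w)^2))"
proof -
  have cross: "expectation (\<lambda>w. Z i w * (\<Sum>j\<in>I-{i}. Z j w)) = 0" if i: "i \<in> I" for i
  proof (rule indep_expectation_zero)
    have "insert i (I - {i}) = I" using i by auto
    then show "indep_var borel (Z i) borel (\<lambda>w. \<Sum>j\<in>I-{i}. Z j w)"
      using fin indep by (intro indep_vars_sum) auto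
    show "bdd_rv (\<lambda>w. \<Sum>j\<in>I - {i}. Z j w)" by (intro bdd_rv_sum bdd) auto
  qed (use i bdd mean in auto)
  have "(\<Sum>i\<in>I. Z i w)^2 = (\<Sum>i\<in>I. (Z i w)^2 + Z i w * (\<Sum>j\<in>I-{i}. Z j w))" for w
  proof -
    have "(\<Sum>i\<in>I. Z i w)^2 = (\<Sum>i\<in>I. Z i w * (\<Sum>j\<in>I. Z j w))"
      by (simp add: power2_eq_square sum_distrib_right)
    also have "\<dots> = (\<Sum>i\<in>I. (Z i w)^2 + Z i w * (\<Sum>j\<in>I-{i}. Z j w))"
      using fin by (intro sum.cong refl) (simp add: sum.remove power2_eq_square algebra_simps)
    finally show ?thesis .
  qed
  then have "expectation (\<lambda>w. (\<Sum>i\<in>I. Z i w)^2)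
      = expectation (\<lambda>w. \<Sum>i\<in>I. (Z i w)^2 + Z i w * (\<Sum>j\<in>I-{i}. Z j w))" by simp
  also have "\<dots> = (\<Sum>i\<in>I. expectation (\<lambda>w. (Z i w)^2 + Z i w * (\<Sum>j\<in>I-{i}. Z j w)))"
    by (intro Bochner_Integration.integral_sum bdd_rv_integrable bdd_rv_add bdd_rv_mult
        bdd_rv_power bdd_rv_sum bdd) auto
  also have "\<dots> = (\<Sum>i\<in>I. expectation (\<lambda>w. (Z i w)^2))"
  proof (rule sum.cong[OF refl])
    fix i assume i: "i \<in> I"
    have "expectation (\<lambda>w. (Z i w)^2 + Z i w * (\<Sum>j\<in>I-{i}. Z j w))
        = expectation (\<lambda>w. (Z i w)^2) + expectation (\<lambda>w. Z i w * (\<Sum>j\<in>I-{i}. Z j w))"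
      using i by (intro Bochner_Integration.integral_add bdd_rv_integrable bdd_rv_mult
          bdd_rv_power bdd_rv_sum bdd) auto
    then show "expectation (\<lambda>w. (Z i w)^2 + Z i w * (\<Sum>j\<in>I-{i}. Z j w))
        = expectation (\<lambda>w. (Z i w)^2)"
      using cross[OF i] by simp
  qed
  finally show ?thesis .
qed

end

text \<open>Clipping is nondecreasing, which makes the right side nonnegative throughout. If
  \<open>s\<close> is within \<open>d\<close> of \<open>z\<close>, then \<open>s - z\<close> and
  \<open>s - y - z\<close> both lie where clipping at \<open>d + b\<close> is the identity, and the
  right side equals \<open>y^2\<close>.\<close>

lemma clip_mult_diff_ge:
  fixes s y z d b :: real
  assumes "\<bar>y\<bar> \<le> b" "0 \<le> d"
  shows "of_bool (\<bar>s - z\<bar> \<le> d) * y^2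
    \<le> y * (max (- (d + b)) (min (d + b) (s - z)) - max (- (d + b)) (min (d + b) (s - y - z)))"
proof (cases "\<bar>s - z\<bar> \<le> d")
  case True
  then have "max (- (d + b)) (min (d + b) (s - z)) = s - z"
    "max (- (d + b)) (min (d + b) (s - y - z)) = s - y - z"
    using assms by (auto simp: max_def min_def)
  then show ?thesis using True by (simp add: power2_eq_square)
next
  case False
  have "0 \<le> y * (max (- (d + b)) (min (d + b) (s - z)) - max (- (d + b)) (min (d + b) (s - y - z)))"
    by (cases "0 \<le> y") (auto intro!: mult_nonneg_nonneg mult_nonpos_nonpos simp: max_def min_def)
  then show ?thesis using False by simp
qed

text \<open>The Lipschitz property is in the clipping level, not in the argument: it is the price of
  replacing a random level by its leave-one-out version.\<close>

lemma clip_lipschitz: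
  fixes d d' b x :: real
  shows "\<bar>max (- (d + b)) (min (d + b) x) - max (- (d' + b)) (min (d' + b) x)\<bar> \<le> \<bar>d - d'\<bar>"
  by (auto simp: max_def min_def abs_if split: if_splits)

text \<open>The bound \<open>b\<close> takes the place of the sum of the third absolute moments,
  which it dominates because the variances add up to one.\<close>

locale bounded_summands = prob_space M for M :: "'a measure" +
  fixes I :: "'i set" and Y :: "'i \<Rightarrow> 'a \<Rightarrow> real" and b :: real
  assumes fin: "finite I" and indep: "indep_vars (\<lambda>_. borel) Y I"
    and bound: "\<And>i w. i \<in> I \<Longrightarrow> w \<in> space M \<Longrightarrow> \<bar>Y i w\<bar> \<le> b"
    and mean: "\<And>i. i \<in> I \<Longrightarrow> expectation (Y i) = 0"
    and var: "(\<Sum>i\<in>I. expectation (\<lambda>w. (Y i w)^2)) = 1"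
    and b: "0 < b"
begin

definition S :: "'a \<Rightarrow> real" where "S = (\<lambda>w. \<Sum>i\<in>I. Y i w)"

text \<open>A random substitute for the variance: Stein's expansion and the clipping inequality both
  produce this sum of squares, which has mean one and fluctuations of order
  \<open>b\<close>.\<close>

definition \<eta> :: "'a \<Rightarrow> real" where "\<eta> = (\<lambda>w. \<Sum>i\<in>I. (Y i w)^2)"

lemma bdd_Y: "i \<in> I \<Longrightarrow> bdd_rv (Y i)"
  using indep bound by (intro bdd_rvI[of _ b]) (auto simp: indep_vars_def)

lemma bdd_S: "bdd_rv S" and bdd_eta: "bdd_rv \<eta>"
  unfolding S_def \<eta>_def by (intro bdd_intros bdd_Y; assumption)+

lemma measurable_S [measurable]: "random_variable borel S"
  using bdd_S by (rule bdd_rv_measurable)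

lemma measurable_eta [measurable]: "random_variable borel \<eta>"
  using bdd_eta by (rule bdd_rv_measurable)

lemma expectation_S_square: "expectation (\<lambda>w. (S w)^2) = 1"
  unfolding S_def using fin indep bdd_Y mean var by (subst expectation_square_sum) auto

lemma expectation_eta: "expectation \<eta> = 1"
  unfolding \<eta>_def using var
      by (subst Bochner_Integration.integral_sum) (auto intro!: bdd_rv_integrable bdd_intros bdd_Y)

text \<open>The centred squares are independent, and each fourth moment is at most
  \<open>b^2\<close> times the second moment.\<close>

lemma expectation_eta_square_diff: "expectation (\<lambda>w. (\<eta> w - 1)^2) \<le> b^2"
proof -
  define Z where "Z i w = (Y i w)^2 - expectation (\<lambda>w. (Y i w)^2)" for i w
  have "expectation (\<lambda>w. (\<eta> w - 1)^2) = expectation (\<lambda>w. (\<Sum>i\<in>I. Z i w)^2)"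
    unfolding Z_def \<eta>_def sum_subtractf var ..
  also have "\<dots> = (\<Sum>i\<in>I. expectation (\<lambda>w. (Z i w)^2))"
  proof (rule expectation_square_sum[OF fin])
    show "indep_vars (\<lambda>_. borel) Z I"
      unfolding Z_def
      by (rule indep_vars_compose2[OF indep, of "\<lambda>i y. y^2 - expectation (\<lambda>w. (Y i w)^2)"]) measurable
    fix i assume i: "i \<in> I"
    show "bdd_rv (Z i)" unfolding Z_def by (intro bdd_intros bdd_Y i)
    have "expectation (Z i) = expectation (\<lambda>w. (Y i w)^2) - expectation (\<lambda>w.
        expectation (\<lambda>w. (Y i w)^2))"
      unfolding Z_def by (intro Bochner_Integration.integral_diff bdd_rv_integrable bdd_intros bdd_Y i)
    then show "expectation (Z i) = 0" by (simp add: prob_space)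
  qed
  also have "\<dots> \<le> (\<Sum>i\<in>I. b^2 * expectation (\<lambda>w. (Y i w)^2))"
  proof (rule sum_mono)
    fix i assume i: "i \<in> I"
    define v where "v = expectation (\<lambda>w. (Y i w)^2)"
    have v: "0 \<le> v" unfolding v_def by simp
    have "expectation (\<lambda>w. (Z i w)^2)
        = expectation (\<lambda>w. (Y i w)^2 * (Y i w)^2 - (2 * v) * (Y i w)^2 + v^2)"
      unfolding Z_def v_def[symmetric]
      by (intro Bochner_Integration.integral_cong refl) (simp add: power2_eq_square algebra_simps)
    also have "\<dots> \<le> expectation (\<lambda>w. b^2 * (Y i w)^2 - (2 * v) * (Y i w)^2 + v^2)"
    proof (intro integral_mono bdd_rv_integrable bdd_rv_add bdd_rv_diff bdd_rv_mult bdd_rv_const bdd_rv_power bdd_Y i)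
      fix w assume "w \<in> space M"
      then have "(Y i w)^2 \<le> b^2" using bound[OF i] power_mono[of "\<bar>Y i w\<bar>" b 2] by simp
      then show "(Y i w)^2 * (Y i w)^2 - 2 * v * (Y i w)^2 + v^2 \<le> b^2 * (Y i w)^2 - 2 * v * (Y i w)^2 + v^2"
        using mult_right_mono[of "(Y i w)^2" "b^2" "(Y i w)^2"] by simp
    qed
    also have "\<dots> = b^2 * v - (2 * v) * v + v^2"
    proof -
      have [simp]: "integrable M (\<lambda>w. (Y i w)^2)" by (intro bdd_rv_integrable bdd_intros bdd_Y i)
      show ?thesis by (simp add: v_def prob_space)
    qed
    also have "\<dots> \<le> b^2 * v" using v by (simp add: power2_eq_square)
    finally show "expectation (\<lambda>w. (Z i w)^2)
        \<le> b^2 * expectation (\<lambda>w. (Y i w)^2)" unfolding v_def .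
  qed
  also have "\<dots> = b^2" by (simp add: sum_distrib_left[symmetric] var)
  finally show ?thesis .
qed

lemma expectation_abs_eta_diff: "expectation (\<lambda>w. \<bar>1 - \<eta> w\<bar>) \<le> b"
proof -
  have "expectation (\<lambda>w. \<bar>1 - \<eta> w\<bar>)
      \<le> expectation (\<lambda>w. b / 2 + (\<eta> w - 1)^2 / (2 * b))"
  proof (intro integral_mono bdd_rv_integrable)
    fix w
    \<comment> \<open>Young's inequality in place of Cauchy-Schwarz; the weight \<open>b\<close>
      balances the two terms because the second moment is at most \<open>b^2\<close>.\<close>
    have "0 \<le> (b - \<bar>1 - \<eta> w\<bar>)^2" by simp
    also have "\<dots> = b^2 - 2 * b * \<bar>1 - \<eta> w\<bar> + (\<eta> w - 1)^2"
      by (simp add: power2_diff power2_commute)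
    finally show "\<bar>1 - \<eta> w\<bar> \<le> b / 2 + (\<eta> w - 1)^2 / (2 * b)"
      using b by (simp add: field_simps power2_eq_square)
  qed (intro bdd_rv_add bdd_rv_divide bdd_rv_power bdd_rv_diff bdd_rv_abs bdd_rv_const bdd_eta)+
  also have "\<dots> = b / 2 + expectation (\<lambda>w. (\<eta> w - 1)^2) / (2 * b)"
  proof -
    have "bdd_rv (\<lambda>w. (\<eta> w - 1)^2)" by (intro bdd_rv_power bdd_rv_diff bdd_rv_const bdd_eta)
    then have [simp]: "integrable M (\<lambda>w. (\<eta> w - 1)^2)" by (rule bdd_rv_integrable)
    show ?thesis by (simp add: prob_space)
  qed
  also have "\<dots> \<le> b / 2 + b^2 / (2 * b)"
    using b by (intro add_mono divide_right_mono expectation_eta_square_diff) auto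
  also have "\<dots> = b" using b by (simp add: power2_eq_square)
  finally show ?thesis .
qed

lemma expectation_eta_square: "expectation (\<lambda>w. (\<eta> w)^2) \<le> 1 + b^2"
proof -
  have i: "integrable M \<eta>" "integrable M (\<lambda>w. (\<eta> w)^2)"
    by (intro bdd_rv_integrable bdd_intros bdd_eta)+
  have "expectation (\<lambda>w. (\<eta> w - 1)^2) = expectation (\<lambda>w. (\<eta> w)^2 - 2 * \<eta> w + 1)"
    by (intro Bochner_Integration.integral_cong refl) (simp add: power2_diff)
  also have "\<dots> = expectation (\<lambda>w. (\<eta> w)^2) - 2 + 1"
    using i by (simp add: expectation_eta prob_space)
  finally show ?thesis using expectation_eta_square_diff by simp
qed

lemma expectation_abs_S: "expectation (\<lambda>w. \<bar>S w\<bar>) \<le> 1"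
proof -
  have "expectation (\<lambda>w. \<bar>S w\<bar>) \<le> expectation (\<lambda>w. 1 / 2 + (S w)^2 / 2)"
  proof (intro integral_mono bdd_rv_integrable)
    fix w
    have "0 \<le> (1 - \<bar>S w\<bar>)^2" by simp
    then show "\<bar>S w\<bar> \<le> 1 / 2 + (S w)^2 / 2" by (simp add: power2_diff)
  qed (intro bdd_rv_add bdd_rv_divide bdd_rv_power bdd_rv_abs bdd_rv_const bdd_S)+
  also have "\<dots> = 1"
  proof -
    have [simp]: "integrable M (\<lambda>w. (S w)^2)" by (intro bdd_rv_integrable bdd_intros bdd_S)
    show ?thesis by (simp add: prob_space expectation_S_square)
  qed
  finally show ?thesis .
qed

text \<open>Let \<open>f\<close> clip at half-width \<open>D + b\<close> around \<open>z\<close>. By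
  the clipping inequality the left side is at most the mean of the sum of \<open>Y i\<close> times
  the increment of \<open>f\<close> from \<open>S - Y i\<close> to \<open>S\<close>. The terms at
  \<open>S\<close> add up to \<open>S\<close> times \<open>f\<close>, at most |S| (D + b) in size.
  In the terms at \<open>S - Y i\<close>, replacing \<open>D\<close> by \<open>D' i\<close> leaves
  mean zero at the cost |Y i| |D - D' i|. Independence of \<open>Y i\<close> from a pair is
  expressed through arbitrary real functions \<open>h\<close> of the pair.\<close>

lemma concentration:
  assumes D: "bdd_rv D" "\<And>w. w \<in> space M \<Longrightarrow> 0 \<le> D w"
    and D': "\<And>i. i \<in> I \<Longrightarrow> bdd_rv (D' i)"
    and indep_D': "\<And>i h. i \<in> I
        \<Longrightarrow> h \<in> borel_measurable (borel \<Otimes>\<^sub>M borel) \<Longrightarrow>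
      indep_var borel (Y i) borel (\<lambda>w. h (S w - Y i w, D' i w))"
  shows "expectation (\<lambda>w. of_bool (\<bar>S w - z\<bar> \<le> D w) * \<eta> w)
    \<le> expectation (\<lambda>w. \<bar>S w\<bar> * D w) + b
        + (\<Sum>i\<in>I. expectation (\<lambda>w. \<bar>Y i w\<bar> * \<bar>D w - D' i w\<bar>))"
proof -
  note [measurable] = bdd_rv_measurable[OF D(1)] bdd_rv_measurable[OF D'] bdd_rv_measurable[OF bdd_Y]
  define f where "f d v = max (- (d + b)) (min (d + b) (v - z))" for d v :: real
  let ?g = "\<lambda>i w. \<bar>Y i w\<bar> * \<bar>D w - D' i w\<bar> - Y i w * f (D' i w) (S w - Y i w)"
  have f_meas [measurable]: "(\<lambda>(v, d). f d v) \<in> borel_measurable (borel \<Otimes>\<^sub>M borel)"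
    unfolding f_def by measurable
  have bdd_f: "bdd_rv (\<lambda>w. f (E w) (W w))" if "bdd_rv E" and [measurable]: "random_variable borel W" for E W
  proof -
    note [measurable] = bdd_rv_measurable[OF that(1)]
    from that(1) obtain c where "\<forall>w\<in>space M. \<bar>E w\<bar> \<le> c" unfolding bdd_rv_def by blast
    then have c: "\<bar>E w + b\<bar> \<le> c + b" if "w \<in> space M" for w
      using b that by (intro order_trans[OF abs_triangle_ineq] add_mono) auto
    have "\<bar>max (- a) (min a x)\<bar> \<le> \<bar>a\<bar>" for a x :: real by linarith
    then show ?thesis unfolding f_def using c
      by (intro bdd_rvI[of _ "c + b"]) (measurable, blast intro: order_trans)
  qed
  have zero: "expectation (\<lambda>w. Y i w * f (D' i w) (S w - Y i w)) = 0" if i: "i \<in> I" for i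
  proof -
    have "indep_var borel (Y i) borel (\<lambda>w. f (D' i w) (S w - Y i w))"
      using indep_D'[OF i f_meas] by simp
    then show ?thesis
      using bdd_Y[OF i] mean[OF i] bdd_f[OF D'[OF i], of "\<lambda>w. S w - Y i w"] i
      by (intro indep_expectation_zero) auto
  qed
  have pw: "of_bool (\<bar>S w - z\<bar> \<le> D w) * \<eta> w \<le> \<bar>S w\<bar> * D w + b * \<bar>S w\<bar>
      + (\<Sum>i\<in>I. ?g i w)"
    if w: "w \<in> space M" for w
  proof -
    have "of_bool (\<bar>S w - z\<bar>
        \<le> D w) * \<eta> w = (\<Sum>i\<in>I. of_bool (\<bar>S w - z\<bar> \<le> D w) * (Y i w)^2)"
      by (simp add: \<eta>_def sum_distrib_left)
    also have "\<dots> \<le> (\<Sum>i\<in>I. Y i w * (f (D w) (S w) - f (D w) (S w - Y i w)))"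
      unfolding f_def using w by (intro sum_mono clip_mult_diff_ge bound D)
    also have "\<dots> \<le> (\<Sum>i\<in>I. Y i w * f (D w) (S w) + ?g i w)"
    proof (rule sum_mono)
      fix i
      have "Y i w * (f (D' i w) (S w - Y i w) - f (D w) (S w - Y i w))
        \<le> \<bar>Y i w * (f (D' i w) (S w - Y i w) - f (D w) (S w - Y i w))\<bar>" by simp
      also have "\<dots> \<le> \<bar>Y i w\<bar> * \<bar>D' i w - D w\<bar>"
        unfolding abs_mult f_def by (intro mult_left_mono clip_lipschitz) auto
      finally show "Y i w * (f (D w) (S w) - f (D w) (S w - Y i w))
        \<le> Y i w * f (D w) (S w) + ?g i w"
        by (simp add: algebra_simps abs_minus_commute)
    qed
    also have "\<dots> = S w * f (D w) (S w) + (\<Sum>i\<in>I. ?g i w)"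
      unfolding S_def by (simp add: sum.distrib sum_distrib_right)
    also have "S w * f (D w) (S w) \<le> \<bar>S w * f (D w) (S w)\<bar>" by simp
    also have "\<dots> \<le> \<bar>S w\<bar> * (D w + b)"
      unfolding abs_mult using D(2)[OF w] b
      by (intro mult_left_mono) (auto simp: f_def max_def min_def abs_if)
    finally show ?thesis by (simp add: algebra_simps)
  qed
  have bdds: "bdd_rv (\<lambda>w. \<bar>S w\<bar> * D w)" "bdd_rv (\<lambda>w. b * \<bar>S w\<bar>)"
    "bdd_rv (\<lambda>w. of_bool (\<bar>S w - z\<bar> \<le> D w) * \<eta> w)"
    by (intro bdd_intros D bdd_S bdd_eta; measurable)+
  have bddi: "bdd_rv (\<lambda>w. \<bar>Y i w\<bar>
      * \<bar>D w - D' i w\<bar>)" "bdd_rv (\<lambda>w. Y i w * f (D' i w) (S w - Y i w))" if "i \<in> I" for i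
    using that by (intro bdd_intros D D' bdd_Y bdd_f; measurable)+
  have bddsum: "bdd_rv (\<lambda>w. \<Sum>i\<in>I. ?g i w)"
    by (intro bdd_rv_sum bdd_rv_diff bddi)
  have "expectation (\<lambda>w. of_bool (\<bar>S w - z\<bar> \<le> D w) * \<eta> w)
    \<le> expectation (\<lambda>w. \<bar>S w\<bar> * D w + b * \<bar>S w\<bar>
      + (\<Sum>i\<in>I. ?g i w))"
    by (intro integral_mono bdd_rv_integrable pw bdd_rv_add bdds bddsum)
  also have "\<dots> = expectation (\<lambda>w. \<bar>S w\<bar> * D w) + expectation (\<lambda>w. b * \<bar>S w\<bar>)
      + expectation (\<lambda>w. \<Sum>i\<in>I. ?g i w)"
    using bdds[THEN bdd_rv_integrable] bddsum[THEN bdd_rv_integrable] by simp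
  also have "expectation (\<lambda>w. \<Sum>i\<in>I. ?g i w)
     = (\<Sum>i\<in>I. expectation (\<lambda>w. ?g i w))"
    by (intro Bochner_Integration.integral_sum bdd_rv_integrable bdd_rv_diff bddi)
  also have "\<dots> = (\<Sum>i\<in>I. expectation (\<lambda>w. \<bar>Y i w\<bar> * \<bar>D w - D' i w\<bar>))"
    using bddi[THEN bdd_rv_integrable] zero
    by (intro sum.cong refl) simp
  also have "expectation (\<lambda>w. b * \<bar>S w\<bar>) \<le> b"
    using expectation_abs_S b by (simp add: mult_left_le)
  finally show ?thesis by simp
qed

text \<open>Exchanges the plain indicator for the weighted one that the concentration inequality
  controls; the difference is at most |1 - \<eta>|.\<close>

lemma prob_le_expectation_eta:
  assumes [measurable]: "Measurable.pred M P"
  shows "prob {w\<in>space M. P w} \<le> expectation (\<lambda>w. of_bool (P w) * \<eta> w) + b"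
proof -
  have bdd: "bdd_rv (\<lambda>w. of_bool (P w) * \<eta> w)" "bdd_rv (\<lambda>w. \<bar>1 - \<eta> w\<bar>)"
    by (intro bdd_intros bdd_eta; measurable)+
  have "prob {w\<in>space M. P w} = expectation (\<lambda>w. of_bool (P w))"
    by (simp add: expectation_of_bool)
  also have "\<dots> \<le> expectation (\<lambda>w. of_bool (P w) * \<eta> w + \<bar>1 - \<eta> w\<bar>)"
  proof (intro integral_mono bdd_rv_integrable bdd_rv_of_bool bdd_rv_add bdd)
    fix w show "of_bool (P w) \<le> of_bool (P w) * \<eta> w + \<bar>1 - \<eta> w\<bar>" by auto
  qed simp
  also have "\<dots> = expectation (\<lambda>w. of_bool (P w) * \<eta> w)
      + expectation (\<lambda>w. \<bar>1 - \<eta> w\<bar>)"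
    using bdd by (simp add: bdd_rv_integrable)
  finally show ?thesis using expectation_abs_eta_diff by simp
qed

lemma indep_Y_diff:
  assumes i: "i \<in> I"
  shows "indep_var borel (Y i) borel (\<lambda>w. S w - Y i w)"
proof -
  have "insert i (I - {i}) = I" using i by auto
  then have "indep_var borel (Y i) borel (\<lambda>w. \<Sum>j\<in>I-{i}. Y j w)"
    using fin indep by (intro indep_vars_sum) auto
  moreover have "(\<lambda>w. \<Sum>j\<in>I-{i}. Y j w) = (\<lambda>w. S w - Y i w)"
    using fin i by (auto simp: S_def sum.remove fun_eq_iff)
  ultimately show ?thesis by simp
qed

text \<open>Concentration with the deterministic width \<open>b\<close>, which is its own
  leave-one-out version, so that the perturbation sum vanishes.\<close>

lemma small_ball_eta: "expectation (\<lambda>w. of_bool (\<bar>S w - z\<bar> \<le> b) * \<eta> w) \<le> 2 * b"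
proof -
  have "expectation (\<lambda>w. of_bool (\<bar>S w - z\<bar> \<le> b) * \<eta> w)
    \<le> expectation (\<lambda>w. \<bar>S w\<bar> * b) + b
        + (\<Sum>i\<in>I. expectation (\<lambda>w. \<bar>Y i w\<bar> * \<bar>b - b\<bar>))"
  proof (rule concentration)
    fix i and h :: "real \<times> real \<Rightarrow> real"
    assume i: "i \<in> I" and [measurable]: "h \<in> borel_measurable (borel \<Otimes>\<^sub>M borel)"
    have "indep_var borel (id \<circ> Y i) borel ((\<lambda>s. h (s, b)) \<circ> (\<lambda>w. S w - Y i w))"
      by (rule indep_var_compose[OF indep_Y_diff[OF i]]) measurable
    then show "indep_var borel (Y i) borel (\<lambda>w. h (S w - Y i w, b))"
      by (simp add: comp_def id_def)
  qed (use b bdd_rv_const in auto)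
  also have "\<dots> \<le> b + b + 0"
    using expectation_abs_S b by (intro add_mono) (simp_all add: mult_left_le_one_le)
  finally show ?thesis by simp
qed

text \<open>The auxiliary \<open>g\<close> has mean zero because \<open>Y i\<close> is independent
  of \<open>S - Y i\<close>. Adding it to the centred indicator leaves, by Stein's equation,
  \<open>1 - \<eta>\<close> times the derivative of the solution and, up to sign, the Taylor errors.
  The assumption on \<open>b\<close> bounds the second moment of \<open>\<eta>\<close> by 2.\<close>

lemma Berry_Esseen_le_1:
  assumes b1: "b \<le> 1"
  shows "\<bar>prob {w\<in>space M. S w \<le> z} - \<Phi> z\<bar> \<le> (13 + gauss_const) * b"
proof -
  note [measurable] = bdd_rv_measurable[OF bdd_Y]
  let ?f = "stein_sol z"
  let ?e = "\<lambda>i w. Y i w * (?f (S w) - ?f (S w - Y i w) - Y i w * stein_deriv z (S w))"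
  have bdd_f: "bdd_rv (\<lambda>w. ?f (W w))" if [measurable]: "random_variable borel W" for W
    by (rule bdd_rvI[of _ gauss_const]) (auto intro: stein_sol_bound)
  have bdd_f': "bdd_rv (\<lambda>w. stein_deriv z (S w))"
    by (rule bdd_rvI[OF _ stein_deriv_bound]) measurable
  have zero: "expectation (\<lambda>w. Y i w * ?f (S w - Y i w)) = 0" if i: "i \<in> I" for i
  proof -
    have "indep_var borel (id \<circ> Y i) borel (?f \<circ> (\<lambda>w. S w - Y i w))"
      by (rule indep_var_compose[OF indep_Y_diff[OF i]]) auto
    then show ?thesis
      using bdd_Y[OF i] mean[OF i] bdd_f[of "\<lambda>w. S w - Y i w"] i
      by (intro indep_expectation_zero) (auto simp: comp_def id_def)
  qed
  define r where "r w = 2 * \<bar>1 - \<eta> w\<bar> + b * gauss_const * \<eta> w + b * ((\<eta> w)^2 + (S w)^2)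
     + 4 * (of_bool (\<bar>S w - z\<bar> \<le> b) * \<eta> w)" for w
  define g where "g w = (\<Sum>i\<in>I. Y i w * ?f (S w - Y i w))" for w
  have bdd_g: "bdd_rv g"
    unfolding g_def by (intro bdd_rv_sum bdd_rv_mult bdd_f bdd_Y) measurable
  have bdd_r: "bdd_rv r"
    unfolding r_def by (intro bdd_intros bdd_S bdd_eta) measurable
  have "expectation g = 0"
    unfolding g_def using zero
    by (subst Bochner_Integration.integral_sum) (auto intro!: bdd_rv_integrable bdd_rv_mult bdd_f bdd_Y)
  have pw: "\<bar>(of_bool (S w \<le> z) - \<Phi> z) + g w\<bar> \<le> r w" if w: "w \<in> space M" for w
  proof -
    have "of_bool (S w \<le> z) - \<Phi> z = stein_deriv z (S w) - S w * ?f (S w)"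
      by (simp add: stein_deriv_def)
    also have "S w * ?f (S w) = (\<Sum>i\<in>I. Y i w * ?f (S w))"
      unfolding S_def by (simp add: sum_distrib_right)
    also have "\<dots> = g w + (\<Sum>i\<in>I. Y i w * (?f (S w) - ?f (S w - Y i w)))"
      unfolding g_def by (simp add: sum.distrib[symmetric] algebra_simps)
    also have "\<dots> = g w + \<eta> w * stein_deriv z (S w) + (\<Sum>i\<in>I. ?e i w)"
      unfolding \<eta>_def
      by (simp add: sum_distrib_right sum_subtractf right_diff_distrib power2_eq_square mult.assoc)
    finally have eq: "(of_bool (S w \<le> z) - \<Phi> z) + g w = (1 - \<eta> w) * stein_deriv z (S w)
       - (\<Sum>i\<in>I. ?e i w)"
      by (simp add: algebra_simps)
    let ?c = "b * (gauss_const + 2 * \<bar>S w\<bar>) + 4 * of_bool (\<bar>S w - z\<bar> \<le> b)"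
    have "\<bar>\<Sum>i\<in>I. ?e i w\<bar>
        \<le> (\<Sum>i\<in>I. \<bar>Y i w\<bar> * (\<bar>Y i w\<bar> * ?c))"
      by (rule order_trans[OF sum_abs], unfold abs_mult, intro sum_mono mult_left_mono stein_sol_taylor bound w) auto
    also have "\<dots> = \<eta> w * ?c"
      unfolding \<eta>_def by (simp add: sum_distrib_right power2_eq_square mult.assoc[symmetric])
    also have "\<dots> = b * gauss_const * \<eta> w + b * (2 * \<eta> w * \<bar>S w\<bar>)
        + 4 * (of_bool (\<bar>S w - z\<bar> \<le> b) * \<eta> w)"
      by (simp add: algebra_simps)
    also have "\<dots> \<le> b * gauss_const * \<eta> w + b * ((\<eta> w)^2 + (S w)^2)
        + 4 * (of_bool (\<bar>S w - z\<bar> \<le> b) * \<eta> w)"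
      using b sum_squares_bound[of "\<eta> w" "\<bar>S w\<bar>"] by (intro add_mono mult_left_mono order_refl) auto
    finally have 1: "\<bar>\<Sum>i\<in>I. ?e i w\<bar>
      \<le> b * gauss_const * \<eta> w + b * ((\<eta> w)^2 + (S w)^2)
          + 4 * (of_bool (\<bar>S w - z\<bar> \<le> b) * \<eta> w)" .
    have 2: "\<bar>(1 - \<eta> w) * stein_deriv z (S w)\<bar> \<le> \<bar>1 - \<eta> w\<bar> * 2"
      unfolding abs_mult by (intro mult_left_mono stein_deriv_bound) auto
    show ?thesis unfolding eq r_def using 1 2 by linarith
  qed
  have "\<bar>prob {w\<in>space M. S w
      \<le> z} - \<Phi> z\<bar> = \<bar>expectation (\<lambda>w. (of_bool (S w \<le> z) - \<Phi> z) + g w)\<bar>"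
  proof -
    have "integrable M (\<lambda>w. of_bool (S w
        \<le> z) :: real)" by (intro bdd_rv_integrable bdd_rv_of_bool) measurable
    then show ?thesis using bdd_rv_integrable[OF bdd_g] \<open>expectation g = 0\<close>
      by (simp add: expectation_of_bool prob_space)
  qed
  also have "\<dots> \<le> expectation (\<lambda>w. \<bar>(of_bool (S w \<le> z) - \<Phi> z) + g w\<bar>)"
    by (rule integral_abs_bound)
  also have "\<dots> \<le> expectation r"
    by (intro integral_mono bdd_rv_integrable pw bdd_intros bdd_g bdd_r) measurable
  also have "\<dots> = 2 * expectation (\<lambda>w. \<bar>1 - \<eta> w\<bar>) + b * gauss_const
      + b * (expectation (\<lambda>w. (\<eta> w)^2) + 1)
     + 4 * expectation (\<lambda>w. of_bool (\<bar>S w - z\<bar> \<le> b) * \<eta> w)"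
  proof -
    have "bdd_rv (\<lambda>w. \<bar>1 - \<eta> w\<bar>)" "bdd_rv (\<lambda>w. (\<eta> w)^2)"
        "bdd_rv (\<lambda>w. (S w)^2)"
      "bdd_rv (\<lambda>w. of_bool (\<bar>S w - z\<bar>
          \<le> b) * \<eta> w)" by (intro bdd_intros bdd_S bdd_eta; measurable)+
    note i = this[THEN bdd_rv_integrable] bdd_rv_integrable[OF bdd_eta]
    show ?thesis unfolding r_def using i by (simp add: expectation_eta expectation_S_square)
  qed
  \<comment> \<open>The constant 13 is made up of 2 from \<open>1 - \<eta>\<close>, 3 from the
    squares of \<open>\<eta>\<close> and \<open>S\<close>, and 8 from the small ball
    estimate.\<close>
  also have "\<dots> \<le> 2 * b + b * gauss_const + b * (1 + 1 + 1) + 4 * (2 * b)"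
  proof (intro add_mono mult_left_mono expectation_abs_eta_diff small_ball_eta order_refl)
    show "expectation (\<lambda>w. (\<eta> w)^2) \<le> 1 + 1"
      using expectation_eta_square b b1 power_le_one[of b 2] by simp
  qed (use b in auto)
  finally show ?thesis by (simp add: algebra_simps)
qed

lemma Berry_Esseen:
  "\<bar>prob {w\<in>space M. S w \<le> z} - \<Phi> z\<bar> \<le> (13 + gauss_const) * b"
proof (cases "b \<le> 1")
  case False
  have "0 \<le> prob {w\<in>space M. S w \<le> z}" "prob {w\<in>space M. S w \<le> z} \<le> 1" by auto
  then have "\<bar>prob {w\<in>space M. S w \<le> z} - \<Phi> z\<bar> \<le> 1 * 1"
    unfolding abs_le_iff using Phi_nonneg[of z] Phi_le_1[of z] by linarith
  also have "\<dots> \<le> (13 + gauss_const) * b"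
    using False gauss_const_pos by (intro mult_mono) auto
  finally show ?thesis .
qed (rule Berry_Esseen_le_1)

text \<open>The perturbation \<open>D\<close> need not be independent of the summands; what counts is how well it
  is approximated by the \<open>D' i\<close>, which do not depend on the \<open>i\<close>-th summand (Chen and Shao).\<close>

theorem Berry_Esseen_perturbed:
  assumes D: "bdd_rv D" "\<And>w. w \<in> space M \<Longrightarrow> 0 \<le> D w"
    and D': "\<And>i. i \<in> I \<Longrightarrow> bdd_rv (D' i)"
    and indep_D': "\<And>i h. i \<in> I
        \<Longrightarrow> h \<in> borel_measurable (borel \<Otimes>\<^sub>M borel) \<Longrightarrow>
      indep_var borel (Y i) borel (\<lambda>w. h (S w - Y i w, D' i w))"
    and T [measurable]: "random_variable borel T" and B: "B \<in> events"
    and TS: "\<And>w. w \<in> space M - B \<Longrightarrow> \<bar>T w - S w\<bar> \<le> D w"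
  shows "\<bar>prob {w\<in>space M. T w \<le> z} - \<Phi> z\<bar>
    \<le> prob B + (15 + gauss_const) * b + expectation (\<lambda>w. \<bar>S w\<bar> * D w)
      + (\<Sum>i\<in>I. expectation (\<lambda>w. \<bar>Y i w\<bar> * \<bar>D w - D' i w\<bar>))"
proof -
  note [measurable] = bdd_rv_measurable[OF D(1)] B
  let ?A = "{w\<in>space M. \<bar>S w - z\<bar> \<le> D w}"
  let ?T = "{w\<in>space M. T w \<le> z}" and ?S = "{w\<in>space M. S w \<le> z}"
  have meas: "?A \<in> events" "?T \<in> events" "?S \<in> events" "?A \<union> B \<in> events" by measurable
  \<comment> \<open>Off \<open>B\<close>, if \<open>T\<close> and \<open>S\<close> lie on different
    sides of \<open>z\<close>, then \<open>S\<close> is within \<open>D\<close> of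
    \<open>z\<close>.\<close>
  have sub: "?T \<subseteq> ?S \<union> (?A \<union> B)" "?S \<subseteq> ?T \<union> (?A \<union> B)"
    using TS by (fastforce simp: abs_le_iff)+
  have "prob ?T \<le> prob ?S + prob (?A \<union> B)"
    using finite_measure_mono[OF sub(1) sets.Un[OF meas(3,4)]] measure_Un_le[OF meas(3,4)] by linarith
  moreover have "prob ?S \<le> prob ?T + prob (?A \<union> B)"
    using finite_measure_mono[OF sub(2) sets.Un[OF meas(2,4)]] measure_Un_le[OF meas(2,4)] by linarith
  moreover have "prob (?A \<union> B) \<le> prob ?A + prob B"
    using meas B by (intro measure_Un_le)
  moreover have "prob ?A \<le> expectation (\<lambda>w. of_bool (\<bar>S w - z\<bar> \<le> D w) * \<eta> w) + b"
    by (rule prob_le_expectation_eta) measurable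
  moreover note concentration[OF D D' indep_D', of z] Berry_Esseen[of z]
  \<comment> \<open>One additional \<open>b\<close> comes from weighting the indicator by
    \<open>\<eta>\<close>, the other from the concentration inequality.\<close>
  moreover have "(15 + gauss_const) * b = (13 + gauss_const) * b + b + b"
    by (simp add: algebra_simps)
  ultimately show ?thesis by linarith
qed

end

section \<open>Counts near a quantile\<close>

context prob_space
begin

text \<open>The source of leave-one-out independence for counts and remainders. It asks for
  functionals on a product space, which is why these are later written as functions of the
  coordinates.\<close>

lemma indep_var_split:
  assumes indep: "indep_vars (\<lambda>_. borel) X I" and i: "i \<in> I"
    and f: "f \<in> borel_measurable borel"
    and g: "g \<in> borel_measurable (PiM (I - {i}) (\<lambda>_. borel))"
  shows "indep_var borel (\<lambda>w. f (X i w)) borel (\<lambda>w. g (restrict (\<lambda>j. X j w) (I - {i})))"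
proof -
  have [measurable]: "(\<lambda>x. f (x i)) \<in> borel_measurable (PiM {i} (\<lambda>_. borel))"
    by (rule measurable_compose[OF _ f]) (rule measurable_component_singleton, simp)
  have "indep_var borel ((\<lambda>x. f (x i)) \<circ> (\<lambda>w. restrict (\<lambda>j. X j w) {i}))
      borel (g \<circ> (\<lambda>w. restrict (\<lambda>j. X j w) (I - {i})))"
    by (rule indep_var_compose[OF indep_var_restrict[OF indep]]) (use i g in auto)
  then show ?thesis by (simp add: comp_def)
qed

text \<open>The binomial generating function is dominated by the Poisson one through
  \<open>1 + x \<le> exp x\<close>.\<close>

lemma expectation_exp_count_le:
  fixes V :: "'i \<Rightarrow> 'a \<Rightarrow> real" and p s t :: real
  assumes fin: "finite I" and indep: "indep_vars (\<lambda>_. borel) V I"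
    and p: "\<And>i. i \<in> I \<Longrightarrow> prob {w\<in>space M. V i w \<le> t} = p"
  shows "expectation (\<lambda>w. exp (s * (\<Sum>i\<in>I. of_bool (V i w \<le> t))))
      \<le> exp (card I * p * (exp s - 1))"
proof (cases "I = {}")
  case True
  then show ?thesis by (simp add: prob_space)
next
  case False
  have [measurable]: "random_variable borel (V i)" if "i \<in> I" for i
    using indep that by (simp add: indep_vars_def)
  have eq: "exp (s * of_bool Q) = 1 + (exp s - 1) * of_bool Q" for Q by (cases Q) auto
  have bdd: "bdd_rv (\<lambda>w. exp (s * of_bool (V i w \<le> t)))" if "i \<in> I" for i
    unfolding eq using that by (intro bdd_intros) measurable
  from False obtain i where "i \<in> I" by blast
  then have "0 \<le> p" "p \<le> 1" using p[of i] by auto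
  have "expectation (\<lambda>w. exp (s * (\<Sum>i\<in>I. of_bool (V i w \<le> t))))
      = expectation (\<lambda>w. \<Prod>i\<in>I. exp (s * of_bool (V i w \<le> t)))"
    unfolding sum_distrib_left exp_sum[OF fin] ..
  also have "\<dots> = (\<Prod>i\<in>I. expectation (\<lambda>w. exp (s * of_bool (V i w \<le> t))))"
    by (intro indep_vars_lebesgue_integral fin bdd_rv_integrable bdd
      indep_vars_compose2[OF indep, of "\<lambda>_ v. exp (s * of_bool (v \<le> t))"]) measurable
  also have "\<dots> = (\<Prod>i\<in>I. 1 + (exp s - 1) * p)"
  proof (rule prod.cong[OF refl])
    fix i assume i: "i \<in> I"
    then have [measurable]: "random_variable borel (V i)" by simp
    have "bdd_rv (\<lambda>w. of_bool (V i w \<le> t))" by (intro bdd_intros) measurable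
    from bdd_rv_integrable[OF this]
    show "expectation (\<lambda>w. exp (s * of_bool (V i w \<le> t))) = 1 + (exp s - 1) * p"
      unfolding eq by (simp add: prob_space expectation_of_bool p i)
  qed
  also have "\<dots> \<le> (\<Prod>i\<in>I. exp (p * (exp s - 1)))"
  proof (rule prod_mono)
    have "0 \<le> (1 - p) + exp s * p" using \<open>0 \<le> p\<close> \<open>p \<le> 1\<close> by simp
    then show "0 \<le> 1 + (exp s - 1) * p \<and> 1 + (exp s - 1) * p \<le> exp (p * (exp s - 1))"
      using exp_ge_add_one_self[of "p * (exp s - 1)"] by (simp add: algebra_simps)
  qed
  also have "\<dots> = exp (card I * p * (exp s - 1))"
    by (simp add: exp_of_nat_mult[symmetric] mult.assoc)
  finally show ?thesis .
qed

end

section \<open>Chernoff exponents for deviations on the scale of the square root of the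
  count\<close>

lemma exp_minus_le_quadratic:
  fixes x :: real
  assumes "0 \<le> x"
  shows "exp (- x) \<le> 1 - x + x^2 / 2"
proof -
  have "(1 - 0 + 0^2 / 2) - exp (- 0) \<le> (1 - x + x^2 / 2) - exp (- x)"
  proof (rule DERIV_nonneg_imp_nondecreasing[OF assms])
    fix y :: real
    have "((\<lambda>y. (1 - y + y^2 / 2) - exp (- y)) has_real_derivative (- 1 + y + exp (- y))) (at y)"
      by (rule derivative_eq_intros refl | simp)+
    moreover have "0 \<le> - 1 + y + exp (- y)" using exp_ge_add_one_self[of "- y"] by simp
    ultimately show "\<exists>l. ((\<lambda>y. (1 - y
        + y^2 / 2) - exp (- y)) has_real_derivative l) (at y) \<and> 0 \<le> l"
      by blast
  qed
  then show ?thesis by simp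
qed

lemma square_pos_part_le_exp:
  fixes x \<theta> :: real
  assumes "0 < \<theta>"
  shows "(max 0 x)^2 \<le> 2 / \<theta>^2 * exp (\<theta> * x)"
proof (cases "0 \<le> x")
  case True
  have nn: "0 \<le> \<theta> * x" using True assms by simp
  then have "(\<theta> * x)^2 / 2 \<le> exp (\<theta> * x)"
    using exp_lower_Taylor_quadratic[OF nn] by linarith
  then show ?thesis using True assms by (simp add: field_simps power_mult_distrib)
qed (use assms in simp)

text \<open>Here \<open>u\<close> stands for \<open>sqrt k\<close>, \<open>x\<close> for the
  deviation in units of \<open>u\<close>, and \<open>q\<close> for the expected count; the
  \<open>- 1\<close> allows for one deleted variable. The tilt \<open>1 / u\<close> gives a decay
  linear in \<open>x\<close>, which suffices for geometric series.\<close>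

lemma Chernoff_exponent_lower:
  fixes u x q :: real
  assumes u: "1 \<le> u" and x: "0 \<le> x" and q: "u^2 + x * u - 1 \<le> q"
  shows "u + q * (exp (- (1 / u)) - 1) \<le> 2 - x / 2"
proof -
  define \<theta> where "\<theta> = 1 / u"
  have \<theta>: "0 < \<theta>" "\<theta> \<le> 1" "\<theta> * u = 1" using u by (simp_all add: \<theta>_def)
  have "exp (- \<theta>) - 1
      \<le> - (\<theta> - \<theta>^2 / 2)" using exp_minus_le_quadratic[of \<theta>] \<theta> by simp
  moreover have pos: "0 \<le> \<theta> - \<theta>^2 / 2"
  proof -
    have "\<theta>^2 \<le> \<theta>" using \<theta> by (simp add: power2_eq_square mult_left_le)
    then show ?thesis using \<theta> by linarith
  qed
  moreover have "0 \<le> q"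
  proof -
    have "1 \<le> u^2" "0 \<le> x * u" using u x by simp_all
    then show ?thesis using q by linarith
  qed
  ultimately have "q * (exp (- \<theta>) - 1) \<le> q * (- (\<theta> - \<theta>^2 / 2))"
    by (intro mult_left_mono)
  also have "\<dots> \<le> (u^2 + x * u - 1) * (- (\<theta> - \<theta>^2 / 2))"
    using q pos by (intro mult_right_mono_neg) auto
  also have "\<dots> = - (\<theta> * u) * u - x * (\<theta> * u) + \<theta> + (\<theta> * u)^2 / 2
      + x * (\<theta> * u) * \<theta> / 2 - \<theta>^2 / 2"
    by (simp add: power2_eq_square algebra_simps)
  also have "\<dots> = - u - x + \<theta> + 1 / 2 + x * \<theta> / 2 - \<theta>^2 / 2"
    unfolding \<theta>(3) by simp
  finally have "q * (exp (- \<theta>) - 1) \<le> - u - x + \<theta> + 1 / 2 + x * \<theta> / 2 - \<theta>^2 / 2" .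
  moreover have "x * \<theta> \<le> x" using \<theta> x by (simp add: mult_left_le)
  moreover have "0 \<le> \<theta>^2" by simp
  ultimately have "u + q * (exp (- \<theta>) - 1) \<le> 2 - x / 2" using \<theta>(2) by linarith
  then show ?thesis by (simp add: \<theta>_def)
qed

text \<open>The counterpart for counts that are too large, by
  \<open>exp \<theta> - 1 \<le> \<theta> + \<theta>^2\<close>. No unit is subtracted here, since
  deleting a variable can only lower the expected count.\<close>

lemma Chernoff_exponent_upper:
  fixes u x q :: real
  assumes u: "1 \<le> u" and x: "0 \<le> x" and q: "0 \<le> q" "q \<le> u^2 - x * u"
  shows "- u + q * (exp (1 / u) - 1) \<le> 2 - x / 2"
proof -
  define \<theta> where "\<theta> = 1 / u"
  have \<theta>: "0 < \<theta>" "\<theta> \<le> 1" "\<theta> * u = 1" using u by (simp_all add: \<theta>_def)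
  have "exp \<theta> - 1 \<le> \<theta> + \<theta>^2" using exp_bound[of \<theta>] \<theta> by simp
  then have "q * (exp \<theta> - 1) \<le> q * (\<theta> + \<theta>^2)" using q by (intro mult_left_mono)
  also have "\<dots> \<le> (u^2 - x * u) * (\<theta> + \<theta>^2)"
    using q \<theta> by (intro mult_right_mono) auto
  also have "\<dots> = (\<theta> * u) * u - x * (\<theta> * u) + (\<theta> * u)^2 - x * (\<theta> * u) * \<theta>"
    by (simp add: power2_eq_square algebra_simps)
  also have "\<dots> = u - x + 1 - x * \<theta>" unfolding \<theta>(3) by simp
  finally have "- u + q * (exp \<theta> - 1) \<le> 2 - x / 2"
    using x \<theta>(1) mult_nonneg_nonneg[of x \<theta>] by linarith
  then show ?thesis by (simp add: \<theta>_def)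
qed

text \<open>Grid points at distance \<open>A * j / sqrt k\<close> from the quantile \<open>- A\<close>; the counts at these points
  differ from \<open>k\<close> by multiples of \<open>sqrt k\<close>, the order of their standard deviations.\<close>

locale tail_counts = prob_space M for M :: "'a measure" +
  fixes I :: "nat set" and X :: "nat \<Rightarrow> 'a \<Rightarrow> real" and v :: "real \<Rightarrow> real"
    and G :: "real \<Rightarrow> real" and A k c K :: real and J :: nat
  assumes fin: "finite I" "I \<noteq> {}" and indep: "indep_vars (\<lambda>_. borel) X I"
    and v_meas [measurable]: "v \<in> borel_measurable borel"
    and prob_v: "\<And>i t. i \<in> I \<Longrightarrow> prob {w\<in>space M. v (X i w) \<le> t} = G t"
    and A: "0 < A" and k: "1 \<le> k" and c: "0 < c" and K: "0 < K"
    and G_grid: "\<And>j. j \<le> J \<Longrightarrow> k + c * real j * sqrt k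
        \<le> card I * G (- A * (1 - real j / sqrt k))"
      "\<And>j. j \<le> J \<Longrightarrow> card I * G (- A * (1 + real j / sqrt k)) \<le> k - c * real j * sqrt k"
      "\<And>j. j \<le> J \<Longrightarrow> card I * G (- A * (1 - real j / sqrt k)) \<le> K * k"
begin

definition N :: "nat set \<Rightarrow> real \<Rightarrow> 'a \<Rightarrow> real" where
  "N L t = (\<lambda>w. \<Sum>i\<in>L. of_bool (v (X i w) \<le> t))"

definition up :: "nat \<Rightarrow> real" where "up j = - A * (1 - real j / sqrt k)"

definition dn :: "nat \<Rightarrow> real" where "dn j = - A * (1 + real j / sqrt k)"

text \<open>A majorant of the remainder from one tail. The index set is a parameter so that
  \<open>D (I - {i})\<close> is the leave-one-out version.\<close>

definition D :: "nat set \<Rightarrow> 'a \<Rightarrow> real" where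
  "D L = (\<lambda>w. A / sqrt k * (\<Sum>j<J. max 0 (k - N L (up j) w) + max 0 (N L (dn j) w - k)))"

lemmas G_up = G_grid(1)[folded up_def] and G_dn = G_grid(2)[folded dn_def]
  and G_le = G_grid(3)[folded up_def]

text \<open>Chosen such that the Chernoff factor \<open>exp (- c * j / 2)\<close> equals
  \<open>r ^ (2 * j)\<close>; its square root \<open>r ^ j\<close> survives when a count deviation
  is multiplied by another variable.\<close>

definition r :: real where "r = exp (- c / 4)"

lemma r: "0 < r" "r < 1"
  using c by (simp_all add: r_def)

lemma sqrt_k: "1 \<le> sqrt k" "(sqrt k)^2 = k"
  using k by simp_all

lemma measurable_X: "i \<in> I \<Longrightarrow> random_variable borel (X i)"
  using indep by (simp add: indep_vars_def)

lemma bdd_N: "L \<subseteq> I \<Longrightarrow> bdd_rv (N L t)"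
  unfolding N_def
proof (rule bdd_rv_sum)
  fix i assume "L \<subseteq> I" "i \<in> L"
  then have [measurable]: "random_variable borel (X i)" using measurable_X by auto
  show "bdd_rv (\<lambda>w. of_bool (v (X i w) \<le> t))" by (intro bdd_intros) measurable
qed

lemma bdd_D: "L \<subseteq> I \<Longrightarrow> bdd_rv (D L)"
  unfolding D_def by (intro bdd_intros bdd_N)

lemma D_nonneg: "0 \<le> D L w"
  unfolding D_def using A k by (intro mult_nonneg_nonneg sum_nonneg) auto

lemma bdd_exp:
  assumes "bdd_rv W" shows "bdd_rv (\<lambda>w. exp (W w))"
proof -
  from assms obtain d where "\<forall>w\<in>space M. \<bar>W w\<bar>
      \<le> d" and [measurable]: "random_variable borel W"
    unfolding bdd_rv_def by blast
  then show ?thesis by (intro bdd_rvI[of _ "exp d"]) (auto simp: abs_le_iff)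
qed

lemma exp_moment:
  fixes p s t :: real
  assumes L: "L \<subseteq> I" and p: "G t = p"
  shows "expectation (\<lambda>w. exp (s * N L t w)) \<le> exp (card L * p * (exp s - 1))"
  unfolding N_def
proof (rule expectation_exp_count_le)
  show "indep_vars (\<lambda>_. borel) (\<lambda>i w. v (X i w)) L"
    by (rule indep_vars_compose2[OF indep_vars_subset[OF indep L]]) measurable
  show "finite L" using L fin by (auto intro: finite_subset)
qed (use L p prob_v in auto)

lemma G_nonneg: "0 \<le> G t" and G_le_1: "G t \<le> 1"
  using fin(2) prob_v[of _ t] by (metis ex_in_conv measure_nonneg, metis ex_in_conv prob_le_1)

lemma exp_moment_shift:
  assumes "L \<subseteq> I"
  shows "expectation (\<lambda>w. exp (s * (N L t w - k) / sqrt k))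
    \<le> exp (- s * sqrt k + card L * G t * (exp (s / sqrt k) - 1))"
proof -
  have e: "s * (x - k) / sqrt k = - s * sqrt k + s / sqrt k * x" for x
    using k by (simp add: right_diff_distrib diff_divide_distrib times_divide_eq_right[symmetric] real_div_sqrt
      del: times_divide_eq_right)
  have "expectation (\<lambda>w. exp (s * (N L t w - k) / sqrt k))
      = exp (- s * sqrt k) * expectation (\<lambda>w. exp (s / sqrt k * N L t w))"
    unfolding e exp_add by (rule Bochner_Integration.integral_mult_right_zero)
  also have "\<dots> \<le> exp (- s * sqrt k) * exp (card L * G t * (exp (s / sqrt k) - 1))"
    by (intro mult_left_mono exp_moment assms refl exp_ge_zero)
  finally show ?thesis by (simp only: exp_add)
qed

text \<open>The condition on \<open>card L\<close> covers \<open>I\<close> and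
  \<open>I - {i}\<close> at once; losing one observation lowers the expected count by at most
  one.\<close>

lemma exp_moment_up:
  assumes j: "j \<le> J" and L: "L \<subseteq> I" "card I \<le> card L + 1"
  shows "expectation (\<lambda>w. exp ((k - N L (up j) w) / sqrt k)) \<le> exp 2 * r ^ (2 * j)"
proof -
  let ?u = "sqrt k"
  have "real (card I) * G (up j) \<le> (real (card L) + 1) * G (up j)"
    using L G_nonneg by (intro mult_right_mono) auto
  then have q: "?u^2 + (c * j) * ?u - 1 \<le> card L * G (up j)"
    using G_up[OF j] G_le_1[of "up j"] sqrt_k(2) by (simp add: algebra_simps)
  have "expectation (\<lambda>w. exp ((k - N L (up j) w) / ?u))
      \<le> exp (?u + card L * G (up j) * (exp (- (1 / ?u)) - 1))"
    using exp_moment_shift[OF L(1), of "- 1" "up j"] by simp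
  also have "\<dots> \<le> exp (2 - (c * j) / 2)"
    using Chernoff_exponent_lower[OF sqrt_k(1) _ q] c by simp
  also have "\<dots> = exp 2 * r ^ (2 * j)"
    by (simp add: r_def exp_of_nat_mult[symmetric] exp_add[symmetric])
  finally show ?thesis .
qed

lemma exp_moment_dn:
  assumes j: "j \<le> J" and L: "L \<subseteq> I"
  shows "expectation (\<lambda>w. exp ((N L (dn j) w - k) / sqrt k)) \<le> exp 2 * r ^ (2 * j)"
proof -
  let ?u = "sqrt k"
  have "real (card L) * G (dn j) \<le> real (card I) * G (dn j)"
    using L fin G_nonneg by (intro mult_right_mono) (auto intro: card_mono)
  then have q: "card L * G (dn j) \<le> ?u^2 - (c * j) * ?u"
    using G_dn[OF j] sqrt_k(2) by simp
  have "expectation (\<lambda>w. exp ((N L (dn j) w - k) / ?u))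
      \<le> exp (- ?u + card L * G (dn j) * (exp (1 / ?u) - 1))"
    using exp_moment_shift[OF L, of 1 "dn j"] by simp
  also have "\<dots> \<le> exp (2 - (c * j) / 2)"
    using Chernoff_exponent_upper[OF sqrt_k(1) _ _ q] c G_nonneg by simp
  also have "\<dots> = exp 2 * r ^ (2 * j)"
    by (simp add: r_def exp_of_nat_mult[symmetric] exp_add[symmetric])
  finally show ?thesis .
qed

lemma expectation_mult_pos_part_le:
  assumes S: "bdd_rv S" "expectation (\<lambda>w. (S w)^2) \<le> 1" and W: "bdd_rv W"
    and exp: "expectation (\<lambda>w. exp (W w / sqrt k)) \<le> exp 2 * r ^ (2 * j)"
  shows "expectation (\<lambda>w. \<bar>S w\<bar> * max 0 (W w)) \<le> (1 + exp 2) * sqrt k * r ^ j"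
proof -
  \<comment> \<open>The weight for Young's inequality: by the exponential moment, the positive part
    of \<open>W\<close> has a second moment of order \<open>l^2\<close>.\<close>
  define l where "l = sqrt k * r ^ j"
  have l: "0 < l" using k r by (simp add: l_def)
  have bdd: "bdd_rv (\<lambda>w. (S w)^2)" "bdd_rv (\<lambda>w. exp (W w / sqrt k))"
    by (intro bdd_intros bdd_exp S W)+
  have "expectation (\<lambda>w. \<bar>S w\<bar> * max 0 (W w))
      \<le> expectation (\<lambda>w. l / 2 * (S w)^2 + k / l * exp (W w / sqrt k))"
  proof (intro integral_mono bdd_rv_integrable bdd_rv_add bdd_rv_mult bdd_rv_abs bdd_rv_max bdd_rv_const bdd S W)
    fix w
    have "\<bar>S w\<bar> * max 0 (W w) \<le> l / 2 * (S w)^2 + (max 0 (W w))^2 / (2 * l)"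
    proof -
      have "0 \<le> (l * \<bar>S w\<bar> - max 0 (W w))^2" by simp
      also have "\<dots> = l^2 * (S w)^2 - 2 * l * (\<bar>S w\<bar> * max 0 (W w)) + (max 0 (W w))^2"
        by (simp add: power2_diff power_mult_distrib mult.assoc)
      finally show ?thesis using l by (simp add: field_simps power2_eq_square)
    qed
    also have "(max 0 (W w))^2 \<le> 2 * k * exp (W w / sqrt k)"
      using square_pos_part_le_exp[of "1 / sqrt k" "W w"] k by (simp add: power_divide)
    then have "(max 0 (W w))^2 / (2 * l) \<le> 2 * k * exp (W w / sqrt k) / (2 * l)"
      using l by (intro divide_right_mono) auto
    also have "\<dots> = k / l * exp (W w / sqrt k)" by simp
    finally show "\<bar>S w\<bar> * max 0 (W w) \<le> l / 2 * (S w)^2 + k / l * exp (W w / sqrt k)"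
      by simp
  qed
  also have "\<dots> = l / 2 * expectation (\<lambda>w. (S w)^2)
      + k / l * expectation (\<lambda>w. exp (W w / sqrt k))"
    using bdd[THEN bdd_rv_integrable] by simp
  also have "\<dots> \<le> l / 2 * 1 + k / l * (exp 2 * r ^ (2 * j))"
    using l k by (intro add_mono mult_left_mono S exp) auto
  also have "k / l * (exp 2 * r ^ (2 * j)) = exp 2 * l"
  proof -
    have "r ^ (2 * j) * k = l * l"
      unfolding l_def using sqrt_k(2)
          by (simp add: power_mult power2_eq_square power_mult_distrib mult_ac power_even_eq)
    then show ?thesis using l by (simp add: field_simps)
  qed
  also have "l / 2 * 1 + exp 2 * l \<le> (1 + exp 2) * l" using l by (simp add: algebra_simps)
  finally show ?thesis by (simp add: l_def mult.assoc)
qed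

lemma sum_geometric_le: "(\<Sum>j<J. r ^ j) \<le> 1 / (1 - r)"
  using r by (simp add: sum_gp_strict divide_right_mono)

text \<open>The \<open>j\<close>-th grid point contributes the order \<open>sqrt k * r ^ j\<close>;
  the mesh \<open>A / sqrt k\<close> cancels \<open>sqrt k\<close>, and the geometric series leaves
  a multiple of \<open>A\<close>.\<close>

lemma expectation_mult_D_le:
  assumes S: "bdd_rv S" "expectation (\<lambda>w. (S w)^2) \<le> 1"
  shows "expectation (\<lambda>w. \<bar>S w\<bar> * D I w) \<le> A * (2 * (1 + exp 2) / (1 - r))"
proof -
  let ?U = "\<lambda>j w. \<bar>S w\<bar> * max 0 (k - N I (up j) w)" and ?L
      = "\<lambda>j w. \<bar>S w\<bar> * max 0 (N I (dn j) w - k)"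
  have bdd: "bdd_rv (?U j)" "bdd_rv (?L j)" for j
    by (intro bdd_intros S bdd_N order_refl)+
  note int = this[THEN bdd_rv_integrable]
  have "expectation (\<lambda>w. \<bar>S w\<bar> * D I w)
      = expectation (\<lambda>w. A / sqrt k * (\<Sum>j<J. ?U j w + ?L j w))"
    unfolding D_def by (simp add: sum_distrib_left distrib_left mult_ac)
  also have "\<dots> = A / sqrt k * (\<Sum>j<J. expectation (?U j) + expectation (?L j))"
    using int by simp
  also have "\<dots> \<le> A / sqrt k * (\<Sum>j<J. (1 + exp 2) * sqrt k * r ^ j + (1 + exp 2) * sqrt k * r ^ j)"
    using A k
    by (intro mult_left_mono sum_mono add_mono expectation_mult_pos_part_le S bdd_intros bdd_N order_refl
      exp_moment_up exp_moment_dn) auto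
  also have "\<dots> = A / sqrt k * (\<Sum>j<J. 2 * (1 + exp 2) * sqrt k * r ^ j)"
    by (simp add: algebra_simps)
  also have "\<dots> = A * (2 * (1 + exp 2)) * (\<Sum>j<J. r ^ j)"
    unfolding sum_distrib_left[symmetric] using k by simp
  also have "\<dots> \<le> A * (2 * (1 + exp 2)) * (1 / (1 - r))"
    using A by (intro mult_left_mono sum_geometric_le) (simp add: add_nonneg_nonneg)
  finally show ?thesis by simp
qed

lemma prob_count_up:
  assumes "j \<le> J" "L \<subseteq> I" "card I \<le> card L + 1"
  shows "prob {w\<in>space M. N L (up j) w < k} \<le> exp 2 * r ^ (2 * j)"
proof -
  note [measurable] = bdd_rv_measurable[OF bdd_N[OF assms(2)]]
  have "prob {w\<in>space M. N L (up j) w < k} = expectation (\<lambda>w. of_bool (N L (up j) w < k))"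
    by (simp add: expectation_of_bool)
  also have "\<dots> \<le> expectation (\<lambda>w. exp ((k - N L (up j) w) / sqrt k))"
  proof (intro integral_mono bdd_rv_integrable bdd_exp bdd_intros bdd_N assms)
    fix w show "of_bool (N L (up j) w < k) \<le> exp ((k - N L (up j) w) / sqrt k)"
      using k by (cases "N L (up j) w < k") auto
  qed measurable
  also have "\<dots> \<le> exp 2 * r ^ (2 * j)" by (rule exp_moment_up[OF assms])
  finally show ?thesis .
qed

text \<open>The threshold is \<open>k - 1\<close> because adding the deleted variable back can lift
  the count above \<open>k\<close> as soon as the others exceed \<open>k - 1\<close>. Moving the
  threshold by one costs the factor \<open>exp 1\<close>.\<close>

lemma prob_count_dn:
  assumes "j \<le> J" "L \<subseteq> I"
  shows "prob {w\<in>space M. k - 1 < N L (dn j) w} \<le> exp 3 * r ^ (2 * j)"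
proof -
  note [measurable] = bdd_rv_measurable[OF bdd_N[OF assms(2)]]
  have "prob {w\<in>space M. k - 1 < N L (dn j) w} = expectation (\<lambda>w. of_bool (k - 1 < N L (dn j) w))"
    by (simp add: expectation_of_bool)
  also have "\<dots> \<le> expectation (\<lambda>w. exp 1 * exp ((N L (dn j) w - k) / sqrt k))"
  proof (intro integral_mono bdd_rv_integrable bdd_exp bdd_intros bdd_N assms)
    fix w show "of_bool (k - 1 < N L (dn j) w) \<le> exp 1 * exp ((N L (dn j) w - k) / sqrt k)"
    proof (cases "k - 1 < N L (dn j) w")
      case True
      have "(- 1) / sqrt k \<le> (N L (dn j) w - k) / sqrt k"
        using True k by (intro divide_right_mono) auto
      moreover have "1 / sqrt k \<le> 1" using sqrt_k by simp
      ultimately show ?thesis using True by (simp add: exp_add[symmetric])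
    qed simp
  qed measurable
  also have "\<dots> = exp 1 * expectation (\<lambda>w. exp ((N L (dn j) w - k) / sqrt k))" by simp
  also have "\<dots> \<le> exp 1 * (exp 2 * r ^ (2 * j))"
    by (intro mult_left_mono exp_moment_dn assms) simp
  finally show ?thesis by (simp add: exp_add[symmetric] mult.assoc[symmetric])
qed

text \<open>Off this event the grid reaches beyond the empirical quantile on both sides, as the
  deterministic comparison with the Winsorized sum requires.\<close>

lemma prob_bad:
  "prob {w\<in>space M. N I (up J) w < k \<or> k - 1 < N I (dn J) w} \<le> 2 * exp 3 * r ^ (2 * J)"
proof -
  have meas: "random_variable borel (N I t)" for t
    by (rule bdd_rv_measurable[OF bdd_N[OF order_refl]])
  define B1 B2 where "B1 = {w\<in>space M. N I (up J) w < k}" and "B2 = {w\<in>space M. k - 1 < N I (dn J) w}"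
  have sets: "B1 \<in> events" "B2 \<in> events"
    unfolding B1_def B2_def by (intro borel_measurable_less meas borel_measurable_const)+
  have eq: "{w\<in>space M. N I (up J) w < k \<or> k - 1 < N I (dn J) w} = B1 \<union> B2"
    by (auto simp: B1_def B2_def)
  have "prob (B1 \<union> B2) \<le> prob B1 + prob B2" by (rule measure_Un_le[OF sets])
  moreover have "prob B1 \<le> exp 2 * r ^ (2 * J)"
    unfolding B1_def by (rule prob_count_up) auto
  moreover have "prob B2 \<le> exp 3 * r ^ (2 * J)"
    unfolding B2_def by (rule prob_count_dn) auto
  moreover have "exp 2 * r ^ (2 * J) \<le> exp 3 * r ^ (2 * J)"
    using r by (intro mult_right_mono) auto
  ultimately show ?thesis unfolding eq by linarith
qed

lemma N_remove: "i \<in> I \<Longrightarrow> N I t w = of_bool (v (X i w) \<le> t) + N (I - {i}) t w"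
  unfolding N_def using fin by (simp add: sum.remove del: sum_of_bool_eq)

text \<open>Deleting a variable changes each positive part by at most one, and only if the variable
  is counted at that grid point and the count of the others leaves the positive part active.\<close>

lemma D_diff_le:
  assumes i: "i \<in> I"
  shows "\<bar>D I w - D (I - {i}) w\<bar> \<le> A / sqrt k * (\<Sum>j<J.
    of_bool (v (X i w) \<le> up j) * of_bool (N (I - {i}) (up j) w < k)
    + of_bool (v (X i w) \<le> dn j) * of_bool (k - 1 < N (I - {i}) (dn j) w))"
proof -
  have up: "\<bar>max 0 (k - N I t w) - max 0 (k - N (I - {i}) t w)\<bar>
      \<le> of_bool (v (X i w) \<le> t) * of_bool (N (I - {i}) t w < k)" for t
    unfolding N_remove[OF i] by (auto simp: max_def abs_if)
  have dn: "\<bar>max 0 (N I t w - k) - max 0 (N (I - {i}) t w - k)\<bar>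
      \<le> of_bool (v (X i w) \<le> t) * of_bool (k - 1 < N (I - {i}) t w)" for t
    unfolding N_remove[OF i] by (auto simp: max_def abs_if)
  have "\<bar>D I w - D (I - {i}) w\<bar>
      = A / sqrt k * \<bar>\<Sum>j<J. (max 0 (k - N I (up j) w) - max 0 (k - N (I - {i}) (up j) w))
     + (max 0 (N I (dn j) w - k) - max 0 (N (I - {i}) (dn j) w - k))\<bar>"
    unfolding D_def right_diff_distrib[symmetric] abs_mult sum_subtractf[symmetric]
    using A k by (simp add: algebra_simps)
  also have "\<dots> \<le> A / sqrt k * (\<Sum>j<J.
    of_bool (v (X i w) \<le> up j) * of_bool (N (I - {i}) (up j) w < k)
    + of_bool (v (X i w) \<le> dn j) * of_bool (k - 1 < N (I - {i}) (dn j) w))"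
    using A k
    by (intro mult_left_mono order_trans[OF sum_abs] sum_mono order_trans[OF abs_triangle_ineq] add_mono up dn) auto
  finally show ?thesis .
qed

lemma measurable_N_restrict [measurable]:
  "(\<lambda>x. \<Sum>l\<in>L. of_bool (v (x l)
      \<le> t) :: real) \<in> borel_measurable (PiM L (\<lambda>_. borel :: real measure))"
proof (intro borel_measurable_sum)
  fix l assume "l \<in> L"
  then have [measurable]: "(\<lambda>x. x l) \<in> borel_measurable (PiM L (\<lambda>_. borel :: real measure))"
    by (rule measurable_component_singleton)
  show "(\<lambda>x. of_bool (v (x l)
      \<le> t) :: real) \<in> borel_measurable (PiM L (\<lambda>_. borel :: real measure))"
    by measurable
qed

lemma N_restrict: "(\<Sum>l\<in>L. of_bool (v (restrict (\<lambda>j. X j w) L l) \<le> t)) = N L t w"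
  unfolding N_def by (intro sum.cong) auto

text \<open>The majorant as a function of the observations in \<open>L\<close> alone, the form in
  which independence of a deleted variable can be read off.\<close>

definition D_fun :: "nat set \<Rightarrow> (nat \<Rightarrow> real) \<Rightarrow> real" where
  "D_fun L x = A / sqrt k * (\<Sum>j<J. max 0 (k - (\<Sum>l\<in>L. of_bool (v (x l) \<le> up j)))
    + max 0 ((\<Sum>l\<in>L. of_bool (v (x l) \<le> dn j)) - k))"

lemma D_fun_restrict: "D_fun L (restrict (\<lambda>j. X j w) L) = D L w"
  unfolding D_fun_def D_def N_restrict ..

lemma measurable_D_fun [measurable]: "D_fun L \<in> borel_measurable (PiM L (\<lambda>_. borel :: real measure))"
  unfolding D_fun_def[abs_def]
  by (intro borel_measurable_times borel_measurable_const borel_measurable_sum borel_measurable_add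
    borel_measurable_max borel_measurable_diff measurable_N_restrict)

text \<open>The event about the others is independent of \<open>X i\<close> and splits off as a
  probability. The factor \<open>card I\<close> stands for a sum over identically distributed terms:
  second moments then total at most one and expected counts at most \<open>K * k\<close>, and either
  gives the order \<open>sqrt k\<close>.\<close>

lemma expectation_indicator_split:
  assumes i: "i \<in> I" and [measurable]: "y \<in> borel_measurable borel" and bdd: "bdd_rv (\<lambda>w. y (X i w))"
    and [measurable]: "Measurable.pred borel Q"
    and sq: "card I * expectation (\<lambda>w. (y (X i w))^2) \<le> 1" and G: "card I * G t \<le> K * k"
    and p: "prob {w\<in>space M. Q (N (I - {i}) s w)} \<le> exp 3 * r ^ (2 * j)"
  shows "card I * expectation (\<lambda>w. \<bar>y (X i w)\<bar> * (of_bool (v (X i w)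
      \<le> t) * of_bool (Q (N (I - {i}) s w))))
    \<le> (1 + K) * sqrt k * exp 3 * r ^ j"
proof -
  let ?E = "expectation (\<lambda>w. \<bar>y (X i w)\<bar> * (of_bool (v (X i w)
      \<le> t) * of_bool (Q (N (I - {i}) s w))))"
    and ?P = "prob {w\<in>space M. Q (N (I - {i}) s w)}"
  note [measurable] = measurable_X[OF i] bdd_rv_measurable[OF bdd_N, of "I - {i}"]
  let ?f = "\<lambda>w. \<bar>y (X i w)\<bar> * of_bool (v (X i w)
      \<le> t)" and ?g = "\<lambda>w. of_bool (Q (N (I - {i}) s w)) :: real"
  have bdds: "bdd_rv ?f" "bdd_rv ?g"
    by (intro bdd_intros bdd; measurable)+
  have ind: "indep_var borel ?f borel ?g"
    using indep_var_split[OF indep i, of "\<lambda>x. \<bar>y x\<bar> * of_bool (v x \<le> t)"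
      "\<lambda>x. of_bool (Q (\<Sum>l\<in>I-{i}. of_bool (v (x l) \<le> s)))"]
    unfolding N_restrict by measurable
  have "?E
      = expectation (\<lambda>w. ?f w * ?g w)" by (simp add: mult.assoc)
  also have "\<dots> = expectation ?f * expectation ?g"
    by (rule indep_var_lebesgue_integral[OF ind]) (intro bdd_rv_integrable bdds)+
  also have "expectation ?g = ?P"
    by (rule expectation_of_bool) measurable
  finally have eq: "?E
      = expectation ?f * ?P" .
  have bdds2: "bdd_rv (\<lambda>w. (y (X i w))^2)" "bdd_rv (\<lambda>w. of_bool (v (X i w) \<le> t))"
    by (intro bdd_intros bdd; measurable)+
  have "expectation ?f \<le> expectation (\<lambda>w. sqrt k * (y (X i w))^2
      + 1 / sqrt k * of_bool (v (X i w) \<le> t))"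
  proof (intro integral_mono bdd_rv_integrable bdds bdd_rv_add bdd_rv_mult bdd_rv_const bdds2)
    fix w
    \<comment> \<open>Young's inequality with weight \<open>sqrt k\<close>. It is applied only where
      the indicator is one, so that the constant term is multiplied by the small probability
      \<open>G t\<close>.\<close>
    have "\<bar>y (X i w)\<bar> \<le> sqrt k * (y (X i w))^2 + 1 / sqrt k"
    proof -
      let ?a = "\<bar>y (X i w)\<bar>"
      have "0 \<le> (sqrt k * ?a - 1)^2" by simp
      also have "\<dots> = sqrt k * sqrt k * ?a^2 - 2 * (sqrt k * ?a) + 1"
        by (simp add: power2_eq_square algebra_simps)
      finally have "2 * (sqrt k * ?a) \<le> sqrt k * sqrt k * ?a^2 + 1" by simp
      moreover have "0 \<le> sqrt k * ?a" using k by simp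
      ultimately have "sqrt k * ?a \<le> sqrt k * sqrt k * ?a^2 + 1" by linarith
      then have "\<bar>y (X i w)\<bar> \<le> (sqrt k * sqrt k * ?a^2 + 1) / sqrt k"
        using sqrt_k(1) by (simp add: pos_le_divide_eq mult.commute)
      also have "\<dots> = sqrt k * (y (X i w))^2 + 1 / sqrt k"
        using sqrt_k(1) by (simp add: add_divide_distrib del: real_sqrt_mult_self)
      finally show ?thesis .
    qed
    then show "\<bar>y (X i w)\<bar> * of_bool (v (X i w) \<le> t)
        \<le> sqrt k * (y (X i w))^2 + 1 / sqrt k * of_bool (v (X i w) \<le> t)"
      using k by (cases "v (X i w) \<le> t") auto
  qed
  also have "\<dots> = sqrt k * expectation (\<lambda>w. (y (X i w))^2) + 1 / sqrt k * G t"
    using bdds2[THEN bdd_rv_integrable] by (simp add: expectation_of_bool prob_v i)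
  finally have "card I * expectation ?f
      \<le> card I * (sqrt k * expectation (\<lambda>w. (y (X i w))^2) + 1 / sqrt k * G t)"
    by (intro mult_left_mono) auto
  also have "\<dots> = sqrt k * (card I * expectation (\<lambda>w. (y (X i w))^2)) + 1 / sqrt k * (card I * G t)"
    by (simp add: algebra_simps)
  also have "\<dots> \<le> sqrt k * 1 + 1 / sqrt k * (K * k)"
    using k by (intro add_mono mult_left_mono sq G) auto
  also have "\<dots> = (1 + K) * sqrt k" using k by (simp add: field_simps)
  finally have f: "card I * expectation ?f \<le> (1 + K) * sqrt k" .
  have "card I * (expectation ?f * ?P)
      = (card I * expectation ?f) * ?P" by simp
  also have "\<dots> \<le> ((1 + K) * sqrt k) * (exp 3 * r ^ (2 * j))"
    using K k by (intro mult_mono f p) auto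
  also have "\<dots> \<le> ((1 + K) * sqrt k) * (exp 3 * r ^ j)"
    using K k r by (intro mult_left_mono power_decreasing) auto
  finally show ?thesis unfolding eq by (simp add: mult.assoc)
qed

lemma sum_expectation_mult_D_diff_le:
  assumes y [measurable]: "y \<in> borel_measurable borel" and bdd: "\<And>i. i \<in> I
      \<Longrightarrow> bdd_rv (\<lambda>w. y (X i w))"
    and sq: "\<And>i. i \<in> I \<Longrightarrow> card I * expectation (\<lambda>w. (y (X i w))^2) \<le> 1"
  shows "(\<Sum>i\<in>I. expectation (\<lambda>w. \<bar>y (X i w)\<bar>
      * \<bar>D I w - D (I - {i}) w\<bar>)) \<le> A * (2 * (1 + K) * exp 3 / (1 - r))"
proof -
  have card: "0 < real (card I)" using fin by (simp add: card_gt_0_iff)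
  have one: "card I * expectation (\<lambda>w. \<bar>y (X i w)\<bar>
      * \<bar>D I w - D (I - {i}) w\<bar>) \<le> A * (2 * (1 + K) * exp 3 / (1 - r))"
    if i: "i \<in> I" for i
  proof -
    note [measurable] = measurable_X[OF i] bdd_rv_measurable[OF bdd_N, of "I - {i}"]
    let ?U = "\<lambda>j w. \<bar>y (X i w)\<bar> * (of_bool (v (X i w)
        \<le> up j) * of_bool (N (I - {i}) (up j) w < k))"
    let ?L = "\<lambda>j w. \<bar>y (X i w)\<bar> * (of_bool (v (X i w)
        \<le> dn j) * of_bool (k - 1 < N (I - {i}) (dn j) w))"
    have bdds: "bdd_rv (?U j)" "bdd_rv (?L j)" for j
      by (intro bdd_intros bdd i; measurable)+
    note int = this[THEN bdd_rv_integrable]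
    have card_i: "card I \<le> card (I - {i}) + 1" using i fin by simp
    have "card I * expectation (\<lambda>w. \<bar>y (X i w)\<bar> * \<bar>D I w - D (I - {i}) w\<bar>)
        \<le> card I * expectation (\<lambda>w. A / sqrt k * (\<Sum>j<J. ?U j w + ?L j w))"
    proof (intro mult_left_mono integral_mono bdd_rv_integrable)
      show "bdd_rv (\<lambda>w. \<bar>y (X i w)\<bar> * \<bar>D I w - D (I - {i}) w\<bar>)"
        by (intro bdd_intros bdd i bdd_D) auto
      show "bdd_rv (\<lambda>w. A / sqrt k * (\<Sum>j<J. ?U j w + ?L j w))"
        by (intro bdd_rv_mult bdd_rv_const bdd_rv_sum bdd_rv_add bdds)
      fix w
      show "\<bar>y (X i w)\<bar> * \<bar>D I w - D (I - {i}) w\<bar> \<le> A / sqrt k * (\<Sum>j<J. ?U j w + ?L j w)"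
        using mult_left_mono[OF D_diff_le[OF i, of w], of "\<bar>y (X i w)\<bar>"]
        by (simp add: sum_distrib_left distrib_left mult_ac)
    qed auto
    also have "\<dots> = A / sqrt k * (\<Sum>j<J. card I * expectation (?U j) + card I * expectation (?L j))"
      using int by (simp add: sum_distrib_left distrib_left mult_ac)
    also have "\<dots> \<le> A / sqrt k * (\<Sum>j<J. (1 + K) * sqrt k * exp 3 * r ^ j + (1
        + K) * sqrt k * exp 3 * r ^ j)"
    proof (intro mult_left_mono sum_mono add_mono)
      fix j assume "j \<in> {..<J}"
      then have j: "j \<le> J" by simp
      have "prob {w\<in>space M. N (I - {i}) (up j) w < k} \<le> exp 2 * r ^ (2 * j)"
        by (rule prob_count_up[OF j _ card_i]) auto
      also have "\<dots> \<le> exp 3 * r ^ (2 * j)" using r by (intro mult_right_mono) auto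
      finally show "card I * expectation (?U j) \<le> (1 + K) * sqrt k * exp 3 * r ^ j"
        by (intro expectation_indicator_split[where Q="\<lambda>x. x < k"] i y bdd sq G_le j) measurable
      have "G (dn j) \<le> K * k / card I"
      proof -
        \<comment> \<open>The hypothesis with \<open>K\<close> concerns the upper grid points;
          monotonicity carries it to the lower ones.\<close>
        have "G (dn j) \<le> G (up j)"
        proof -
          have le: "dn j \<le> up j" using A k by (simp add: up_def dn_def)
          have "prob {w\<in>space M. v (X i w) \<le> dn j} \<le> prob {w\<in>space M. v (X i w) \<le> up j}"
            using le by (intro finite_measure_mono) (auto, measurable)
          then show ?thesis using prob_v[OF i] by simp
        qed
        also have "\<dots> \<le> K * k / card I" using G_le[OF j] card by (simp add: field_simps)
        finally show ?thesis .
      qed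
      then have "card I * G (dn j) \<le> K * k" using card by (simp add: field_simps)
      then show "card I * expectation (?L j) \<le> (1 + K) * sqrt k * exp 3 * r ^ j"
        by (intro expectation_indicator_split[where Q="\<lambda>x. k - 1 < x"] i y bdd sq prob_count_dn j) auto
    qed (use A k in auto)
    also have "\<dots> = A / sqrt k * (\<Sum>j<J. 2 * (1 + K) * exp 3 * sqrt k * r ^ j)"
      by (simp add: algebra_simps)
    also have "\<dots> = A * (2 * (1 + K) * exp 3) * (\<Sum>j<J. r ^ j)"
      unfolding sum_distrib_left[symmetric] using k by simp
    also have "\<dots> \<le> A * (2 * (1 + K) * exp 3) * (1 / (1 - r))"
      using A K by (intro mult_left_mono sum_geometric_le) auto
    finally show ?thesis by simp
  qed
  \<comment> \<open>Each term was bounded after multiplication by \<open>card I\<close>, so this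
    factor is cancelled once the terms are added.\<close>
  have "card I * (\<Sum>i\<in>I. expectation (\<lambda>w. \<bar>y (X i w)\<bar> * \<bar>D I w - D (I - {i}) w\<bar>))
     \<le> (\<Sum>i\<in>I. A * (2 * (1 + K) * exp 3 / (1 - r)))"
    unfolding sum_distrib_left by (intro sum_mono one)
  also have "\<dots> = card I * (A * (2 * (1 + K) * exp 3 / (1 - r)))" by simp
  finally show ?thesis by (rule mult_left_le_imp_le[OF _ card])
qed

end

section \<open>Trimmed and Winsorized sums\<close>

text \<open>A discrete layer-cake formula: a positive \<open>y\<close> within the range of the grid
  is at most \<open>h\<close> times the number of grid levels strictly below it.\<close>

lemma pos_part_le_stairs:
  fixes y h :: real
  assumes "0 \<le> h" "y \<le> real J * h"
  shows "max 0 y \<le> h * (\<Sum>j<J. of_bool (real j * h < y))"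
  using assms(2)
proof (induction J)
  case (Suc J)
  show ?case
  proof (cases "y \<le> real J * h")
    case True
    with Suc.IH have "max 0 y \<le> h * (\<Sum>j<J. of_bool (real j * h < y))" by blast
    also have "\<dots> \<le> h * (\<Sum>j<Suc J. of_bool (real j * h < y))"
      using assms(1) by (intro mult_left_mono) (auto simp del: sum_of_bool_eq)
    finally show ?thesis .
  next
    case False
    have "real j * h < y" if "j < Suc J" for j
    proof -
      have "real j * h \<le> real J * h" using that assms(1) by (intro mult_right_mono) auto
      then show ?thesis using False by linarith
    qed
    then have "(\<Sum>j<Suc J. of_bool (real j * h < y)) = (\<Sum>j<Suc J. 1 :: real)"
      by (intro sum.cong) auto
    then have "(\<Sum>j<Suc J. of_bool (real j * h < y)) = real (Suc J)" by simp
    moreover have "0 \<le> h * real (Suc J)" using assms(1) by simp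
    ultimately show ?thesis using Suc.prems by (simp only: mult.commute max.bounded_iff)
  qed
qed (use assms in auto)

section \<open>Deterministic inequalities for a sorted sample\<close>

context
  fixes xs :: "real list" and n :: nat and cnt :: "real \<Rightarrow> real"
  assumes sorted: "sorted xs" and n: "n = length xs"
  defines "cnt \<equiv> \<lambda>t. \<Sum>i<n. of_bool (xs ! i \<le> t)"
begin

lemma sorted_nth_le: "i \<le> j \<Longrightarrow> j < n \<Longrightarrow> xs ! i \<le> xs ! j"
  using sorted n by (simp add: sorted_nth_mono)

lemma cnt_split: "k \<le> n \<Longrightarrow> cnt t = (\<Sum>i<k. of_bool (xs ! i
    \<le> t)) + (\<Sum>i=k..<n. of_bool (xs ! i \<le> t))"
  unfolding cnt_def by (metis atLeast0LessThan le0 sum.atLeastLessThan_concat)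

text \<open>The bridge from order statistics to counts. List positions start at 0, hence the strict
  comparison with \<open>i\<close>.\<close>

lemma nth_le_iff_cnt:
  assumes "i < n"
  shows "xs ! i \<le> t \<longleftrightarrow> real i < cnt t"
proof
  assume le: "xs ! i \<le> t"
  have "real (Suc i) = (\<Sum>l<Suc i. of_bool (xs ! l \<le> t))"
  proof -
    have "(\<Sum>l<Suc i. of_bool (xs ! l \<le> t)) = (\<Sum>l<Suc i. 1 :: real)"
      using sorted_nth_le[of _ i] assms le by (intro sum.cong) (auto simp: less_Suc_eq_le intro: order_trans)
    then show ?thesis by simp
  qed
  also have "\<dots> \<le> cnt t"
    unfolding cnt_def using assms by (intro sum_mono2) auto
  finally show "real i < cnt t" by simp
next
  assume less: "real i < cnt t"
  show "xs ! i \<le> t"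
  proof (rule ccontr)
    assume "\<not> xs ! i \<le> t"
    then have "t < xs ! l" if "l \<in> {i..<n}" for l
      using sorted_nth_le[of i l] that by auto
    then have "(\<Sum>l=i..<n. of_bool (xs ! l \<le> t)) = (0 :: real)"
      by (intro sum.neutral) (auto simp: not_le)
    moreover have "(\<Sum>l<i. of_bool (xs ! l \<le> t)) \<le> (\<Sum>l<i. 1 :: real)"
      by (intro sum_mono) auto
    ultimately show False using less cnt_split[of i t] assms by simp
  qed
qed

text \<open>If some entry among the first \<open>k\<close> exceeds \<open>t\<close>, then so do all
  later ones and equality holds; otherwise the left side is zero.\<close>

lemma sum_above_le:
  assumes k: "k \<le> n"
  shows "(\<Sum>i<k. of_bool (t < xs ! i)) \<le> max 0 (real k - cnt t)"
proof (cases "\<exists>i<k. t < xs ! i")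
  case True
  then obtain i where i: "i < k" "t < xs ! i" by blast
  have "t < xs ! l" if "l \<in> {k..<n}" for l
    using sorted_nth_le[of i l] i that by auto
  then have "(\<Sum>l=k..<n. of_bool (xs ! l \<le> t)) = (0 :: real)"
    by (intro sum.neutral) (auto simp: not_le)
  then have "real k - cnt t = (\<Sum>i<k. 1 - of_bool (xs ! i \<le> t))"
    unfolding cnt_split[OF k] sum_subtractf by simp
  also have "\<dots> = (\<Sum>i<k. of_bool (t < xs ! i))"
    by (intro sum.cong) auto
  finally show ?thesis by simp
next
  case False
  then have "(\<Sum>i<k. of_bool (t < xs ! i)) = (0 :: real)" by (intro sum.neutral) auto
  then show ?thesis by simp
qed

lemma sum_below_le:
  assumes k: "k \<le> n"
  shows "(\<Sum>i=k..<n. of_bool (xs ! i \<le> t)) \<le> max 0 (cnt t - real k)"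
proof (cases "\<exists>i\<in>{k..<n}. xs ! i \<le> t")
  case True
  then obtain i where i: "k \<le> i" "i < n" "xs ! i \<le> t" by auto
  have "xs ! l \<le> t" if "l < k" for l
    using sorted_nth_le[of l i] i that by auto
  then have "(\<Sum>l<k. of_bool (xs ! l \<le> t)) = (\<Sum>l<k. 1 :: real)"
    by (intro sum.cong) auto
  then show ?thesis using cnt_split[OF k, of t] by simp
next
  case False
  then have "(\<Sum>i=k..<n. of_bool (xs ! i \<le> t)) = (0 :: real)" by (intro sum.neutral) auto
  then show ?thesis by simp
qed

text \<open>\<open>R\<close> is the total size of the misplacements: the excess over
  \<open>a\<close> among the \<open>k\<close> smallest entries plus the shortfall below
  \<open>a\<close> among the others. Measuring each in grid steps and exchanging the order of
  summation turns them into counts at the grid points.\<close>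

lemma lower_sum_bounds:
  fixes a h :: real and k J :: nat
  defines "R \<equiv> (\<Sum>i<k. xs ! i) - real k * a + (\<Sum>i<n. max 0 (a - xs ! i))"
  assumes k: "k \<le> n" and h: "0 \<le> h"
    and up: "real k \<le> cnt (a + real J * h)" and dn: "cnt (a - real J * h) \<le> real k"
  shows "0 \<le> R"
    "R \<le> h * (\<Sum>j<J. max 0 (real k - cnt (a + real j * h)) + max 0 (cnt (a - real j * h) - real k))"
proof -
  have split: "(\<Sum>i<n. max 0 (a - xs ! i))
      = (\<Sum>i<k. max 0 (a - xs ! i)) + (\<Sum>i=k..<n. max 0 (a - xs ! i))"
    using k by (metis atLeast0LessThan le0 sum.atLeastLessThan_concat)
  have "(\<Sum>i<k. max 0 (xs ! i - a)) = (\<Sum>i<k. xs ! i - a + max 0 (a - xs ! i))"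
    by (intro sum.cong) auto
  then have R: "R = (\<Sum>i<k. max 0 (xs ! i - a)) + (\<Sum>i=k..<n. max 0 (a - xs ! i))"
    unfolding R_def split by (simp add: sum.distrib sum_subtractf)
  show "0 \<le> R" unfolding R by (intro add_nonneg_nonneg sum_nonneg) auto
  have "(\<Sum>i<k. max 0 (xs ! i - a)) \<le> (\<Sum>i<k. h * (\<Sum>j<J. of_bool (a + real j * h < xs ! i)))"
  proof (rule sum_mono)
    fix i assume i: "i \<in> {..<k}"
    then have "xs ! i \<le> a + real J * h"
      using up k nth_le_iff_cnt[of i "a + real J * h"] by simp
    then show "max 0 (xs ! i - a) \<le> h * (\<Sum>j<J. of_bool (a + real j * h < xs ! i))"
      using pos_part_le_stairs[OF h, of "xs ! i - a" J] by (simp add: less_diff_eq add.commute)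
  qed
  also have "\<dots> = h * (\<Sum>j<J. \<Sum>i<k. of_bool (a + real j * h < xs ! i))"
    unfolding sum_distrib_left[symmetric] by (subst sum.swap) (rule refl)
  also have "\<dots> \<le> h * (\<Sum>j<J. max 0 (real k - cnt (a + real j * h)))"
    by (intro mult_left_mono sum_mono sum_above_le k h)
  finally have 1: "(\<Sum>i<k. max 0 (xs ! i - a)) \<le> h * (\<Sum>j<J. max 0 (real k - cnt (a + real j * h)))" .
  have "(\<Sum>i=k..<n. max 0 (a - xs ! i)) \<le> (\<Sum>i=k..<n. h * (\<Sum>j<J. of_bool (xs ! i
      \<le> a - real j * h)))"
  proof (rule sum_mono)
    fix i assume i: "i \<in> {k..<n}"
    then have "\<not> xs ! i \<le> a - real J * h"
      using dn nth_le_iff_cnt[of i "a - real J * h"] by auto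
    then have "max 0 (a - xs ! i) \<le> h * (\<Sum>j<J. of_bool (real j * h < a - xs ! i))"
      by (intro pos_part_le_stairs h) simp
    also have "\<dots> \<le> h * (\<Sum>j<J. of_bool (xs ! i \<le> a - real j * h))"
      by (intro mult_left_mono sum_mono h) (auto split: split_of_bool)
    finally show "max 0 (a - xs ! i) \<le> h * (\<Sum>j<J. of_bool (xs ! i \<le> a - real j * h))" .
  qed
  also have "\<dots> = h * (\<Sum>j<J. \<Sum>i=k..<n. of_bool (xs ! i \<le> a - real j * h))"
    unfolding sum_distrib_left[symmetric] by (subst sum.swap) (rule refl)
  also have "\<dots> \<le> h * (\<Sum>j<J. max 0 (cnt (a - real j * h) - real k))"
    by (intro mult_left_mono sum_mono sum_below_le k h)
  finally have 2: "(\<Sum>i=k..<n. max 0 (a - xs ! i)) \<le> h * (\<Sum>j<J. max 0 (cnt (a - real j * h) - real k))" .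
  show "R \<le> h * (\<Sum>j<J. max 0 (real k - cnt (a + real j * h)) + max 0 (cnt (a - real j * h) - real k))"
    unfolding R sum.distrib distrib_left using 1 2 by (rule add_mono)
qed

end

lemma sum_sort_nth:
  fixes g :: "real \<Rightarrow> real" and f :: "nat \<Rightarrow> real" and n :: nat
  defines "xs \<equiv> sort (map f [1..<Suc n])"
  shows "(\<Sum>i<n. g (xs ! i)) = (\<Sum>i\<in>{1..n}. g (f i))"
proof -
  have len: "length xs = n" by (simp add: xs_def)
  have "(\<Sum>i<n. g (xs ! i)) = sum_list (map g xs)"
    by (subst sum_list_sum_nth) (auto simp: len atLeast0LessThan)
  also have "\<dots> = sum_mset (image_mset g (mset xs))"
    by (simp add: sum_mset_sum_list[symmetric])
  also have "\<dots> = sum_mset (image_mset g (mset (map f [1..<Suc n])))"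
    by (simp add: xs_def)
  also have "\<dots> = sum_list (map (\<lambda>i. g (f i)) [1..<Suc n])"
    by (simp add: sum_mset_sum_list[symmetric] image_mset.compositionality comp_def del: upt_Suc)
  also have "\<dots> = (\<Sum>i\<in>{1..n}. g (f i))"
    by (subst interv_sum_list_conv_sum_set_nat)
      (simp add: atLeastLessThanSuc_atLeastAtMost[symmetric] del: upt_Suc)
  finally show ?thesis .
qed

lemma trimmed_sum_eq:
  fixes X :: "nat \<Rightarrow> 'a \<Rightarrow> real" and k m :: "nat \<Rightarrow> nat"
  defines "xs \<equiv> \<lambda>n w. sort (map (\<lambda>j. X j w) [1..<Suc n])"
  assumes n: "0 < n" "k n < n - m n"
  shows "n * trimmed_sum X k m n w = (\<Sum>i=k n..<n - m n. xs n w ! i)"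
proof -
  have "n * trimmed_sum X k m n w = (\<Sum>i=k n + 1..n - m n. xs n w ! (i - 1))"
    using n by (simp add: trimmed_sum_def order_stat_def xs_def)
  also have "\<dots> = (\<Sum>i=k n..<n - m n. xs n w ! i)"
    by (rule sum.reindex_bij_witness[of _ Suc "\<lambda>i. i - 1"]) auto
  finally show ?thesis .
qed

text \<open>The Winsorized sum is the linear part of the trimmed sum.  In each tail the remainder is an
  integral of the deviation of the empirical from the true distribution function, here bounded by
  a Riemann sum over a grid of mesh \<open>h\<close>.\<close>

lemma trimmed_sum_approx:
  fixes X :: "nat \<Rightarrow> 'a \<Rightarrow> real" and a d h h' :: real and n :: nat
  defines "N \<equiv> \<lambda>v t w. \<Sum>i\<in>{1..n}. of_bool (v (X i w) \<le> t)"
  assumes n: "0 < n" "k n < n - m n" and ad: "a \<le> d" and h: "0 \<le> h" "0 \<le> h'"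
    and L: "real (k n) \<le> N id (a + real J * h) w" "N id (a - real J * h) w \<le> real (k n)"
    and U: "real (m n) \<le> N uminus (- d + real J' * h') w" "N uminus (- d - real J' * h') w \<le> real (m n)"
  shows "\<bar>n * trimmed_sum X k m n w - ((\<Sum>i\<in>{1..n}. max a (min (X i w) d)) - k n * a - m n * d)\<bar>
    \<le> h * (\<Sum>j<J. max 0 (real (k n) - N id (a + real j * h) w) + max 0 (N id (a - real j * h) w - real (k n)))
    + h' * (\<Sum>j<J'. max 0 (real (m n) - N uminus (- d + real j * h') w)
        + max 0 (N uminus (- d - real j * h') w - real (m n)))"
proof -
  define xs where "xs = sort (map (\<lambda>j. X j w) [1..<Suc n])"
  \<comment> \<open>The upper tail is the lower tail of the reflected sample, with
    \<open>- d\<close> in place of \<open>a\<close>.\<close>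
  define ys where "ys = rev (map uminus xs)"
  have len: "n = length xs" "n = length ys" by (simp_all add: xs_def ys_def)
  have xs: "sorted xs" by (simp add: xs_def)
  then have ys: "sorted ys"
    unfolding ys_def by (simp add: sorted_wrt_rev sorted_wrt_map)
  have sum_xs: "(\<Sum>i<n. g (xs ! i)) = (\<Sum>i\<in>{1..n}. g (X i w))" for g :: "real \<Rightarrow> real"
    unfolding xs_def by (rule sum_sort_nth)
  have ys_nth: "ys ! i = - (xs ! (n - 1 - i))" if "i < n" for i
    using that len by (simp add: ys_def rev_nth)
  have sum_ys: "(\<Sum>i<n. g (ys ! i)) = (\<Sum>i\<in>{1..n}. g (- X i w))" for g :: "real \<Rightarrow> real"
  proof -
    have "(\<Sum>i<n. g (ys ! i)) = (\<Sum>i<n. g (- (xs ! i)))"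
      by (rule sum.reindex_bij_witness[of _ "\<lambda>i. n - 1 - i" "\<lambda>i. n - 1 - i"]) (auto simp: ys_nth)
    then show ?thesis using sum_xs[of "\<lambda>x. g (- x)"] by simp
  qed
  have cx: "(\<Sum>i<n. of_bool (xs ! i \<le> t)) = N id t w" for t
    unfolding N_def using sum_xs[of "\<lambda>x. of_bool (x \<le> t)"] by simp
  have cy: "(\<Sum>i<n. of_bool (ys ! i \<le> t)) = N uminus t w" for t
    unfolding N_def using sum_ys[of "\<lambda>x. of_bool (x \<le> t)"] by simp
  have km: "k n \<le> n" "m n \<le> n" using n by auto
  define R where "R = (\<Sum>i<k n. xs ! i) - real (k n) * a + (\<Sum>i<n. max 0 (a - xs ! i))"
  define R' where "R' = (\<Sum>i<m n. ys ! i) - real (m n) * (- d) + (\<Sum>i<n. max 0 (- d - ys ! i))"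
  note lx = lower_sum_bounds[OF xs len(1) km(1) h(1), of a J, unfolded cx, OF L, folded R_def]
  note ly = lower_sum_bounds[OF ys len(2) km(2) h(2), of "- d" J', unfolded cy, OF U, folded R'_def]
  have "(\<Sum>i<m n. ys ! i) = - (\<Sum>i=n - m n..<n. xs ! i)"
    unfolding sum_negf[symmetric] using n
    by (intro sum.reindex_bij_witness[of _ "\<lambda>i. n - 1 - i" "\<lambda>i. n - 1 - i"]) (auto simp: ys_nth)
  moreover have "(\<Sum>i<n. max 0 (- d - ys ! i)) = (\<Sum>i<n. max 0 (xs ! i - d))"
    unfolding sum_ys[of "\<lambda>x. max 0 (- d - x)"] sum_xs[of "\<lambda>x. max 0 (x - d)"] by simp
  moreover have "(\<Sum>i<n. xs ! i)
      = (\<Sum>i<k n. xs ! i) + (\<Sum>i=k n..<n - m n. xs ! i) + (\<Sum>i=n - m n..<n. xs ! i)"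
    using n by (simp add: atLeast0LessThan[symmetric] sum.atLeastLessThan_concat)
  moreover have "(\<Sum>i\<in>{1..n}. max a (min (X i w) d))
      = (\<Sum>i<n. xs ! i) + (\<Sum>i<n. max 0 (a - xs ! i)) - (\<Sum>i<n. max 0 (xs ! i - d))"
  proof -
    have "(\<Sum>i\<in>{1..n}. max a (min (X i w) d)) = (\<Sum>i<n. max a (min (xs ! i) d))"
      using sum_xs[of "\<lambda>x. max a (min x d)"] by simp
    also have "\<dots> = (\<Sum>i<n. xs ! i + max 0 (a - xs ! i) - max 0 (xs ! i - d))"
      using ad by (intro sum.cong) auto
    finally show ?thesis by (simp add: sum.distrib sum_subtractf)
  qed
  moreover have "n * trimmed_sum X k m n w = (\<Sum>i=k n..<n - m n. xs ! i)"
    unfolding xs_def using n by (rule trimmed_sum_eq[where k=k and m=m and n=n])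
  \<comment> \<open>The remainders of the two tails are nonnegative and enter with opposite signs,
    so the absolute value is at most their sum.\<close>
  ultimately have "n * trimmed_sum X k m n w - ((\<Sum>i\<in>{1..n}. max a (min (X i w) d)) - k n
      * a - m n * d) = R' - R"
    unfolding R_def R'_def by simp
  then show ?thesis using lx ly by linarith
qed

text \<open>Sorting is avoided by passing to sublevel sets of the order statistics, which are events
  about counts.\<close>

lemma borel_measurable_trimmed_sum:
  fixes X :: "nat \<Rightarrow> 'a \<Rightarrow> real"
  assumes X: "\<And>i. 1 \<le> i \<Longrightarrow> X i \<in> borel_measurable M"
  shows "trimmed_sum X k m n \<in> borel_measurable M"
proof -
  have [measurable]: "(\<lambda>w. order_stat X n i w) \<in> borel_measurable M"
      if i: "i \<in> {k n + 1..n - m n}" for i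
  proof (rule borel_measurableI_le)
    fix t
    have "{w\<in>space M. order_stat X n i w \<le> t}
      = {w\<in>space M. real (i - 1) < (\<Sum>j\<in>{1..n}. of_bool (X j w \<le> t))}"
    proof (intro Collect_cong conj_cong refl)
      fix w
      define xs where "xs = sort (map (\<lambda>j. X j w) [1..<Suc n])"
      have len: "n = length xs" by (simp add: xs_def)
      show "order_stat X n i w \<le> t
          \<longleftrightarrow> real (i - 1) < (\<Sum>j\<in>{1..n}. of_bool (X j w \<le> t))"
      proof -
        have "sorted xs" "i - 1 < n" using i by (auto simp: xs_def)
        then show ?thesis
          using nth_le_iff_cnt[OF _ len, of "i - 1" t]
          unfolding order_stat_def xs_def sum_sort_nth[of "\<lambda>x. of_bool (x
              \<le> t)" "\<lambda>j. X j w" n] by blast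
      qed
    qed
    also have "\<dots> \<in> sets M"
    proof -
      have [measurable]: "X j \<in> borel_measurable M" if "j \<in> {1..n}" for j using X that by simp
      show ?thesis by measurable
    qed
    finally show "{w\<in>space M. order_stat X n i w \<le> t} \<in> sets M" .
  qed
  show ?thesis
    unfolding trimmed_sum_def[abs_def] by measurable
qed

section \<open>Regularly varying tails\<close>

text \<open>Condition \<open>[R]\<close> is about functions \<open>\<Delta>\<close>; gluing a sequence of violations into one \<open>\<Delta>\<close> makes it
  uniform in the increment.\<close>

lemma smooth_variation_uniform:
  fixes f :: "real \<Rightarrow> real"
  assumes f_nonneg: "\<forall>\<^sub>F x in at_infinity. 0 \<le> f x"
    and smooth: "\<And>\<Delta>. \<Delta> \<in> o[at_infinity](\<lambda>x. \<bar>x\<bar>) \<Longrightarrow>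
      (\<lambda>x. \<bar>f (x + \<Delta> x) - f x\<bar>) \<in> O[at_infinity](\<lambda>x. f x
          * \<bar>\<Delta> x / x\<bar>)"
  shows "\<exists>m R. 0 < m \<and> (\<forall>x h. R
      \<le> \<bar>x\<bar> \<longrightarrow> \<bar>h\<bar>
      \<le> \<bar>x\<bar> / m \<longrightarrow> \<bar>f (x + h) - f x\<bar> \<le> m * (f x * \<bar>h / x\<bar>))"
proof (rule ccontr)
  assume "\<not> ?thesis"
  then have neg: "\<exists>x h. R \<le> \<bar>x\<bar> \<and> \<bar>h\<bar>
      \<le> \<bar>x\<bar> / m \<and> m * (f x * \<bar>h / x\<bar>) < \<bar>f (x + h) - f x\<bar>" if "0 < m" for m R
    using that by (force simp: not_le)
  define bad where "bad n x h \<longleftrightarrow> \<bar>h\<bar>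
      \<le> \<bar>x\<bar> / real (Suc n)
      \<and> real (Suc n) * (f x * \<bar>h / x\<bar>) < \<bar>f (x + h) - f x\<bar>"
    for n x h
  \<comment> \<open>The spacing by one makes the points distinct, so that a single function can take
    all prescribed increments, and drives them to infinity.\<close>
  have "\<exists>p. \<forall>n. bad n (fst (p n)) (snd (p n)) \<and> \<bar>fst (p n)\<bar> + 1
      \<le> \<bar>fst (p (Suc n))\<bar>"
  proof (rule dependent_nat_choice)
    show "\<exists>p. bad 0 (fst p) (snd p)"
      using neg[of 1 0] by (auto simp: bad_def)
    fix p :: "real \<times> real" and n
    show "\<exists>q. bad (Suc n) (fst q) (snd q) \<and> \<bar>fst p\<bar> + 1 \<le> \<bar>fst q\<bar>"
      using neg[of "real (Suc (Suc n))" "\<bar>fst p\<bar> + 1"] unfolding bad_def by auto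
  qed
  then obtain p where bad: "\<And>n. bad n (fst (p n)) (snd (p n))"
    and step: "\<And>n. \<bar>fst (p n)\<bar> + 1 \<le> \<bar>fst (p (Suc n))\<bar>" by blast
  define x h where "x n = fst (p n)" and "h n = snd (p n)" for n
  have mono: "\<bar>x i\<bar> + real (j - i) \<le> \<bar>x j\<bar>" if "i \<le> j" for i j
    using that
  proof (induction j rule: dec_induct)
    case (step n)
    have "\<bar>x n\<bar> + 1 \<le> \<bar>x (Suc n)\<bar>"
        using \<open>\<And>n. \<bar>fst (p n)\<bar> + 1 \<le> \<bar>fst (p (Suc n))\<bar>\<close> by (simp add: x_def)
    then show ?case using step by (simp add: Suc_diff_le)
  qed simp
  have inj: "i = j" if "x i = x j" for i j
    using mono[of i j] mono[of j i] that by (cases i j rule: linorder_cases) auto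
  define \<Delta> where "\<Delta> y = (if \<exists>n. y = x n then h (THE n. y = x n) else 0)" for y
  have \<Delta>_x: "\<Delta> (x n) = h n" for n
  proof -
    have "(THE i. x n = x i) = n" by (rule the_equality) (auto dest: inj)
    then show ?thesis by (auto simp: \<Delta>_def)
  qed
  have "\<Delta> \<in> o[at_infinity](\<lambda>x. \<bar>x\<bar>)"
  proof (rule landau_o.smallI)
    fix c :: real assume "0 < c"
    then obtain n0 where n0: "inverse (real (Suc n0)) < c" using reals_Archimedean by blast
    have "norm (\<Delta> y) \<le> c * norm \<bar>y\<bar>" if y: "\<bar>x n0\<bar> \<le> norm y" for y
    proof (cases "\<exists>n. y = x n")
      case True
      then obtain n where n: "y = x n" by blast
      have "n0 \<le> n"
      proof (rule ccontr)
        assume "\<not> n0 \<le> n"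
        then have "\<bar>x n\<bar> < \<bar>x n0\<bar>" using mono[of n n0] by simp
        then show False using y n by simp
      qed
      have "\<bar>h n\<bar> \<le> \<bar>x n\<bar> / real (Suc n)" using bad[of n] by (simp add: bad_def x_def h_def)
      also have "\<dots> \<le> \<bar>x n\<bar> * inverse (real (Suc n0))"
        unfolding divide_inverse using \<open>n0 \<le> n\<close> by (intro mult_left_mono le_imp_inverse_le) auto
      also have "\<dots> \<le> \<bar>x n\<bar> * c" using n0 by (intro mult_left_mono) auto
      finally show ?thesis by (simp add: n \<Delta>_x mult.commute)
    next
      case False
      then show ?thesis using \<open>0 < c\<close> by (simp add: \<Delta>_def)
    qed
    then show "\<forall>\<^sub>F y in at_infinity. norm (\<Delta> y) \<le> c * norm \<bar>y\<bar>"
      unfolding eventually_at_infinity by blast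
  qed
  from landau_o.bigE[OF smooth[OF this]] obtain c where c: "0 < c"
    "\<forall>\<^sub>F y in at_infinity. norm \<bar>f (y + \<Delta> y) - f y\<bar>
        \<le> c * norm (f y * \<bar>\<Delta> y / y\<bar>)" by blast
  have "\<forall>\<^sub>F y in at_infinity. \<bar>f (y + \<Delta> y) - f y\<bar>
      \<le> c * (f y * \<bar>\<Delta> y / y\<bar>) \<and> 0 \<le> f y"
    using f_nonneg c(2) by eventually_elim (simp add: abs_mult)
  then obtain R where R: "\<And>y. R
      \<le> \<bar>y\<bar> \<Longrightarrow> \<bar>f (y + \<Delta> y) - f y\<bar>
      \<le> c * (f y * \<bar>\<Delta> y / y\<bar>) \<and> 0 \<le> f y"
    unfolding eventually_at_infinity real_norm_def by blast
  obtain n where n: "max c R < real n" using reals_Archimedean2 by blast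
  have "R \<le> \<bar>x n\<bar>" using mono[of 0 n] n by linarith
  from R[OF this] have "\<bar>f (x n + h n) - f (x n)\<bar>
      \<le> c * (f (x n) * \<bar>h n / x n\<bar>)" "0 \<le> f (x n)"
    by (simp_all add: \<Delta>_x)
  moreover have "c * (f (x n) * \<bar>h n / x n\<bar>) \<le> real (Suc n) * (f (x n) * \<bar>h n / x n\<bar>)"
    using n \<open>0 \<le> f (x n)\<close> by (intro mult_right_mono mult_nonneg_nonneg) auto
  ultimately show False using bad[of n] by (simp add: bad_def x_def h_def)
qed

text \<open>For \<open>T a = k / n\<close>, multiplication by \<open>n\<close> turns the three
  inequalities at \<open>s = j / sqrt k\<close> into the grid hypotheses of
  \<open>tail_counts\<close>, with \<open>K = 4\<close>.\<close>

definition tail_regular :: "real \<Rightarrow> real \<Rightarrow> (real \<Rightarrow> real)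
    \<Rightarrow> real \<Rightarrow> bool" where
  "tail_regular c \<delta> T a \<longleftrightarrow> (\<forall>s. 0 \<le> s \<longrightarrow> s
      \<le> \<delta> \<longrightarrow>
    T a * (1 + c * s) \<le> T (a * (1 - s)) \<and> T (a * (1 + s))
        \<le> T a * (1 - c * s) \<and> T (a * (1 - s)) \<le> 4 * T a)"

lemma tail_regular_mono:
  assumes reg: "tail_regular c' \<delta>' T a" and "0 \<le> T a" "c \<le> c'" "\<delta> \<le> \<delta>'"
  shows "tail_regular c \<delta> T a"
  unfolding tail_regular_def
proof (intro allI impI)
  fix s assume s: "0 \<le> s" "s \<le> \<delta>"
  then have "T a * (1 + c * s) \<le> T a * (1 + c' * s)" "T a * (1 - c' * s) \<le> T a * (1 - c * s)"
    using assms by (auto intro!: mult_left_mono mult_right_mono)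
  moreover have "s \<le> \<delta>'" using s assms by simp
  ultimately show "T a * (1 + c * s) \<le> T (a * (1 - s)) \<and> T (a * (1 + s))
      \<le> T a * (1 - c * s) \<and> T (a * (1 - s)) \<le> 4 * T a"
    using reg s(1) unfolding tail_regular_def by (meson order_trans)
qed

text \<open>A substitute for Karamata's theorem: comparing derivatives gives \<open>T (t * x) \<le> q * T x\<close> for some
  \<open>q < 1\<close>, whence \<open>T x\<close> is at most a constant times \<open>T x - T (t * x)\<close>, which is of order \<open>x * g x\<close>.\<close>

lemma tail_growth:
  fixes T g :: "real \<Rightarrow> real" and \<gamma> m R :: real
  assumes deriv: "\<And>x. R < x \<Longrightarrow> (T has_real_derivative - g x) (at x)"
    and T0: "(T \<longlongrightarrow> 0) at_top" and g_pos: "\<And>x. R < x \<Longrightarrow> 0 < g x"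
    and ratio: "\<And>t. 0 < t
        \<Longrightarrow> ((\<lambda>x. g (t * x) / g x) \<longlongrightarrow> t powr - (1 + \<gamma>)) at_top"
    and \<gamma>: "0 < \<gamma>" and R: "0 < R" and m: "0 < m"
    and smooth: "\<And>x h. R < x \<Longrightarrow> \<bar>h\<bar>
        \<le> x / m \<Longrightarrow> \<bar>g (x + h) - g x\<bar> \<le> m * (g x * (\<bar>h\<bar> / x))"
  shows "\<exists>c \<delta> a0. 0 < c \<and> 0 < \<delta> \<and> \<delta>
      \<le> 1 / 2 \<and> (\<forall>a\<ge>a0. tail_regular c \<delta> T a)"
proof -
  \<comment> \<open>The condition \<open>m * \<delta> \<le> 1 / 2\<close> keeps \<open>g\<close>
    between one half and three halves of \<open>g x\<close> within relative distance \<delta> of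
    \<open>x\<close>.\<close>
  define \<delta> where "\<delta> = min (1 / 2) (1 / (2 * m))"
  have \<delta>: "0 < \<delta>" "\<delta> \<le> 1 / 2" "\<delta> \<le> 1 / m" "m * \<delta> \<le> 1 / 2"
    using m by (auto simp: \<delta>_def min_def field_simps)
  have local: "g x / 2 \<le> g y \<and> g y
      \<le> 3 / 2 * g x" if x: "R < x" and y: "\<bar>y - x\<bar> \<le> \<delta> * x" for x y
  proof -
    have x0: "0 < x" using x R by simp
    have "\<delta> * x \<le> x / m" using mult_right_mono[OF \<delta>(3), of x] x0 by simp
    then have "\<bar>g y - g x\<bar>
        \<le> m * (g x * (\<bar>y - x\<bar> / x))" using smooth[OF x, of "y - x"] y by simp
    also have "\<dots> \<le> m * (g x * \<delta>)"
      using m g_pos[OF x] y x0 by (intro mult_left_mono) (auto simp: divide_le_eq)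
    also have "\<dots> = (m * \<delta>) * g x" by simp
    also have "\<dots> \<le> 1 / 2 * g x" using \<delta>(4) g_pos[OF x] by (intro mult_right_mono) auto
    finally have "\<bar>g y - g x\<bar> \<le> 1 / 2 * g x" .
    then show ?thesis unfolding abs_le_iff by linarith
  qed
  have mvt: "\<exists>z. u < z \<and> z < w \<and> T u - T w = (w - u) * g z" if "R < u" "u < w" for u w
  proof -
    have "\<exists>z. u < z \<and> z < w \<and> T w - T u = (w - u) * (- g z)"
      using that by (intro MVT2[of u w T "\<lambda>z. - g z"]) (auto intro: deriv)
    then obtain z where "u < z" "z < w" "T w - T u = (w - u) * (- g z)" by blast
    then show ?thesis by (intro exI[of _ z]) (simp add: algebra_simps)
  qed
  define t where "t = 1 + \<delta>"
  have t: "1 < t" using \<delta> by (simp add: t_def)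
  \<comment> \<open>The limit of the derivative ratio is \<open>t powr - \<gamma>\<close>; halving
    the exponent leaves room for a strict inequality at large arguments while \<open>q\<close> stays
    below one.\<close>
  define q where "q = t powr - (\<gamma> / 2)"
  have q: "0 < q" "q < 1" using t \<gamma> by (auto simp: q_def intro: powr_less_one)
  have "t * t powr - (1 + \<gamma>) < q"
  proof -
    have "t * t powr - (1 + \<gamma>) = t powr (1 + - (1 + \<gamma>))" using t by (subst powr_add) simp
    also have "\<dots> < q" unfolding q_def using t \<gamma> by (intro powr_less_mono) auto
    finally show ?thesis .
  qed
  moreover have "((\<lambda>x. t * (g (t * x) / g x)) \<longlongrightarrow> t * t powr - (1 + \<gamma>)) at_top"
    using t by (intro tendsto_mult_left ratio) simp
  ultimately have "\<forall>\<^sub>F x in at_top. t * (g (t * x) / g x) < q"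
    by (rule order_tendstoD(2)[rotated])
  then obtain R1 where R1: "\<And>x. R1 \<le> x \<Longrightarrow> t * (g (t * x) / g x) < q"
    unfolding eventually_at_top_linorder by blast
  define a1 where "a1 = max R1 (R + 1)"
  have a1: "R < x" "0 < x" "x \<le> t * x" if "a1 \<le> x" for x
    using that R t by (auto simp: a1_def mult_le_cancel_right1)
  have T_geometric: "T (t * x) \<le> q * T x" if x: "a1 \<le> x" for x
  proof -
    let ?\<phi> = "\<lambda>x. q * T x - T (t * x)"
    have anti: "?\<phi> z \<le> ?\<phi> x" if "x \<le> z" for z
    proof (rule DERIV_nonpos_imp_nonincreasing[OF that])
      fix y assume "x \<le> y" "y \<le> z"
      then have y: "a1 \<le> y" using x by simp
      have ty: "R < t * y" using a1[OF y] by linarith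
      have "(?\<phi> has_real_derivative q * - g y - - g (t * y) * t) (at y)"
        by (intro DERIV_diff DERIV_cmult deriv a1 y DERIV_chain2[where f=T and g="\<lambda>y. t
            * y"] ty DERIV_cmult_Id)
      moreover have "t * g (t * y) < q * g y"
        using R1[of y] y g_pos[of y] a1[OF y] by (simp add: a1_def field_simps)
      ultimately show "\<exists>d. (?\<phi> has_real_derivative d) (at y) \<and> d \<le> 0"
        by (intro exI[of _ "q * - g y - - g (t * y) * t"]) (simp add: mult.commute)
    qed
    have "filterlim (\<lambda>x. t * x) at_top at_top"
      using t by (intro filterlim_tendsto_pos_mult_at_top[OF tendsto_const _ filterlim_ident]) auto
    then have "((\<lambda>x. T (t * x)) \<longlongrightarrow> 0) at_top"
      by (rule filterlim_compose[OF T0])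
    then have "(?\<phi> \<longlongrightarrow> q * 0 - 0) at_top"
      by (intro tendsto_diff tendsto_mult_left T0)
    then have "(?\<phi> \<longlongrightarrow> 0) at_top" by simp
    then have "0 \<le> ?\<phi> x"
      by (rule tendsto_upperbound) (auto intro!: eventually_mono[OF eventually_ge_at_top[of x]] anti)
    then show ?thesis by simp
  qed
  define C where "C = 3 / 2 * \<delta> / (1 - q)"
  have C: "0 < C" using \<delta> q by (simp add: C_def)
  have nonneg: "0 \<le> T x" if "a1 \<le> x" for x
  proof -
    have "T z \<le> T x" if "x \<le> z" for z
    proof (rule DERIV_nonpos_imp_nonincreasing[OF that])
      fix y assume "x \<le> y"
      then have "R < y" using a1[OF \<open>a1 \<le> x\<close>] by simp
      then show "\<exists>d. (T has_real_derivative d) (at y) \<and> d \<le> 0"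
        using deriv g_pos by (intro exI[of _ "- g y"]) (auto simp: less_imp_le)
    qed
    then show ?thesis
      by (intro tendsto_upperbound[OF T0]) (auto intro!: eventually_mono[OF eventually_ge_at_top[of x]])
  qed
  have bounds: "T x \<le> C * (x * g x) \<and> \<delta> / 2 * (x * g x) \<le> T x" if x: "a1 \<le> x" for x
  proof -
    have "x < t * x" using t a1[OF x] by simp
    from mvt[OF a1(1)[OF x] this] obtain z where z: "x < z" "z < t * x" "T x - T (t * x) = (t * x - x) * g z"
      by blast
    have "\<bar>z - x\<bar> \<le> \<delta> * x" using z by (simp add: t_def algebra_simps)
    note loc = local[OF a1(1)[OF x] this]
    have eq: "T x - T (t * x) = \<delta> * x * g z" using z(3) by (simp add: t_def algebra_simps)
    have dx: "0 \<le> \<delta> * x" using \<delta> a1[OF x] by simp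
    have "(1 - q) * T x \<le> T x - T (t * x)" using T_geometric[OF x] by (simp add: algebra_simps)
    also have "\<dots> \<le> \<delta> * x * (3 / 2 * g x)" unfolding eq using loc dx by (intro mult_left_mono) auto
    finally have "T x \<le> \<delta> * x * (3 / 2 * g x) / (1 - q)" using q
      by (simp only: pos_le_divide_eq[of "1 - q"] diff_gt_0_iff_gt mult.commute[of "T x"])
    also have "\<dots> = C * (x * g x)" by (simp add: C_def)
    finally have 1: "T x \<le> C * (x * g x)" .
    have "\<delta> * x * (g x / 2) \<le> T x - T (t * x)" unfolding eq using loc dx by (intro mult_left_mono) auto
    moreover have "a1 \<le> t * x" using a1[OF x] x by linarith
    ultimately have "\<delta> / 2 * (x * g x) \<le> T x" using nonneg[of "t * x"] by simp
    with 1 show ?thesis by simp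
  qed
  have step: "T a * ((w - u) / a / (2 * C)) \<le> T u - T w \<and> T u - T w \<le> (w - u) * (3 / 2 * g a)"
    if a: "a1 \<le> a" and u: "R < u" "u < w" "a - \<delta> * a \<le> u" "w \<le> a + \<delta> * a" for a u w
  proof -
    obtain z where z: "u < z" "z < w" "T u - T w = (w - u) * g z"
      using mvt[OF u(1,2)] by blast
    have "\<bar>z - a\<bar> \<le> \<delta> * a" using z(1,2) u by linarith
    note loc = local[OF a1(1)[OF a] this]
    have "T a / (2 * C) / a \<le> g a / 2"
      using bounds[OF a] C a1(2)[OF a] by (simp add: field_simps)
    also have "\<dots> \<le> g z" using loc by simp
    finally have "(w - u) * (T a / (2 * C) / a) \<le> (w - u) * g z"
      using u by (intro mult_left_mono) auto
    moreover have "(w - u) * g z \<le> (w - u) * (3 / 2 * g a)"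
      using loc u by (intro mult_left_mono) auto
    moreover have "T a * ((w - u) / a / (2 * C)) = (w - u) * (T a / (2 * C) / a)" by (simp add: mult_ac)
    ultimately show ?thesis unfolding z(3) by (simp only: simp_thms)
  qed
  \<comment> \<open>The factor 2 keeps \<open>a * (1 - s)\<close> in the regular range, since
    \<open>s \<le> \<delta> \<le> 1 / 2\<close>.\<close>
  define a0 where "a0 = 2 * a1"
  have main: "T a * (1 + 1 / (2 * C) * s) \<le> T (a * (1 - s)) \<and> T (a * (1 + s))
      \<le> T a * (1 - 1 / (2 * C) * s)
      \<and> T (a * (1 - s)) \<le> 4 * T a" if a: "a0 \<le> a" and s: "0 \<le> s" "s \<le> \<delta>" for a s
  proof (cases "s = 0")
    case True
    have "a1 \<le> a" using a a1[of a1] by (simp add: a0_def)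
    then show ?thesis using True nonneg[of a] by simp
  next
    case False
    have a1a: "a1 \<le> a / 2" "a1 \<le> a" "0 < a" using a a1[of a1] by (simp_all add: a0_def)
    have as: "a * s \<le> \<delta> * a" "0 < a * s" using s False a1a
        by (auto simp: mult.commute intro: mult_left_mono)
    have "\<delta> * a \<le> 1 / 2 * a" using \<delta> a1a by (intro mult_right_mono) auto
    then have low: "R < a * (1 - s)"
      using as(1) a1(1)[OF a1a(1)] unfolding right_diff_distrib by linarith
    have "T a * (s / (2 * C)) \<le> T (a * (1 - s)) - T a \<and> T (a * (1 - s)) - T a \<le> a * s * (3 / 2 * g a)"
      using step[OF a1a(2) low, of a] as a1a(3) by (simp add: right_diff_distrib)
    moreover have "T a * (s / (2 * C)) \<le> T a - T (a * (1 + s))"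
      using step[OF a1a(2) a1(1)[OF a1a(2)], of "a * (1 + s)"] as a1a(3) by (simp add: distrib_left)
    \<comment> \<open>The origin of the factor 4 in \<open>tail_regular\<close>: passing from
      \<open>a\<close> to \<open>a * (1 - s)\<close> adds at most three times
      \<open>T a\<close>.\<close>
    moreover have "a * s * (3 / 2 * g a) \<le> 3 * T a"
    proof -
      have "a * s * (3 / 2 * g a) \<le> \<delta> * a * (3 / 2 * g a)"
        using as g_pos[OF a1(1)[OF a1a(2)]] by (intro mult_right_mono) auto
      also have "\<dots> = 3 * (\<delta> / 2 * (a * g a))" by simp
      also have "\<dots> \<le> 3 * T a" using bounds[OF a1a(2)] by simp
      finally show ?thesis .
    qed
    moreover have "1 / (2 * C) * s = s / (2 * C)" by simp
    ultimately show ?thesis by (simp only: distrib_left right_diff_distrib mult_1_right) linarith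
  qed
  show ?thesis
    unfolding tail_regular_def using C \<delta> main
        by (intro exI[of _ "1 / (2 * C)"] exI[of _ \<delta>] exI[of _ a0]) auto
qed

lemma RV_ratio_tendsto:
  assumes L: "\<And>x. 0 < L x" "slowly_varying L" and f: "\<And>x. x0 < \<bar>x\<bar>
      \<Longrightarrow> f x = \<bar>x\<bar> powr \<rho> * L x" and t: "0 < t"
  shows "((\<lambda>x. f (t * x) / f x) \<longlongrightarrow> t powr \<rho>) (at_infinity :: real filter)"
proof -
  have "((\<lambda>x. t powr \<rho> * (L (t * x) / L x)) \<longlongrightarrow> t powr \<rho> * 1) at_infinity"
    using L(2) t unfolding slowly_varying_def by (intro tendsto_mult_left) auto
  moreover have "\<forall>\<^sub>F x in at_infinity. t powr \<rho> * (L (t * x) / L x) = f (t * x) / f x"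
    unfolding eventually_at_infinity
  proof (intro exI allI impI)
    fix x :: real assume x: "max (\<bar>x0\<bar> + 1) ((\<bar>x0\<bar> + 1) / t) \<le> norm x"
    then have "\<bar>x0\<bar> + 1 \<le> \<bar>x\<bar>" by simp
    then have "x0 < \<bar>x\<bar>" by linarith
    have "\<bar>x0\<bar> + 1 \<le> t * \<bar>x\<bar>" using x t by (simp add: pos_divide_le_eq mult.commute)
    then have "x0 < \<bar>t * x\<bar>" using t unfolding abs_mult by linarith
    then have "f (t * x) = (t * \<bar>x\<bar>) powr \<rho> * L (t * x)" using f t by (simp add: abs_mult)
    moreover have "\<bar>x\<bar> powr \<rho> \<noteq> 0" using x by auto
    ultimately show "t powr \<rho> * (L (t * x) / L x) = f (t * x) / f x"
      using f[OF \<open>x0 < \<bar>x\<bar>\<close>] t by (simp add: powr_mult)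
  qed
  ultimately have "((\<lambda>x. f (t * x) / f x) \<longlongrightarrow> t powr \<rho> * 1) at_infinity"
    by (rule Lim_transform_eventually)
  then show ?thesis by simp
qed

text \<open>The left tail is treated by reflection. Minima of the constants serve both tails, and
  \<open>a0\<close> lies beyond the point from which the representation in [R] places all arguments
  in \<open>D\<close>.\<close>

lemma cdf_tails_growth:
  assumes N: "real_distribution N" and \<gamma>: "0 < \<gamma>"
    and RV: "RV_infinity_on D (- (1 + \<gamma>)) (deriv (cdf N))"
    and D: "\<And>x. x \<in> D \<Longrightarrow> cdf N field_differentiable at x \<and> 0 < deriv (cdf N) x"
  shows "\<exists>c \<delta> a0. 0 < c \<and> 0 < \<delta> \<and> \<delta>
      \<le> 1 / 2 \<and> 0 < a0 \<and> (\<forall>x. a0 \<le> \<bar>x\<bar> \<longrightarrow> x \<in> D) \<and>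
    (\<forall>a\<ge>a0. tail_regular c \<delta> (\<lambda>x. cdf N (- x)) a
        \<and> tail_regular c \<delta> (\<lambda>x. 1 - cdf N x) a)"
proof -
  interpret N: real_distribution N by fact
  let ?f = "deriv (cdf N)"
  from RV obtain x0 L where x0: "0 < x0" and L: "\<And>x. 0 < L x" "slowly_varying L"
    and f: "\<And>x. x0 < \<bar>x\<bar> \<Longrightarrow> x \<in> D \<and> ?f x
        = \<bar>x\<bar> powr - (1 + \<gamma>) * L x"
    and smooth: "\<And>\<Delta>. \<Delta> \<in> o[at_infinity](\<lambda>x. \<bar>x\<bar>) \<Longrightarrow>
      (\<lambda>x. \<bar>?f (x + \<Delta> x) - ?f x\<bar>) \<in> O[at_infinity](\<lambda>x. ?f x
          * \<bar>\<Delta> x / x\<bar>)"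
    unfolding RV_infinity_on_def by blast
  have pos: "0 < ?f x" and der: "(cdf N has_real_derivative ?f x) (at x)" if "x0 < \<bar>x\<bar>" for x
    using f[OF that] D DERIV_deriv_iff_field_differentiable by blast+
  have "\<forall>\<^sub>F x in at_infinity. 0 \<le> ?f x"
    unfolding eventually_at_infinity
    by (rule exI[of _ "x0 + 1"]) (auto intro!: less_imp_le pos)
  from smooth_variation_uniform[OF this smooth] obtain m R where m: "0 < m"
    and unif: "\<And>x h. R \<le> \<bar>x\<bar> \<Longrightarrow> \<bar>h\<bar>
        \<le> \<bar>x\<bar> / m \<Longrightarrow> \<bar>?f (x + h) - ?f x\<bar> \<le> m * (?f x * \<bar>h / x\<bar>)"
    by blast
  have ratio: "((\<lambda>x. ?f (t * x) / ?f x) \<longlongrightarrow> t powr - (1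
      + \<gamma>)) at_infinity" if "0 < t" for t
    using RV_ratio_tendsto[OF L _ that] f by blast
  define R' where "R' = max R x0"
  have R': "0 < R'" "x0 < \<bar>x\<bar>" "R
      \<le> \<bar>x\<bar>" if "R' < \<bar>x\<bar>" for x using that x0 by (auto simp: R'_def)
  have R'0: "0 < R'" using x0 by (simp add: R'_def)
  have "\<exists>c \<delta> a0. 0 < c \<and> 0 < \<delta> \<and> \<delta>
      \<le> 1 / 2 \<and> (\<forall>a\<ge>a0. tail_regular c \<delta> (\<lambda>x. cdf N (- x)) a)"
  proof (rule tail_growth[where g="\<lambda>x. ?f (- x)" and R=R' and m=m and \<gamma>=\<gamma>])
    fix x assume x: "R' < x"
    then have x': "R' < \<bar>- x\<bar>" using R'0 by simp
    show "((\<lambda>x. cdf N (- x)) has_real_derivative - ?f (- x)) (at x)"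
      using DERIV_chain2[OF der[OF R'(2)[OF x']] DERIV_minus[OF DERIV_ident]] by simp
    show "0 < ?f (- x)" by (rule pos[OF R'(2)[OF x']])
    fix h :: real assume "\<bar>h\<bar> \<le> x / m"
    then show "\<bar>?f (- (x + h)) - ?f (- x)\<bar> \<le> m * (?f (- x) * (\<bar>h\<bar> / x))"
      using unif[OF R'(3)[OF x'], of "- h"] x R'0 by (simp add: abs_divide)
  next
    show "((\<lambda>x. cdf N (- x)) \<longlongrightarrow> 0) at_top"
      by (rule filterlim_compose[OF N.cdf_lim_at_bot filterlim_uminus_at_bot_at_top])
    fix t :: real assume "0 < t"
    have "filterlim uminus at_infinity (at_top :: real filter)"
      by (rule filterlim_mono[OF filterlim_uminus_at_bot_at_top]) (auto simp: at_bot_le_at_infinity)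
    from filterlim_compose[OF ratio[OF \<open>0 < t\<close>] this]
    show "((\<lambda>x. ?f (- (t * x)) / ?f (- x)) \<longlongrightarrow> t powr - (1 + \<gamma>)) at_top" by simp
  qed (use \<gamma> m R'0 in auto)
  then obtain c1 \<delta>1 a1 where 1: "0 < c1" "0 < \<delta>1" "\<delta>1 \<le> 1 / 2"
    "\<And>a. a1 \<le> a \<Longrightarrow> tail_regular c1 \<delta>1 (\<lambda>x. cdf N (- x)) a" by blast
  have "\<exists>c \<delta> a0. 0 < c \<and> 0 < \<delta> \<and> \<delta>
      \<le> 1 / 2 \<and> (\<forall>a\<ge>a0. tail_regular c \<delta> (\<lambda>x. 1 - cdf N x) a)"
  proof (rule tail_growth[where g="?f" and R=R' and m=m and \<gamma>=\<gamma>])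
    fix x assume x: "R' < x"
    then have x': "R' < \<bar>x\<bar>" using R'0 by simp
    show "((\<lambda>x. 1 - cdf N x) has_real_derivative - ?f x) (at x)"
      using DERIV_diff[OF DERIV_const der[OF R'(2)[OF x']], of 1] by simp
    show "0 < ?f x" by (rule pos[OF R'(2)[OF x']])
    fix h :: real assume "\<bar>h\<bar> \<le> x / m"
    then show "\<bar>?f (x + h) - ?f x\<bar> \<le> m * (?f x * (\<bar>h\<bar> / x))"
      using unif[OF R'(3)[OF x'], of "h"] x R'0 by (simp add: abs_divide)
  next
    have "((\<lambda>x. 1 - cdf N x) \<longlongrightarrow> 1 - 1) at_top"
      by (intro tendsto_intros N.cdf_lim_at_top_prob)
    then show "((\<lambda>x. 1 - cdf N x) \<longlongrightarrow> 0) at_top" by simp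
    fix t :: real assume "0 < t"
    show "((\<lambda>x. ?f (t * x) / ?f x) \<longlongrightarrow> t powr - (1 + \<gamma>)) at_top"
      by (rule tendsto_mono[OF at_top_le_at_infinity ratio[OF \<open>0 < t\<close>]])
  qed (use \<gamma> m R'0 in auto)
  then obtain c2 \<delta>2 a2 where 2: "0 < c2" "0 < \<delta>2" "\<delta>2 \<le> 1 / 2"
    "\<And>a. a2 \<le> a \<Longrightarrow> tail_regular c2 \<delta>2 (\<lambda>x. 1 - cdf N x) a" by blast
  define c \<delta> a0 where "c = min c1 c2" and "\<delta> = min \<delta>1 \<delta>2" and "a0
      = max (x0 + 1) (max a1 a2)"
  have "tail_regular c \<delta> (\<lambda>x. cdf N (- x)) a
      \<and> tail_regular c \<delta> (\<lambda>x. 1 - cdf N x) a" if "a0 \<le> a" for a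
    using that N.cdf_nonneg N.cdf_bounded_prob[of a]
    by (intro conjI tail_regular_mono[OF 1(4)] tail_regular_mono[OF 2(4)]) (auto simp: c_def \<delta>_def a0_def)
  then show ?thesis
    using 1 2 f x0 by (intro exI[of _ c] exI[of _ \<delta>] exI[of _ a0]) (auto simp: c_def \<delta>_def a0_def)
qed

section \<open>Winsorized moments\<close>

lemma quantile_mono:
  assumes N: "real_distribution N" and "0 < u" "u \<le> w" "w < 1"
  shows "quantile (cdf N) u \<le> quantile (cdf N) w"
  using quantile_le_iff[OF N, of w "quantile (cdf N) w"] quantile_le_iff[OF N, of u "quantile (cdf N) w"] assms
  by auto

lemma distr_quantile:
  assumes "real_distribution N"
  shows "distr (restrict_space lborel {0<..<1}) borel (quantile (cdf N)) = N"
    and measurable_quantile: "quantile (cdf N) \<in> borel_measurable (restrict_space borel {0<..<1})"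
proof -
  interpret N: cdf_distribution N
    using assms by (simp add: cdf_distribution_def)
  have eq: "quantile (cdf N) = N.I" by (simp add: quantile_def fun_eq_iff)
  show "distr (restrict_space lborel {0<..<1}) borel (quantile (cdf N)) = N"
    unfolding eq by (rule N.distr_I_eq_M)
  show "quantile (cdf N) \<in> borel_measurable (restrict_space borel {0<..<1})"
    unfolding eq by (rule N.measurable_CI)
qed

lemma integral_quantile:
  fixes g :: "real \<Rightarrow> real"
  assumes N: "real_distribution N" and g: "g \<in> borel_measurable borel"
  shows "(\<integral>x. g x \<partial>N) = (LBINT u:{0..1}. g (quantile (cdf N) u))"
proof -
  have Q: "quantile (cdf N) \<in> borel_measurable (restrict_space lborel {0<..<1})"
    using measurable_quantile[OF N] by (simp cong: measurable_cong_sets add: sets_restrict_space)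
  have "(\<integral>x. g x \<partial>N)
      = (\<integral>x. g x \<partial>distr (restrict_space lborel {0<..<1}) borel (quantile (cdf N)))"
    by (simp add: distr_quantile(1)[OF N])
  also have "\<dots> = (\<integral>u. g (quantile (cdf N) u) \<partial>restrict_space lborel {0<..<1})"
    by (rule integral_distr[OF Q g])
  also have "\<dots> = (\<integral>u. indicator {0<..<1} u *\<^sub>R g (quantile (cdf N) u) \<partial>lborel)"
    by (rule integral_restrict_space) simp
  \<comment> \<open>The endpoints, where the infimum defining \<open>quantile\<close> carries no
    meaning, form a null set.\<close>
  also have "\<dots> = (\<integral>u. indicator {0..1} u *\<^sub>R g (quantile (cdf N) u) \<partial>lborel)"
    by (rule integral_discrete_difference[where X="{0, 1}"]) (auto simp: indicator_def)
  finally show ?thesis by (simp add: set_lebesgue_integral_def)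
qed

lemma winsorized_mean_eq_integral:
  assumes "real_distribution N"
  shows "winsorized_mean (cdf N) p q
    = (\<integral>x. max (quantile (cdf N) p) (min x (quantile (cdf N) q)) \<partial>N)"
  unfolding winsorized_mean_def winsorized_quantile_def
  by (subst integral_quantile[OF assms]) auto

lemma winsorized_sd_square:
  assumes "real_distribution N"
  shows "(winsorized_sd (cdf N) p q)^2
    = (\<integral>x. (max (quantile (cdf N) p) (min x (quantile (cdf N) q)) - winsorized_mean (cdf
        N) p q)^2 \<partial>N)"
proof -
  have "0 \<le> (\<integral>x. (max (quantile (cdf N) p) (min x (quantile (cdf N) q)) -
      winsorized_mean (cdf N) p q)^2 \<partial>N)"
    by simp
  then show ?thesis
    unfolding winsorized_sd_def winsorized_quantile_def
    by (subst (asm) integral_quantile[OF assms], simp, subst integral_quantile[OF assms], simp)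
      (rule real_sqrt_pow2)
qed

lemma winsorized_mean_eq:
  assumes N: "real_distribution N" and pq: "0 < p" "p < q" "q < 1"
  shows "winsorized_mean (cdf N) p q
    = p * quantile (cdf N) p + trimmed_mean (cdf N) p q + (1 - q) * quantile (cdf N) q"
proof -
  let ?Q = "quantile (cdf N)"
  \<comment> \<open>The quantile function is known to be measurable on the open unit interval; its
    extension by 0 is measurable everywhere and agrees with it on \<open>{p..q}\<close>.\<close>
  define Q' where "Q' u = (if u \<in> {0<..<1} then ?Q u else 0)" for u
  have [measurable]: "Q' \<in> borel_measurable lborel"
    using measurable_quantile[OF N] unfolding Q'_def[abs_def]
    by (subst (asm) measurable_restrict_space_iff[where c=0]) auto
  have int: "integrable lborel (\<lambda>u. indicator {p..q} u *\<^sub>R Q' u)"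
  proof (rule integrableI_bounded_set_indicator[where B="max \<bar>?Q p\<bar> \<bar>?Q q\<bar>"])
    have "norm (Q' u) \<le> max \<bar>?Q p\<bar> \<bar>?Q q\<bar>" if "u \<in> {p..q}" for u
      using quantile_mono[OF N, of p u] quantile_mono[OF N, of u q] that pq
      by (auto simp: Q'_def)
    then show "AE u in lborel. u \<in> {p..q} \<longrightarrow> norm (Q' u)
        \<le> max \<bar>?Q p\<bar> \<bar>?Q q\<bar>" by simp
  qed (use pq in auto)
  have eq: "(\<lambda>u. indicator {p..q} u *\<^sub>R Q' u) = (\<lambda>u. indicator {p..q} u *\<^sub>R ?Q u)"
    using pq by (auto simp: Q'_def indicator_def fun_eq_iff)
  have "winsorized_mean (cdf N) p q
    = (\<integral>u. ?Q p * indicator {0..p} u + indicator {p..q} u *\<^sub>R Q' u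
        + ?Q q * indicator {q..1} u \<partial>lborel)"
    unfolding winsorized_mean_def winsorized_quantile_def set_lebesgue_integral_def
  proof (rule integral_discrete_difference[where X="{0, p, q, 1}"])
    fix u assume "u \<notin> {0, p, q, 1}"
    then consider "u < 0 \<or> 1 < u" | "0 < u" "u < p" | "p < u" "u < q" | "q < u" "u < 1" by force
    then show "indicator {0..1} u *\<^sub>R max (?Q p) (min (?Q u) (?Q q))
      = ?Q p * indicator {0..p} u + indicator {p..q} u *\<^sub>R Q' u + ?Q q * indicator {q..1} u"
      using pq quantile_mono[OF N, of u p] quantile_mono[OF N, of p q]
        quantile_mono[OF N, of p u] quantile_mono[OF N, of u q] quantile_mono[OF N, of q u]
      by cases (auto simp: Q'_def)
  qed auto
  also have "\<dots> = p * ?Q p + (\<integral>u. indicator {p..q} u *\<^sub>R Q' u \<partial>lborel) + (1 - q) * ?Q q"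
    using int pq by (simp add: mult.commute)
  finally show ?thesis
    unfolding trimmed_mean_def set_lebesgue_integral_def eq .
qed

text \<open>Mass at least \<open>p\<close> lies at or below \<open>- a\<close>, and at least half of
  the mass at or above \<open>- a / 4\<close>. If \<open>\<mu>\<close> is at least
  \<open>- a / 2\<close>, the former is at distance \<open>a / 2\<close> or more from it, otherwise
  the latter at distance \<open>a / 4\<close> or more; the second case gives the constant 16 times
  2.\<close>

lemma second_moment_ge:
  fixes W :: "real \<Rightarrow> real"
  assumes N: "real_distribution N" and W: "W \<in> borel_measurable borel" "\<And>x. \<bar>W x\<bar> \<le> B"
    and p: "p \<le> measure N {x. W x \<le> - a}" "0 \<le> p" "p \<le> 1" and half: "1 / 2
        \<le> measure N {x. - a / 4 \<le> W x}"
    and a: "0 \<le> a"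
  shows "p * a^2 \<le> 32 * (\<integral>x. (W x - \<mu>)^2 \<partial>N)"
proof -
  interpret N: real_distribution N by fact
  note [measurable] = W(1)
  have int: "integrable N (\<lambda>x. (W x - \<mu>)^2)"
  proof (rule N.integrable_const_bound[where B="(B + \<bar>\<mu>\<bar>)^2"])
    have "\<bar>W x - \<mu>\<bar> \<le> B + \<bar>\<mu>\<bar>" for x using W(2)[of x] by linarith
    then have "(W x - \<mu>)^2 \<le> (B + \<bar>\<mu>\<bar>)^2" for x
      using power_mono[of "\<bar>W x - \<mu>\<bar>" "B + \<bar>\<mu>\<bar>" 2] by simp
    then show "AE x in N. norm ((W x - \<mu>)^2) \<le> (B + \<bar>\<mu>\<bar>)^2" by simp
  qed measurable
  have markov: "c * measure N {x. P x} \<le> (\<integral>x. (W x - \<mu>)^2 \<partial>N)"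
    if [measurable]: "Measurable.pred borel P" and c: "\<And>x. P x \<Longrightarrow> c \<le> (W x - \<mu>)^2" for c P
  proof -
    have "c * measure N {x. P x} = (\<integral>x. c * indicator {x. P x} x \<partial>N)"
      by simp
    also have "\<dots> \<le> (\<integral>x. (W x - \<mu>)^2 \<partial>N)"
    proof (intro integral_mono int)
      show "integrable N (\<lambda>x. c * indicator {x. P x} x)"
        by (rule N.integrable_const_bound[where B="\<bar>c\<bar>"]) (auto simp: indicator_def)
    qed (use c in \<open>auto simp: indicator_def\<close>)
    finally show ?thesis .
  qed
  show ?thesis
  proof (cases "- a / 2 \<le> \<mu>")
    case True
    have "(a / 2)^2 * measure N {x. W x \<le> - a} \<le> (\<integral>x. (W x - \<mu>)^2 \<partial>N)"
    proof (rule markov)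
      fix x assume "W x \<le> - a"
      then have "a / 2 \<le> \<mu> - W x" using True by linarith
      then have "(a / 2)^2 \<le> (\<mu> - W x)^2" using a by (intro power_mono) auto
      then show "(a / 2)^2 \<le> (W x - \<mu>)^2" by (simp add: power2_commute)
    qed measurable
    moreover have "(a / 2)^2 * p \<le> (a / 2)^2 * measure N {x. W x \<le> - a}"
      using p by (intro mult_left_mono) auto
    moreover have "0 \<le> a^2 * p" using p by simp
    ultimately show ?thesis by (simp add: power_divide mult.commute)
  next
    case False
    have "(a / 4)^2 * measure N {x. - a / 4 \<le> W x} \<le> (\<integral>x. (W x - \<mu>)^2 \<partial>N)"
    proof (rule markov)
      fix x assume "- a / 4 \<le> W x"
      then have "a / 4 \<le> W x - \<mu>" using False by linarith
      then show "(a / 4)^2 \<le> (W x - \<mu>)^2" using a by (intro power_mono) auto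
    qed measurable
    moreover have "(a / 4)^2 * (1 / 2) \<le> (a / 4)^2 * measure N {x. - a / 4 \<le> W x}"
      using half by (intro mult_left_mono) auto
    moreover have "p * a^2 \<le> 1 * a^2" using p by (intro mult_right_mono) auto
    ultimately show ?thesis by (simp add: power_divide mult.commute)
  qed
qed

section \<open>The bound for fixed sample size\<close>

text \<open>The left side is exponentially small in \<open>sqrt k\<close>; by
  \<open>exp y \<ge> y^2 / 2\<close> with \<open>y = c * \<delta> * sqrt k / 2\<close> it is of
  order \<open>1 / k\<close>. The factor \<open>exp (c / 2)\<close> pays for rounding down.\<close>

lemma power_le_inverse_linear:
  fixes c \<delta> k :: real
  assumes c: "0 < c" and \<delta>: "0 < \<delta>" and k: "0 < k"
  shows "exp (- c / 4) ^ (2 * nat \<lfloor>\<delta> * sqrt k\<rfloor>)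
      \<le> exp (c / 2) * (8 / (c^2 * \<delta>^2)) * (1 / k)"
proof -
  define y where "y = c * (\<delta> * sqrt k) / 2"
  have y: "0 < y" using assms by (simp add: y_def)
  have "0 \<le> \<delta> * sqrt k" using assms by simp
  then have J: "\<delta> * sqrt k \<le> real (nat \<lfloor>\<delta> * sqrt k\<rfloor>) + 1"
    by linarith
  have "exp (- c / 4) ^ (2 * nat \<lfloor>\<delta> * sqrt k\<rfloor>)
      = exp (c / 2 - c * (real (nat \<lfloor>\<delta> * sqrt k\<rfloor>) + 1) / 2)"
    by (simp add: exp_of_nat_mult[symmetric] field_simps)
  also have "\<dots> \<le> exp (c / 2 - y)"
    unfolding y_def using J c by (intro iffD2[OF exp_le_cancel_iff] diff_left_mono
        divide_right_mono mult_left_mono) auto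
  also have "\<dots> = exp (c / 2) * (1 / exp y)" by (simp add: exp_diff)
  also have "1 / exp y \<le> 1 / (y^2 / 2)"
    using exp_lower_Taylor_quadratic[of y] y by (intro divide_left_mono) auto
  then have "exp (c / 2) * (1 / exp y) \<le> exp (c / 2) * (1 / (y^2 / 2))"
    by (intro mult_left_mono) auto
  also have "1 / (y^2 / 2) = 8 / (c^2 * \<delta>^2) * (1 / k)"
    unfolding y_def using k by (simp add: power_mult_distrib power_divide)
  finally show ?thesis by simp
qed

text \<open>Since \<open>K = n * T a\<close> and \<open>K * s = j * sqrt K\<close>, multiplication
  by \<open>n\<close> turns relative changes of the tail into multiples of \<open>sqrt K\<close>.
  Rounding down in the range of \<open>j\<close> keeps \<open>s \<le> \<delta>\<close>.\<close>

lemma tail_regular_grid: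
  assumes reg: "tail_regular c \<delta> T a" and K: "1 \<le> K" "K = n * T a" "0 \<le> n" and \<delta>: "0 < \<delta>"
    and j: "j \<le> nat \<lfloor>\<delta> * sqrt K\<rfloor>"
  defines "s \<equiv> real j / sqrt K"
  shows "0 \<le> s" "s \<le> \<delta>"
    "K + c * real j * sqrt K \<le> n * T (a * (1 - s))"
    "n * T (a * (1 + s)) \<le> K - c * real j * sqrt K"
    "n * T (a * (1 - s)) \<le> 4 * K"
proof -
  have "0 \<le> \<delta> * sqrt K" using K \<delta> by simp
  then have "real j \<le> \<delta> * sqrt K" using j by linarith
  then show s: "0 \<le> s" "s \<le> \<delta>" using K by (simp_all add: s_def divide_le_eq)
  have "K * s = real j * sqrt K" using K(1) by (simp add: s_def field_simps)
  then have e: "K + c * real j * sqrt K = n * (T a * (1 + c * s))" "K - c * real j * sqrt K = n * (T a * (1 - c * s))"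
    "4 * K = n * (4 * T a)"
    unfolding mult.assoc[of n, symmetric] K(2)[symmetric] distrib_left right_diff_distrib
    by (simp_all add: mult.left_commute[of K] K(2))
  show "K + c * real j * sqrt K \<le> n * T (a * (1 - s))" "n * T (a * (1 + s)) \<le> K - c * real j * sqrt K"
    "n * T (a * (1 - s)) \<le> 4 * K"
    unfolding e using reg s K(3) by (auto simp: tail_regular_def intro!: mult_left_mono)
qed

text \<open>The summands come from the perturbed Berry-Esseen bound, from the two perturbation terms
  with their geometric series of ratio \<open>exp (- c / 4)\<close>, and from leaving the grid. The
  5 is \<open>1 + K\<close> for \<open>K = 4\<close>; the first two summands contain some
  slack.\<close>

definition trim_const :: "real \<Rightarrow> real \<Rightarrow> real" where
  "trim_const c \<delta> = (16 + gauss_const) + 4 * ((1 + exp 2) + 5 * exp 3) / (1 - exp (- c / 4))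
    + 2 * exp 3 * (exp (c / 2) * (8 / (c^2 * \<delta>^2)))"

text \<open>The linear part is the standardized sum of the variables clipped to [- AL, AR], the
  perturbation is the sum of the two tail majorants. These are of orders \<open>AL\<close> and
  \<open>AR\<close>, so after division by \<open>sd * sqrt n\<close> they cost no more than the
  bound on one summand.\<close>

lemma (in prob_space) trimmed_cdf_bound:
  fixes X :: "nat \<Rightarrow> 'a \<Rightarrow> real" and F :: "real \<Rightarrow> real" and k m
      :: "nat \<Rightarrow> nat" and n :: nat
    and AL AR c \<delta> x :: real
  defines "\<alpha> \<equiv> real (k n) / real n" and "\<beta> \<equiv> real (m n) / real n"
  defines "sd \<equiv> winsorized_sd F \<alpha> (1 - \<beta>)"
  assumes indep: "indep_vars (\<lambda>_. borel) X {1..}"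
    and F: "\<And>i. 1 \<le> i \<Longrightarrow> cdf (distr M borel (X i)) = F"
    and km: "1 \<le> k n" "1 \<le> m n" "k n < n - m n"
    and A: "0 < AL" "0 < AR" "quantile F \<alpha> = - AL" "quantile F (1 - \<beta>) = AR"
      "F (- AL) = \<alpha>" "F AR = 1 - \<beta>"
    and c: "0 < c" and \<delta>: "0 < \<delta>"
    and left: "tail_regular c \<delta> (\<lambda>x. F (- x)) AL"
    and right: "tail_regular c \<delta> (\<lambda>x. 1 - F x) AR"
    and cont: "\<And>s. \<bar>s\<bar> \<le> \<delta> \<Longrightarrow> isCont F (AR * (1 + s))"
    and sd: "0 < sd"
  shows "\<bar>trimmed_cdf M X F k m n x - \<Phi> x\<bar>
    \<le> trim_const c \<delta> * ((AL + AR) / (sd * sqrt n) + 1 / real (k n) + 1 / real (m n))"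
proof -
  define b where "b = (AL + AR) / (sd * sqrt n)"
  have n: "0 < n" using km by simp
  have sn: "0 < sd * sqrt n" using sd n by simp
  have b: "0 < b" unfolding b_def using A sn by (intro divide_pos_pos) auto
  have cdf_eq: "trimmed_cdf M X F k m n x
      = prob {w\<in>space M. inverse sd * sqrt n
      * (trimmed_sum X k m n w - trimmed_mean F \<alpha> (1 - \<beta>)) \<le> x}"
    by (simp add: trimmed_cdf_def Let_def sd_def \<alpha>_def \<beta>_def)
  define I where "I = {1..n}"
  have I: "finite I" "I \<noteq> {}" "card I = n" using n by (auto simp: I_def)
  have indepI: "indep_vars (\<lambda>_. borel) X I"
    by (rule indep_vars_subset[OF indep]) (auto simp: I_def)
  have X_meas: "random_variable borel (X i)" if "1 \<le> i" for i
    using indep that by (auto simp: indep_vars_def)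
  define N where "N = distr M borel (X 1)"
  have N: "real_distribution N" unfolding N_def using X_meas by auto
  interpret N: real_distribution N by fact
  have N1: "measure N UNIV = 1" using N.prob_space by simp
  have FN: "cdf N = F" unfolding N_def using F by simp
  have distr_X: "distr M borel (X i) = N" if "i \<in> I" for i
  proof (rule cdf_unique)
    have i: "1 \<le> i" using that by (simp add: I_def)
    show "real_distribution (distr M borel (X i))" using X_meas[OF i] by auto
    show "cdf (distr M borel (X i)) = cdf N" using F[OF i] FN by simp
  qed (rule N)
  have Xi_meas: "random_variable borel (X i)" if "i \<in> I" for i using that X_meas by (auto simp: I_def)
  have prob_X: "prob {w\<in>space M. X i w \<in> S} = measure N S" if "i \<in> I" "S \<in> sets borel" for i S
    using distr_X[OF that(1)] measure_distr[OF Xi_meas[OF that(1)] that(2)]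
    by (simp add: vimage_def Int_def conj_commute)
  have exp_X: "expectation (\<lambda>w. g (X i w))
      = (\<integral>x. g x \<partial>N)"
      if "i \<in> I" "g \<in> borel_measurable borel" for i and g :: "real \<Rightarrow> real"
    using integral_distr[OF Xi_meas[OF that(1)] that(2)] distr_X[OF that(1)] by simp
  have \<alpha>\<beta>: "0 < \<alpha>" "\<alpha> < 1 - \<beta>" "1 - \<beta> < 1"
  proof -
    have "real (k n) < real n - real (m n)" using km by simp
    then show "\<alpha> < 1 - \<beta>" using n by (simp add: \<alpha>_def \<beta>_def field_simps)
  qed (use km n in \<open>auto simp: \<alpha>_def \<beta>_def\<close>)
  define W where "W y = max (- AL) (min y AR)" for y
  define \<mu> where "\<mu> = winsorized_mean F \<alpha> (1 - \<beta>)"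
  have W_meas [measurable]: "W \<in> borel_measurable borel" unfolding W_def[abs_def] by measurable
  have W_bounds: "- AL \<le> W y" "W y \<le> AR" for y using A by (auto simp: W_def)
  have \<mu>_eq: "\<mu> = (\<integral>x. W x \<partial>N)"
    unfolding \<mu>_def W_def using winsorized_mean_eq_integral[OF N, of \<alpha> "1 - \<beta>"] A FN by simp
  have sd_eq: "sd^2 = (\<integral>x. (W x - \<mu>)^2 \<partial>N)"
    unfolding sd_def \<mu>_def W_def using winsorized_sd_square[OF N, of \<alpha> "1 - \<beta>"] A FN by simp
  have \<mu>_split: "\<mu> = \<alpha> * (- AL) + trimmed_mean F \<alpha> (1 - \<beta>) + \<beta> * AR"
    unfolding \<mu>_def using winsorized_mean_eq[OF N \<alpha>\<beta>] A FN by simp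
  have W_abs: "\<bar>W y\<bar> \<le> AL + AR" for y
    using W_bounds[of y] A(1,2) by linarith
  have W_int: "integrable N W"
    by (rule N.integrable_const_bound[where B="AL + AR"])
      (auto intro!: AE_I2 W_abs)
  have \<mu>_bounds: "- AL \<le> \<mu>" "\<mu> \<le> AR"
    unfolding \<mu>_eq using W_int W_bounds by (auto intro!: N.integral_ge_const N.integral_le_const)
  define y where "y z = (W z - \<mu>) / (sd * sqrt n)" for z
  have y_meas [measurable]: "y \<in> borel_measurable borel" unfolding y_def[abs_def] by measurable
  have y_bound: "\<bar>y z\<bar> \<le> b" for z
  proof -
    have "\<bar>W z - \<mu>\<bar> \<le> AL + AR" using W_bounds[of z] \<mu>_bounds by linarith
    then show ?thesis unfolding y_def b_def abs_divide using sn by (simp add: divide_right_mono)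
  qed
  have y_mean: "expectation (\<lambda>w. y (X i w)) = 0" if "i \<in> I" for i
  proof -
    have "expectation (\<lambda>w. y (X i w)) = (\<integral>z. y z \<partial>N)" by (rule exp_X[OF that y_meas])
    also have "\<dots> = ((\<integral>z. W z \<partial>N) - \<mu>) / (sd * sqrt n)"
      unfolding y_def using W_int by (simp add: N1)
    finally show ?thesis by (simp add: \<mu>_eq)
  qed
  have y_var: "expectation (\<lambda>w. (y (X i w))^2) = 1 / n" if "i \<in> I" for i
  proof -
    have "expectation (\<lambda>w. (y (X i w))^2)
        = (\<integral>z. (y z)^2 \<partial>N)" by (rule exp_X[OF that]) measurable
    also have "\<dots> = (\<integral>z. (W z - \<mu>)^2 \<partial>N) / (sd * sqrt n)^2"
      unfolding y_def by (simp add: power_divide)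
    also have "\<dots> = 1 / n" using sd n by (simp add: sd_eq[symmetric] power_mult_distrib)
    finally show ?thesis .
  qed
  interpret Z: bounded_summands M I "\<lambda>i w. y (X i w)" b
  proof
    show "indep_vars (\<lambda>_. borel) (\<lambda>i w. y (X i w)) I"
      by (rule indep_vars_compose2[OF indepI]) measurable
    show "(\<Sum>i\<in>I. expectation (\<lambda>w. (y (X i w))^2)) = 1"
      using y_var I n by simp
  qed (use I y_bound y_mean b in auto)
  define KL KR where "KL = real (k n)" and "KR = real (m n)"
  have K1: "1 \<le> KL" "1 \<le> KR" using km by (simp_all add: KL_def KR_def)
  have K\<alpha>: "n * \<alpha> = KL" "n * \<beta>
      = KR" using n by (simp_all add: \<alpha>_def \<beta>_def KL_def KR_def)
  have nFL: "real n * F (- AL) = KL" using K\<alpha>(1) A(5) by simp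
  have nFR: "real n * (1 - F AR) = KR" using K\<alpha>(2) A(6) by simp
  define JL JR where "JL = nat \<lfloor>\<delta> * sqrt KL\<rfloor>" and "JR
      = nat \<lfloor>\<delta> * sqrt KR\<rfloor>"
  interpret L: tail_counts M I X id F AL KL c 4 JL
  proof
    fix i t assume "i \<in> I"
    then show "prob {w \<in> space M. id (X i w) \<le> t} = F t"
      using prob_X[of i "{..t}"] fun_cong[OF FN, of t] by (simp add: cdf_def)
  next
    fix j assume j: "j \<le> JL"
    note grid = tail_regular_grid(3-5)[OF left K1(1) nFL[symmetric] of_nat_0_le_iff \<delta> j[unfolded JL_def]]
    then show "KL + c * real j * sqrt KL \<le> card I * F (- AL * (1 - real j / sqrt KL))"
      "card I * F (- AL * (1 + real j / sqrt KL)) \<le> KL - c * real j * sqrt KL"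
      "card I * F (- AL * (1 - real j / sqrt KL)) \<le> 4 * KL"
      unfolding I(3) minus_mult_left[symmetric] by blast+
  qed (use I indepI A(1) K1 c in auto)
  \<comment> \<open>For the reflected variables the right tail is the measure of a closed half-line;
    it agrees with \<open>1 - F\<close> at points where \<open>F\<close> has no jump.\<close>
  define G where "G t = measure N {- t..}" for t
  have G_eq: "G (- (AR * (1 + s))) = 1 - F (AR * (1 + s))" if "\<bar>s\<bar> \<le> \<delta>" for s
  proof -
    let ?u = "AR * (1 + s)"
    have "measure N {?u} = 0" using cont[OF that] N.isCont_cdf FN by simp
    moreover have "measure N {..?u} = measure N {..<?u} + measure N {?u}"
    proof -
      have "{..?u} = {..<?u} \<union> {?u}" by auto
      then show ?thesis by (subst N.finite_measure_Union[symmetric]) auto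
    qed
    moreover have "measure N {?u..} = 1 - measure N {..<?u}"
    proof -
      have "{?u..} = space N - {..<?u}" by auto
      then show ?thesis by (subst N.prob_compl[symmetric]) auto
    qed
    ultimately show ?thesis using fun_cong[OF FN, of ?u] by (simp add: G_def cdf_def)
  qed
  interpret R: tail_counts M I X uminus G AR KR c 4 JR
  proof
    fix i t assume "i \<in> I"
    moreover have "{w \<in> space M. - X i w \<le> t} = {w \<in> space M. X i w \<in> {- t..}}" by auto
    ultimately show "prob {w \<in> space M. - X i w \<le> t} = G t"
      using prob_X[of i "{- t..}"] by (simp add: G_def)
  next
    fix j assume j: "j \<le> JR"
    define s where "s = real j / sqrt KR"
    note grid = tail_regular_grid[OF right K1(2) nFR[symmetric] of_nat_0_le_iff \<delta>
        j[unfolded JR_def], folded s_def]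
    have "G (- AR * (1 - s)) = 1 - F (AR * (1 - s))" "G (- AR * (1 + s)) = 1 - F (AR * (1 + s))"
      using G_eq[of "- s"] G_eq[of s] grid(1,2) by simp_all
    then show "KR + c * real j * sqrt KR \<le> card I * G (- AR * (1 - real j / sqrt KR))"
      "card I * G (- AR * (1 + real j / sqrt KR)) \<le> KR - c * real j * sqrt KR"
      "card I * G (- AR * (1 - real j / sqrt KR)) \<le> 4 * KR"
      unfolding s_def[symmetric] I(3) using grid(3-5) by simp_all
  qed (use I indepI A(2) K1 c in auto)
  have r_eq: "L.r = exp (- c / 4)" "R.r = exp (- c / 4)" by (simp_all add: L.r_def R.r_def)
  define q where "q = exp (- c / 4)"
  have q: "0 < q" "q < 1" using c by (auto simp: q_def)
  define D where "D J w = (L.D J w + R.D J w) / (sd * sqrt n)" for J w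
  define T where "T w = inverse sd * sqrt n * (trimmed_sum X k m n w - trimmed_mean F \<alpha> (1 - \<beta>))" for w
  define BL BR where "BL = {w\<in>space M. L.N I (L.up JL) w < KL \<or> KL - 1 < L.N I (L.dn JL) w}"
    and "BR = {w\<in>space M. R.N I (R.up JR) w < KR \<or> KR - 1 < R.N I (R.dn JR) w}"
  have NL_meas [measurable]: "random_variable borel (L.N I t)" for t
    by (rule bdd_rv_measurable[OF L.bdd_N[OF order_refl]])
  have NR_meas [measurable]: "random_variable borel (R.N I t)" for t
    by (rule bdd_rv_measurable[OF R.bdd_N[OF order_refl]])
  have B_sets: "BL \<in> events" "BR \<in> events"
    unfolding BL_def BR_def by measurable
  have "\<bar>prob {w\<in>space M. T w \<le> x} - \<Phi> x\<bar>
    \<le> prob (BL \<union> BR) + (15 + gauss_const) * b + expectation (\<lambda>w. \<bar>Z.S w\<bar> * D I w)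
      + (\<Sum>i\<in>I. expectation (\<lambda>w. \<bar>y (X i w)\<bar> * \<bar>D I w - D (I - {i}) w\<bar>))"
  proof (rule Z.Berry_Esseen_perturbed)
    show "bdd_rv (D I)"
      unfolding D_def[abs_def] by (intro bdd_intros L.bdd_D R.bdd_D order_refl)
    show "bdd_rv (D (I - {i}))" for i
      unfolding D_def[abs_def] by (intro bdd_intros L.bdd_D R.bdd_D Diff_subset)
    show "0 \<le> D I w" for w
      unfolding D_def using sn by (intro divide_nonneg_pos add_nonneg_nonneg L.D_nonneg R.D_nonneg)
    show "random_variable borel T"
      unfolding T_def[abs_def] using borel_measurable_trimmed_sum[of X M k m n] X_meas by measurable
    show "BL \<union> BR \<in> events" using B_sets by auto
  next
    fix i and h :: "real \<times> real \<Rightarrow> real"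
    assume i: "i \<in> I" and h [measurable]: "h \<in> borel_measurable (borel \<Otimes>\<^sub>M borel)"
    let ?J = "I - {i}"
    \<comment> \<open>The linear part and the majorant without the \<open>i\<close>-th variable are
      both functions of the other coordinates, so the pair is jointly independent of that
      variable.\<close>
    let ?g = "\<lambda>x. h (\<Sum>l\<in>?J. y (x l), (L.D_fun ?J x + R.D_fun ?J x) / (sd * sqrt n))"
    have comp [measurable]: "(\<lambda>x. x l) \<in> borel_measurable (PiM ?J (\<lambda>_. borel
        :: real measure))" if "l \<in> ?J" for l
      using that by (rule measurable_component_singleton)
    have "(\<lambda>x. \<Sum>l\<in>?J. y (x l)) \<in> borel_measurable (PiM ?J (\<lambda>_. borel :: real measure))"
      by (intro borel_measurable_sum measurable_compose[OF comp y_meas])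
    moreover have "(\<lambda>x. (L.D_fun ?J x
        + R.D_fun ?J x) / (sd * sqrt n)) \<in> borel_measurable (PiM ?J (\<lambda>_. borel :: real measure))"
      by (intro borel_measurable_divide borel_measurable_add L.measurable_D_fun R.measurable_D_fun
          borel_measurable_const)
    ultimately have "?g \<in> borel_measurable (PiM ?J (\<lambda>_. borel :: real measure))"
      by (intro measurable_compose[OF measurable_Pair h])
    from indep_var_split[OF indepI i y_meas this]
    have "indep_var borel (\<lambda>w. y (X i w)) borel (\<lambda>w. h (\<Sum>l\<in>?J. y
        (restrict (\<lambda>j. X j w) ?J l), D ?J w))"
      by (simp only: L.D_fun_restrict R.D_fun_restrict D_def)
    moreover have "(\<Sum>l\<in>?J. y (restrict (\<lambda>j. X j w) ?J l)) = Z.S w - y (X i w)" for w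
    proof -
      have "(\<Sum>l\<in>?J. y (restrict (\<lambda>j. X j w) ?J l))
          = (\<Sum>l\<in>?J. y (X l w))" by (intro sum.cong) auto
      then show ?thesis using i I by (simp add: Z.S_def sum.remove)
    qed
    ultimately show "indep_var borel (\<lambda>w. y (X i w)) borel (\<lambda>w. h (Z.S w - y (X i w), D ?J w))"
      by (simp only:)
  next
    fix w assume "w \<in> space M - (BL \<union> BR)"
    then have good: "KL \<le> L.N I (L.up JL) w" "L.N I (L.dn JL) w \<le> KL"
      "KR \<le> R.N I (R.up JR) w" "R.N I (R.dn JR) w \<le> KR"
      by (auto simp: BL_def BR_def)
    have up: "L.up j = - AL + real j * (AL / sqrt KL)" "L.dn j = - AL - real j * (AL / sqrt KL)"
      "R.up j = - AR + real j * (AR / sqrt KR)" "R.dn j = - AR - real j * (AR / sqrt KR)" for j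
      by (simp_all add: L.up_def L.dn_def R.up_def R.dn_def algebra_simps)
    have "\<bar>n * trimmed_sum X k m n w - ((\<Sum>i\<in>{1..n}. max (- AL) (min (X i w) AR)) - k
        n * (- AL) - m n * AR)\<bar>
       \<le> L.D I w + R.D I w"
      unfolding L.D_def R.D_def L.N_def R.N_def up unfolding I_def KL_def[symmetric] KR_def[symmetric]
      by (rule trimmed_sum_approx[of n k m "- AL" AR, folded KL_def KR_def])
        (use n km A(1,2) K1 good in \<open>simp_all add: L.N_def R.N_def up I_def\<close>)
    moreover have "T w - Z.S w
        = (n * trimmed_sum X k m n w - ((\<Sum>i\<in>{1..n}. max (- AL) (min (X i w) AR)) - k n
        * (- AL) - m n * AR)) / (sd * sqrt n)"
    proof -
      have "Z.S w = ((\<Sum>i\<in>I. W (X i w)) - n * \<mu>) / (sd * sqrt n)"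
      proof -
        have "Z.S w = (\<Sum>i\<in>I. y (X i w))" by (simp only: Z.S_def)
        also have "\<dots> = ((\<Sum>i\<in>I. W (X i w)) - n * \<mu>) / (sd * sqrt n)"
          using I by (simp add: y_def sum_divide_distrib[symmetric] sum_subtractf)
        finally show ?thesis .
      qed
      \<comment> \<open>The terms with \<open>AL\<close> and \<open>AR\<close> are the contributions
        of the clipped tails to the mean. They match the deterministic correction in the
        approximation of the trimmed sum, so that the centrings agree.\<close>
      moreover have "n * \<mu> = KL * (- AL) + n * trimmed_mean F \<alpha> (1 - \<beta>) + KR * AR"
        unfolding \<mu>_split distrib_left using K\<alpha> by (simp add: mult.assoc[symmetric])
      moreover have "T w = (n * trimmed_sum X k m n w - n * trimmed_mean F \<alpha> (1 - \<beta>)) / (sd * sqrt n)"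
      proof -
        have "inverse sd * sqrt n = n / (sd * sqrt n)"
          using sd n by (simp add: field_simps)
        then show ?thesis unfolding T_def by (simp add: right_diff_distrib diff_divide_distrib)
      qed
      ultimately show ?thesis
        by (simp add: diff_divide_distrib[symmetric] W_def I_def KL_def KR_def)
    qed
    ultimately show "\<bar>T w - Z.S w\<bar> \<le> D I w"
      unfolding D_def using sn by (simp add: abs_divide divide_right_mono)
  qed
  moreover have "prob (BL \<union> BR) \<le> 2 * exp 3 * (exp (c / 2) * (8 / (c^2 * \<delta>^2))) * (1 / KL + 1 / KR)"
  proof -
    let ?K = "exp (c / 2) * (8 / (c^2 * \<delta>^2))"
    have "prob (BL \<union> BR) \<le> prob BL + prob BR" by (rule measure_Un_le[OF B_sets])
    also have "\<dots> \<le> 2 * exp 3 * q ^ (2 * JL) + 2 * exp 3 * q ^ (2 * JR)"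
      unfolding BL_def BR_def using L.prob_bad R.prob_bad unfolding r_eq q_def by (rule add_mono)
    also have "\<dots> \<le> 2 * exp 3 * (?K * (1 / KL)) + 2 * exp 3 * (?K * (1 / KR))"
      unfolding JL_def JR_def q_def using c \<delta> K1
      by (intro add_mono mult_left_mono power_le_inverse_linear) auto
    finally show ?thesis by (simp only: distrib_left mult.assoc)
  qed
  moreover have "expectation (\<lambda>w. \<bar>Z.S w\<bar> * D I w) \<le> 2 * (1 + exp 2) / (1 - q) * b"
  proof -
    have bdd: "bdd_rv (\<lambda>w. \<bar>Z.S w\<bar> * L.D I w)" "bdd_rv (\<lambda>w. \<bar>Z.S w\<bar> * R.D I w)"
      by (intro bdd_intros Z.bdd_S L.bdd_D R.bdd_D order_refl)+
    have "expectation (\<lambda>w. \<bar>Z.S w\<bar> * D I w)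
      = expectation (\<lambda>w. (\<bar>Z.S w\<bar> * L.D I w + \<bar>Z.S w\<bar> * R.D I w) / (sd * sqrt n))"
      by (simp add: D_def distrib_left)
    also have "\<dots> = (expectation (\<lambda>w. \<bar>Z.S w\<bar> * L.D I w)
        + expectation (\<lambda>w. \<bar>Z.S w\<bar> * R.D I w)) / (sd * sqrt n)"
      using bdd[THEN bdd_rv_integrable] by simp
    also have "\<dots> \<le> (AL * (2 * (1 + exp 2) / (1 - q)) + AR * (2 * (1 + exp 2) / (1 - q))) / (sd * sqrt n)"
      using sn Z.expectation_S_square
      by (intro divide_right_mono add_mono L.expectation_mult_D_le[unfolded r_eq, folded q_def]
        R.expectation_mult_D_le[unfolded r_eq, folded q_def] Z.bdd_S) auto
    also have "\<dots> = 2 * (1 + exp 2) / (1 - q) * b"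
      by (simp add: b_def algebra_simps add_divide_distrib)
    finally show ?thesis .
  qed
  moreover have "(\<Sum>i\<in>I. expectation (\<lambda>w. \<bar>y (X i w)\<bar>
      * \<bar>D I w - D (I - {i}) w\<bar>)) \<le> 2 * (1 + 4) * exp 3 / (1 - q) * b"
  proof -
    let ?D = "\<lambda>i w. \<bar>y (X i w)\<bar> * \<bar>D I w - D (I - {i}) w\<bar>"
    have bdd_y: "bdd_rv (\<lambda>w. y (X i w))" if "i \<in> I" for i by (rule Z.bdd_Y[OF that])
    let ?L = "\<lambda>i w. \<bar>y (X i w)\<bar> * \<bar>L.D I w - L.D (I - {i}) w\<bar>"
    let ?R = "\<lambda>i w. \<bar>y (X i w)\<bar> * \<bar>R.D I w - R.D (I - {i}) w\<bar>"
    have bdd: "bdd_rv (?L i)" "bdd_rv (?R i)" if "i \<in> I" for i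
      by (intro bdd_intros bdd_y that L.bdd_D R.bdd_D order_refl Diff_subset)+
    have "(\<Sum>i\<in>I. expectation (?D i))
      \<le> (\<Sum>i\<in>I. (expectation (?L i) + expectation (?R i)) / (sd * sqrt n))"
    proof (rule sum_mono)
      fix i assume i: "i \<in> I"
      have "expectation (?D i)
        \<le> expectation (\<lambda>w. (?L i w + ?R i w) / (sd * sqrt n))"
      proof (intro integral_mono bdd_rv_integrable)
        show "bdd_rv (?D i)"
          unfolding D_def by (intro bdd_intros bdd_y i L.bdd_D R.bdd_D order_refl Diff_subset)
        show "bdd_rv (\<lambda>w. (?L i w + ?R i w) / (sd * sqrt n))"
          by (intro bdd_rv_divide bdd_rv_add bdd i)
        fix w
        have "\<bar>D I w - D (I - {i}) w\<bar>
          = \<bar>(L.D I w - L.D (I - {i}) w) + (R.D I w - R.D (I - {i}) w)\<bar> / (sd * sqrt n)"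
        proof -
          have "D I w - D (I - {i}) w = ((L.D I w - L.D (I - {i}) w) + (R.D I w - R.D (I - {i}) w)) / (sd * sqrt n)"
            unfolding D_def by (simp add: diff_divide_distrib[symmetric])
          then show ?thesis using sn by (simp add: abs_divide)
        qed
        also have "\<dots> \<le> (\<bar>L.D I w - L.D (I - {i}) w\<bar>
            + \<bar>R.D I w - R.D (I - {i}) w\<bar>) / (sd * sqrt n)"
          using sn by (intro divide_right_mono abs_triangle_ineq) auto
        finally have "?D i w \<le> \<bar>y (X i w)\<bar> * ((\<bar>L.D I w - L.D (I - {i}) w\<bar>
            + \<bar>R.D I w - R.D (I - {i}) w\<bar>) / (sd * sqrt n))"
          by (rule mult_left_mono) simp
        then show "?D i w \<le> (?L i w + ?R i w) / (sd * sqrt n)"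
          by (simp add: distrib_left)
      qed
      also have "\<dots> = (expectation (?L i) + expectation (?R i)) / (sd * sqrt n)"
        using bdd[OF i, THEN bdd_rv_integrable] by simp
      finally show "expectation (?D i)
        \<le> (expectation (?L i) + expectation (?R i)) / (sd * sqrt n)" .
    qed
    also have "\<dots> = ((\<Sum>i\<in>I. expectation (?L i)) + (\<Sum>i\<in>I. expectation (?R i))) / (sd * sqrt n)"
      by (simp add: sum_divide_distrib[symmetric] sum.distrib)
    also have "\<dots> \<le> (AL * (2 * (1 + 4) * exp 3 / (1 - q)) + AR * (2 * (1
        + 4) * exp 3 / (1 - q))) / (sd * sqrt n)"
      using sn y_var n I
      by (intro divide_right_mono add_mono L.sum_expectation_mult_D_diff_le[unfolded r_eq, folded q_def]
        R.sum_expectation_mult_D_diff_le[unfolded r_eq, folded q_def] y_meas bdd_y) auto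
    also have "\<dots> = 2 * (1 + 4) * exp 3 / (1 - q) * b"
      by (simp add: b_def algebra_simps add_divide_distrib)
    finally show ?thesis .
  qed
  ultimately have "\<bar>trimmed_cdf M X F k m n x - \<Phi> x\<bar>
    \<le> 2 * exp 3 * (exp (c / 2) * (8 / (c^2 * \<delta>^2))) * (1 / KL + 1 / KR) + (15 + gauss_const) * b
      + 2 * (1 + exp 2) / (1 - q) * b + 2 * (1 + 4) * exp 3 / (1 - q) * b"
    unfolding cdf_eq T_def by linarith
  also have "\<dots> \<le> trim_const c \<delta> * (b + 1 / KL + 1 / KR)"
  proof -
    define u where "u = 2 * exp 3 * (exp (c / 2) * (8 / (c^2 * \<delta>^2)))"
    define p where "p = ((1 + exp 2) + 5 * exp 3) / (1 - q)"
    have nn: "0 \<le> u" "0 \<le> p" "0 \<le> b" "0 \<le> 1 / KL + 1 / KR" "0 < gauss_const"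
      using q b K1 gauss_const_pos by (auto simp: u_def p_def intro!: divide_nonneg_nonneg add_nonneg_nonneg)
    have "2 * (1 + exp 2) / (1 - q) * b + 2 * (1 + 4) * exp 3 / (1 - q) * b = 2 * p * b"
      by (simp add: p_def add_divide_distrib algebra_simps)
    moreover have "trim_const c \<delta> = 16 + gauss_const + 4 * p + u"
      by (simp add: trim_const_def p_def u_def q_def)
    moreover have "(16 + gauss_const + 4 * p + u) * (b + v)
      = u * v + (15 + gauss_const) * b + 2 * p * b + (b + 2 * p * b + u * b + (16 + gauss_const + 4 * p) * v)" for v
      by (simp add: algebra_simps)
    note this[of "1 / KL + 1 / KR"]
    moreover have "0 \<le> b + 2 * p * b + u * b + (16 + gauss_const + 4 * p) * (1 / KL + 1 / KR)"
      using nn K1 by (intro add_nonneg_nonneg mult_nonneg_nonneg) auto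
    moreover have "trim_const c \<delta> * (b + 1 / KL + 1 / KR) = trim_const c \<delta> * (b + (1 / KL + 1 / KR))"
      by (simp only: add.assoc)
    ultimately show ?thesis unfolding u_def[symmetric] \<open>trim_const c \<delta>
        = 16 + gauss_const + 4 * p + u\<close> by linarith
  qed
  finally show ?thesis by (simp add: b_def KL_def KR_def)
qed

section \<open>Finite variance\<close>

text \<open>On the square with both sides \<open>{a j..<b j}\<close> the integrand is at least
  \<open>w j\<close> and the product measure is the squared quantile increment; by disjointness the
  integral is at least \<open>n * e\<close> for every \<open>n\<close>.\<close>

lemma trimmed_variance_infinite:
  fixes a b w :: "nat \<Rightarrow> real"
  assumes N: "real_distribution N"
    and ab: "\<And>j. 0 < a j" "\<And>j. a j < b j" "\<And>j. b j < 1"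
    and disj: "disjoint_family (\<lambda>j. {a j..<b j})"
    and w: "\<And>j s t. s \<in> {a j..<b j} \<Longrightarrow> t \<in> {a j..<b j}
        \<Longrightarrow> w j \<le> min s t - s * t" "\<And>j. 0 \<le> w j"
    and e: "0 < e" "\<And>j. e \<le> w j * (quantile (cdf N) (b j) - quantile (cdf N) (a j))^2"
  shows "trimmed_variance (cdf N) 0 1 = \<infinity>"
proof -
  let ?\<mu> = "quantile_measure (cdf N)"
  define B where "B j = {a j..<b j}" for j
  define d where "d j = quantile (cdf N) (b j) - quantile (cdf N) (a j)" for j
  have B_sets: "B j \<in> sets ?\<mu>" for j
  proof -
    have "B j \<in> (\<lambda>(a, b). {a..<b}) ` {(a, b). 0 < a \<and> a \<le> b \<and> b < 1}"
      unfolding B_def using ab[of j] by (auto intro!: image_eqI[of _ _ "(a j, b j)"])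
    then show ?thesis
      unfolding quantile_measure_def by (subst sets_extend_measure) auto
  qed
  have B_emeasure: "emeasure ?\<mu> (B j) = ennreal (d j)" for j
    unfolding B_def d_def using ab[of j] by (intro emeasure_quantile_measure N) auto
  have d_nonneg: "0 \<le> d j" for j
    unfolding d_def using quantile_le_iff[OF N, of "b j" "quantile (cdf N) (b j)"]
      quantile_le_iff[OF N, of "a j" "quantile (cdf N) (b j)"] ab[of j] by auto
  have sub: "B j \<subseteq> {0..<1}" for j using ab[of j] by (force simp: B_def)
  define g where "g s = (\<integral>\<^sup>+t\<in>{0..<1}. ennreal (min s t - s * t) \<partial>?\<mu>)" for s
  have g_ge: "ennreal (w j) * ennreal (d j) \<le> g s" if s: "s \<in> B j" for j s
  proof -
    have "ennreal (w j) * ennreal (d j) = (\<integral>\<^sup>+t. ennreal (w j) * indicator (B j) t \<partial>?\<mu>)"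
      using B_sets by (simp add: nn_integral_cmult_indicator B_emeasure)
    also have "\<dots> \<le> g s"
      unfolding g_def
    proof (rule nn_integral_mono)
      fix t
      show "ennreal (w j) * indicator (B j) t \<le> ennreal (min s t - s * t) * indicator {0..<1} t"
      proof (cases "t \<in> B j")
        case True
        then show ?thesis using w(1)[of s j t] s sub[of j] by (auto simp: B_def intro!: ennreal_leI)
      qed simp
    qed
    finally show ?thesis .
  qed
  have lower: "ennreal (real n * e) \<le> trimmed_variance (cdf N) 0 1" for n
  proof -
    have "ennreal (real n * e) = (\<Sum>j<n. ennreal e)"
      using e(1) by (simp add: ennreal_of_nat_eq_real_of_nat ennreal_mult'')
    also have "\<dots> \<le> (\<Sum>j<n. (ennreal (w j) * ennreal (d j)) * emeasure ?\<mu> (B j))"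
    proof (rule sum_mono)
      fix j
      have "ennreal e \<le> ennreal (w j * (d j)^2)" using e(2) unfolding d_def by (rule ennreal_leI)
      also have "\<dots> \<le> ennreal (w j) * ennreal (d j) * ennreal (d j)"
        using w(2)[of j] d_nonneg[of j] by (simp add: ennreal_mult power2_eq_square mult.assoc)
      finally show "ennreal e \<le> ennreal (w j) * ennreal (d j) * emeasure ?\<mu> (B j)" by (simp add: B_emeasure)
    qed
    also have "\<dots> = (\<Sum>j<n. \<integral>\<^sup>+s. (ennreal (w j) * ennreal (d j))
        * indicator (B j) s \<partial>?\<mu>)"
      using B_sets by (simp add: nn_integral_cmult_indicator)
    also have "\<dots> = (\<integral>\<^sup>+s. (\<Sum>j<n. (ennreal (w j) * ennreal (d j))
        * indicator (B j) s) \<partial>?\<mu>)"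
      using B_sets by (subst nn_integral_sum) auto
    also have "\<dots> \<le> (\<integral>\<^sup>+s\<in>{0..<1}. g s \<partial>?\<mu>)"
    proof (rule nn_integral_mono)
      fix s
      show "(\<Sum>j<n. (ennreal (w j) * ennreal (d j)) * indicator (B j) s) \<le> g s * indicator {0..<1} s"
      proof (cases "\<exists>j<n. s \<in> B j")
        case True
        then obtain j where j: "j < n" "s \<in> B j" by blast
        have "disjoint_family_on B {..<n}"
          using disj unfolding B_def[abs_def] by (rule disjoint_family_on_mono[OF subset_UNIV])
        then have "(\<Sum>j<n. (ennreal (w j) * ennreal (d j)) * indicator (B j) s) = ennreal (w j) * ennreal (d j)"
          using j by (intro sum_indicator_disjoint_family) auto
        then show ?thesis using g_ge[OF j(2)] sub[of j] j(2) by (auto simp: indicator_def)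
      next
        case False
        then have zero: "(\<Sum>j<n. (ennreal (w j) * ennreal (d j)) * indicator (B j) s) = 0"
          by (intro sum.neutral) auto
        show ?thesis unfolding zero by simp
      qed
    qed
    finally show ?thesis by (simp add: trimmed_variance_def g_def)
  qed
  show ?thesis
  proof (rule ccontr)
    assume "trimmed_variance (cdf N) 0 1 \<noteq> \<infinity>"
    then obtain v where v: "0 \<le> v" "trimmed_variance (cdf N) 0 1 = ennreal v"
      by (cases "trimmed_variance (cdf N) 0 1") auto
    obtain n where "v / e < real n" using reals_Archimedean2 by blast
    then have "v < real n * e" using e(1) by (simp add: pos_divide_less_eq)
    then show False using lower[of n] v by (simp add: ennreal_le_iff)
  qed
qed

text \<open>Points with \<open>u * (h u)^2 \<ge> e\<close> exist arbitrarily close to 0. Given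
  \<open>u\<close>, the next point \<open>w\<close> of this kind is taken so small that
  \<open>w * (h u)^2 \<le> e / 4\<close>; after multiplication by \<open>sqrt w\<close> the
  increment of \<open>h\<close> still has size at least \<open>sqrt e / 2\<close>.\<close>

lemma not_vanishing_sequence:
  fixes h :: "real \<Rightarrow> real"
  assumes "\<not> ((\<lambda>u. u * (h u)^2) \<longlongrightarrow> 0) (at_right 0)"
  shows "\<exists>e>0. \<exists>u :: nat \<Rightarrow> real. \<forall>j. 0 < u j
      \<and> u j < 1 / 2 \<and> u (Suc j) < u j \<and> e \<le> u (Suc j) * (h (u j) - h (u (Suc j)))^2"
proof -
  have "\<exists>e>0. \<not> (\<forall>\<^sub>F u in at_right 0. \<bar>u * (h u)^2\<bar> < e)"
    using assms unfolding tendsto_iff dist_real_def by auto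
  then obtain e where e: "0 < e" "\<not> (\<forall>\<^sub>F u in at_right 0. \<bar>u * (h u)^2\<bar> < e)" by blast
  have ex: "\<exists>u. 0 < u \<and> u < d \<and> e \<le> u * (h u)^2" if "0 < d" for d
  proof (rule ccontr)
    assume neg: "\<not> ?thesis"
    have "\<forall>\<^sub>F u in at_right 0. \<bar>u * (h u)^2\<bar> < e"
      unfolding eventually_at_right_field
      using neg that by (intro exI[of _ d]) (auto simp: not_le)
    then show False using e by simp
  qed
  have "\<exists>u. \<forall>j. (0 < u j \<and> u j < 1 / 2) \<and> (u (Suc j) < u j \<and> e / 4
      \<le> u (Suc j) * (h (u j) - h (u (Suc j)))^2)"
  proof (rule dependent_nat_choice)
    show "\<exists>u. 0 < u \<and> u < (1 / 2 :: real)" by (rule exI[of _ "1 / 4"]) simp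
    fix u :: real and j :: nat assume u: "0 < u \<and> u < 1 / 2"
    define d where "d = min u (e / (4 * ((h u)^2 + 1)))"
    have pos: "0 < 4 * ((h u)^2 + 1)" by (intro mult_pos_pos add_nonneg_pos) auto
    have "0 < d" using u e pos by (auto simp: d_def)
    from ex[OF this] obtain w where w: "0 < w" "w < d" "e \<le> w * (h w)^2" by blast
    have "w * (4 * ((h u)^2 + 1)) < e"
      using w(2) pos by (simp add: d_def pos_less_divide_eq)
    then have wu: "w * (h u)^2 \<le> e / 4" using w(1) by (simp add: algebra_simps)
    have "\<bar>sqrt w * h u\<bar> \<le> sqrt e / 2"
      using real_sqrt_le_mono[OF wu] w(1) by (simp add: real_sqrt_mult abs_mult real_sqrt_divide)
    moreover have "sqrt e \<le> \<bar>sqrt w * h w\<bar>"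
      using real_sqrt_le_mono[OF w(3)] w(1) by (simp add: real_sqrt_mult abs_mult)
    ultimately have "sqrt e / 2 \<le> \<bar>sqrt w * h u - sqrt w * h w\<bar>" by linarith
    then have "(sqrt e / 2)^2 \<le> (sqrt w * h u - sqrt w * h w)^2"
      using power_mono[of "sqrt e / 2" "\<bar>sqrt w * h u - sqrt w * h w\<bar>" 2] e(1) by simp
    also have "\<dots> = w * (h u - h w)^2"
      using w(1) by (simp add: right_diff_distrib[symmetric] power_mult_distrib)
    finally have "e / 4 \<le> w * (h u - h w)^2" using e(1) by (simp add: power_divide)
    then show "\<exists>w. (0 < w \<and> w < 1 / 2) \<and> (w < u \<and> e / 4 \<le> w * (h u - h w)^2)"
      using w u by (intro exI[of _ w]) (auto simp: d_def)
  qed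
  then show ?thesis using e(1) by (intro exI[of _ "e / 4"]) auto
qed

text \<open>If \<open>u * (Q u)^2\<close> did not vanish at an end of the unit interval, infinitely many disjoint squares
  along the diagonal would contribute a fixed amount each to the double integral.\<close>

lemma quantile_square_tendsto_0:
  assumes N: "real_distribution N" and fin: "trimmed_variance (cdf N) 0 1 < \<infinity>"
  shows "((\<lambda>u. u * (quantile (cdf N) u)^2) \<longlongrightarrow> 0) (at_right 0)"
    and "((\<lambda>u. u * (quantile (cdf N) (1 - u))^2) \<longlongrightarrow> 0) (at_right 0)"
proof -
  have kernel: "min s t - s * t = min s t * (1 - max s t)" for s t :: real
    by (auto simp: min_def max_def algebra_simps)
  have antimono: "u j \<le> u i" if "\<And>j. u (Suc j) < u j" "i \<le> j" for u :: "nat \<Rightarrow> real" and i j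
    using that(2) by (induction rule: dec_induct) (auto intro: order_trans less_imp_le that(1))
  show "((\<lambda>u. u * (quantile (cdf N) u)^2) \<longlongrightarrow> 0) (at_right 0)"
  proof (rule ccontr)
    assume "\<not> ?thesis"
    from not_vanishing_sequence[OF this] obtain e u where e: "0 < e"
      and u: "\<And>j. 0 < u j" "\<And>j. u j < 1 / 2" "\<And>j. u (Suc j) < u j"
      "\<And>j. e \<le> u (Suc j) * (quantile (cdf N) (u j) - quantile (cdf N) (u (Suc j)))^2" by blast
    have "trimmed_variance (cdf N) 0 1 = \<infinity>"
    proof (rule trimmed_variance_infinite[OF N, where a="\<lambda>j. u (Suc j)" and b=u and
        w="\<lambda>j. u (Suc j) / 2" and e="e / 2"])
      show "disjoint_family (\<lambda>j. {u (Suc j)..<u j})"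
        unfolding disjoint_family_on_def
      proof (intro ballI impI)
        fix i j :: nat assume "i \<noteq> j"
        then consider "Suc i \<le> j" | "Suc j \<le> i" by linarith
        then show "{u (Suc i)..<u i} \<inter> {u (Suc j)..<u j} = {}"
          using antimono[where u=u, OF u(3), of "Suc i" j] antimono[where u=u, OF u(3), of "Suc j" i] by cases auto
      qed
    next
      fix j s t assume st: "s \<in> {u (Suc j)..<u j}" "t \<in> {u (Suc j)..<u j}"
      \<comment> \<open>The first factor is at least the left endpoint of the block, and the second
        at least 1 / 2 because \<open>u j < 1 / 2\<close>.\<close>
      have "u (Suc j) * (1 / 2) \<le> min s t * (1 - max s t)"
        using st u(1)[of "Suc j"] u(2)[of j] by (intro mult_mono) auto
      then show "u (Suc j) / 2 \<le> min s t - s * t" unfolding kernel by simp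
    qed (use e u in \<open>auto intro: less_imp_le less_trans[of _ "1 / 2"]\<close>)
    then show False using fin by simp
  qed
  show "((\<lambda>u. u * (quantile (cdf N) (1 - u))^2) \<longlongrightarrow> 0) (at_right 0)"
  proof (rule ccontr)
    assume "\<not> ?thesis"
    from not_vanishing_sequence[OF this] obtain e u where e: "0 < e"
      and u: "\<And>j. 0 < u j" "\<And>j. u j < 1 / 2" "\<And>j. u (Suc j) < u j"
      "\<And>j. e \<le> u (Suc j) * (quantile (cdf N) (1 - u j) - quantile (cdf N) (1 - u (Suc j)))^2" by blast
    have "trimmed_variance (cdf N) 0 1 = \<infinity>"
    proof (rule trimmed_variance_infinite[OF N, where a="\<lambda>j. 1 - u j" and b="\<lambda>j. 1 - u (Suc j)"
          and w="\<lambda>j. u (Suc j) / 2" and e="e / 2"])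
      show "disjoint_family (\<lambda>j. {1 - u j..<1 - u (Suc j)})"
        unfolding disjoint_family_on_def
      proof (intro ballI impI)
        fix i j :: nat assume "i \<noteq> j"
        then consider "Suc i \<le> j" | "Suc j \<le> i" by linarith
        then show "{1 - u i..<1 - u (Suc i)} \<inter> {1 - u j..<1 - u (Suc j)} = {}"
          using antimono[where u=u, OF u(3), of "Suc i" j] antimono[where u=u, OF u(3), of "Suc j" i] by cases auto
      qed
    next
      fix j s t assume st: "s \<in> {1 - u j..<1 - u (Suc j)}" "t \<in> {1 - u j..<1 - u (Suc j)}"
      \<comment> \<open>At the right end of the unit interval the two factors exchange their
        roles.\<close>
      have "1 / 2 * u (Suc j) \<le> min s t * (1 - max s t)"
        using st u(1)[of "Suc j"] u(2)[of j] by (intro mult_mono) auto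
      then show "u (Suc j) / 2 \<le> min s t - s * t" unfolding kernel by simp
    next
      fix j
      show "0 < 1 - u j" using u(2)[of j] by linarith
      show "1 - u j < 1 - u (Suc j)" "1 - u (Suc j) < 1" using u by auto
      show "0 \<le> u (Suc j) / 2" using u(1)[of "Suc j"] by simp
      show "e / 2 \<le> u (Suc j) / 2 * (quantile (cdf N) (1 - u (Suc j)) - quantile (cdf N) (1 - u j))^2"
        using u(4)[of j] by (simp add: power2_commute)
    qed (use e in auto)
    then show False using fin by simp
  qed
qed

section \<open>The main result\<close>

text \<open>To the left of the quantile the distribution function stays below \<open>u\<close>, and
  at the quantile it is at least \<open>u\<close>; continuity excludes a jump across
  \<open>u\<close>.\<close>

lemma cdf_quantile_eq:
  assumes N: "real_distribution N" and u: "0 < u" "u < 1" and cont: "isCont (cdf N) (quantile (cdf N) u)"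
  shows "cdf N (quantile (cdf N) u) = u"
proof (rule antisym)
  let ?q = "quantile (cdf N) u"
  show "u \<le> cdf N ?q" using quantile_le_iff[OF N u, of ?q] by simp
  have "(cdf N \<longlongrightarrow> cdf N ?q) (at_left ?q)"
    using cont by (simp add: isCont_def filterlim_at_split)
  moreover have "\<forall>\<^sub>F y in at_left ?q. cdf N y \<le> u"
    using quantile_le_iff[OF N u] by (auto simp: eventually_at_filter not_le)
      (metis (mono_tags, lifting) eventuallyI less_le_not_le linear)
  ultimately show "cdf N ?q \<le> u"
    by (rule tendsto_upperbound) simp
qed

lemma divide_sqrt_le:
  fixes A \<alpha> s n C :: real
  assumes "0 < \<alpha>" "0 < s" "0 < n" "0 \<le> A" "0 \<le> C" and sq: "\<alpha> * A^2 \<le> C^2 * s^2"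
  shows "A / (s * sqrt n) \<le> C * (1 / sqrt (n * \<alpha>))"
proof -
  have "sqrt \<alpha> * A \<le> C * s"
  proof (rule power2_le_imp_le)
    show "(sqrt \<alpha> * A)^2 \<le> (C * s)^2" using assms by (simp add: power_mult_distrib)
  qed (use assms in auto)
  then have "A \<le> C * s / sqrt \<alpha>" using assms by (simp add: pos_le_divide_eq mult.commute)
  then have "A / (s * sqrt n) \<le> C * s / sqrt \<alpha> / (s * sqrt n)"
    using assms by (intro divide_right_mono) auto
  also have "\<dots> = C * (1 / sqrt (n * \<alpha>))" using assms by (simp add: real_sqrt_mult)
  finally show ?thesis .
qed

lemma abs_SUP_abs_le:
  fixes h :: "real \<Rightarrow> real"
  assumes "\<And>x. \<bar>h x\<bar> \<le> B"
  shows "\<bar>SUP x. \<bar>h x\<bar>\<bar> \<le> B"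
proof -
  have le: "(SUP x. \<bar>h x\<bar>) \<le> B"
    by (rule cSUP_least) (use assms in auto)
  have "0 \<le> \<bar>h 0\<bar>" by simp
  also have "\<dots> \<le> (SUP x. \<bar>h x\<bar>)"
    by (rule cSUP_upper) (use assms in \<open>auto intro!: bdd_aboveI[of _ B]\<close>)
  finally show ?thesis using le by simp
qed

theorem corollary1p1:
  fixes M :: "'a measure" and X :: "nat \<Rightarrow> 'a \<Rightarrow> real" and F :: "real \<Rightarrow> real"
    and k m :: "nat \<Rightarrow> nat" and \<epsilon> \<gamma> :: real and Ua Ub :: "real set"
  assumes "prob_space M"
    and "prob_space.indep_vars M (\<lambda>_. borel) X {1..}"
    and "\<And>i. 1 \<le> i \<Longrightarrow> cdf (distr M borel (X i)) = F"
    and "\<not> (\<exists>c. AE \<omega> in M. X 1 \<omega> = c)"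
    and "\<And>n. 1 \<le> n \<Longrightarrow> k n < n - m n"
    and "filterlim (\<lambda>n. min (k n) (m n)) at_top sequentially"
    and "Liminf sequentially
           (\<lambda>n. ereal (winsorized_sd F (real (k n) / real n) (1 - real (m n) / real n))) > 0"
    and "(\<lambda>n. max (real (k n) / real n) (real (m n) / real n)) \<longlonglongrightarrow> 0"
    and "0 < \<epsilon>" "\<epsilon> < 1" "smooth_tails F \<epsilon> Ua Ub"
    and "0 < \<gamma>" "\<gamma> \<le> 2"
    and "RV_infinity_on (quantile F ` (Ua \<union> Ub)) (- (1 + \<gamma>)) (deriv F)"
  shows "(\<exists>C>0. \<forall>\<^sub>F n in sequentially.
            (SUP x. \<bar>trimmed_cdf M X F k m n x - cdf std_normal_distribution x\<bar>)
              \<le> C * (1 / sqrt (real (k n)) + 1 / sqrt (real (m n))))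
       \<and> (\<gamma> = 2 \<and> trimmed_variance F 0 1 < \<infinity> \<longrightarrow>
            (\<lambda>n. SUP x. \<bar>trimmed_cdf M X F k m n x - cdf std_normal_distribution x\<bar>)
              \<in> o(\<lambda>n. 1 / sqrt (real (k n)) + 1 / sqrt (real (m n))))"
proof -
  interpret prob_space M by fact
  note indep = assms(2) and F = assms(3)
  define N where "N = distr M borel (X 1)"
  have "random_variable borel (X 1)" using indep by (auto simp: indep_vars_def)
  then have N: "real_distribution N" unfolding N_def by auto
  interpret N: real_distribution N by fact
  have FN: "cdf N = F" unfolding N_def using F by simp
  have F_mono: "F x \<le> F y" if "x \<le> y" for x y using N.cdf_nondecreasing[OF that] FN by simp
  define D where "D = quantile F ` (Ua \<union> Ub)"
  have D: "F field_differentiable at x" "0 < deriv F x" if "x \<in> D" for x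
    using assms(11) that by (auto simp: smooth_tails_def D_def)
  have "RV_infinity_on D (- (1 + \<gamma>)) (deriv (cdf N))" using assms(14) by (simp add: D_def FN)
  note cdf_tails_growth[OF N assms(12) this, unfolded FN]
  moreover have "F field_differentiable at x \<and> 0 < deriv F x" if "x \<in> D" for x using D[OF that] by simp
  ultimately have "\<exists>c \<delta> a0. 0 < c \<and> 0 < \<delta> \<and> \<delta>
      \<le> 1 / 2 \<and> 0 < a0 \<and> (\<forall>x. a0 \<le> \<bar>x\<bar> \<longrightarrow> x \<in> D) \<and>
    (\<forall>a\<ge>a0. tail_regular c \<delta> (\<lambda>x. F (- x)) a
        \<and> tail_regular c \<delta> (\<lambda>x. 1 - F x) a)" .
  then obtain c \<delta> a0 where c: "0 < c" and \<delta>: "0 < \<delta>" "\<delta> \<le> 1 / 2" and a0: "0 < a0"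
    and far: "\<And>x. a0 \<le> \<bar>x\<bar> \<Longrightarrow> x \<in> D"
    and regular: "\<And>a. a0 \<le> a \<Longrightarrow> tail_regular c \<delta> (\<lambda>x. F (- x)) a"
      "\<And>a. a0 \<le> a \<Longrightarrow> tail_regular c \<delta> (\<lambda>x. 1 - F x) a"
    by blast
  have F_deriv: "(F has_real_derivative deriv F x) (at x)" if "a0 \<le> \<bar>x\<bar>" for x
    using D(1)[OF far[OF that]] by (simp add: DERIV_deriv_iff_field_differentiable)
  have F_cont: "isCont F x" if "a0 \<le> \<bar>x\<bar>" for x
    using F_deriv[OF that] by (rule DERIV_isCont)
  \<comment> \<open>To the left of every point there is one with positive derivative, so
    \<open>F\<close> never attains 0, and symmetrically never 1. Hence the quantiles run off to
    infinity as \<open>\<alpha>\<close> and \<open>\<beta>\<close> vanish.\<close>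
  have F_pos: "0 < F x" for x
  proof -
    define y where "y = min x (- a0)"
    have y: "a0 \<le> \<bar>y\<bar>" using a0 by (auto simp: y_def)
    from DERIV_pos_inc_left[OF F_deriv[OF y] D(2)[OF far[OF y]]] obtain d where
      "0 < d" "\<And>h. 0 < h \<Longrightarrow> h < d \<Longrightarrow> F (y - h) < F y" by blast
    then have "F (y - d / 2) < F y" by simp
    moreover have "0 \<le> F (y - d / 2)" using N.cdf_nonneg FN by metis
    moreover have "F y \<le> F x" by (rule F_mono) (simp add: y_def)
    ultimately show ?thesis by linarith
  qed
  have F_less_1: "F x < 1" for x
  proof -
    define y where "y = max x a0"
    have y: "a0 \<le> \<bar>y\<bar>" by (auto simp: y_def)
    from DERIV_pos_inc_right[OF F_deriv[OF y] D(2)[OF far[OF y]]] obtain d where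
      "0 < d" "\<And>h. 0 < h \<Longrightarrow> h < d \<Longrightarrow> F y < F (y + h)" by blast
    then have "F y < F (y + d / 2)" by simp
    moreover have "F (y + d / 2) \<le> 1" using N.cdf_bounded_prob FN by metis
    moreover have "F x \<le> F y" by (rule F_mono) (simp add: y_def)
    ultimately show ?thesis by linarith
  qed
  \<comment> \<open>At least half of the mass lies above \<open>- K\<close> and at least half up to
    \<open>K\<close>; the second moment bound requires this for the left and the right tail.\<close>
  obtain K where K: "0 < K" "F (- K) \<le> 1 / 2" "1 / 2 \<le> F K"
  proof -
    have "\<forall>\<^sub>F x in at_top. F (- x) < 1 / 2"
      using filterlim_compose[OF N.cdf_lim_at_bot filterlim_uminus_at_bot_at_top] FN
      by (intro order_tendstoD(2)[of _ 0]) auto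
    moreover have "\<forall>\<^sub>F x in at_top. 1 / 2 < F x"
      using N.cdf_lim_at_top_prob FN by (intro order_tendstoD(1)[of _ 1]) auto
    ultimately have "\<forall>\<^sub>F x in at_top. 0 < x \<and> F (- x) \<le> 1 / 2 \<and> 1 / 2 \<le> F x"
      using eventually_gt_at_top[of 0] by eventually_elim auto
    from eventually_happens'[OF trivial_limit_at_top_linorder this] show ?thesis using that by blast
  qed
  define \<alpha> \<beta> where "\<alpha> n = real (k n) / real n" and "\<beta> n = real (m n) / real n" for n
  define AL AR sd where "AL n = - quantile F (\<alpha> n)" and "AR n = quantile F (1 - \<beta> n)"
    and "sd n = winsorized_sd F (\<alpha> n) (1 - \<beta> n)" for n
  have ev_km: "\<forall>\<^sub>F n in sequentially. L \<le> k n \<and> L \<le> m n" for L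
    using assms(6) unfolding filterlim_at_top by (auto elim: eventually_mono)
  have \<alpha>0: "\<alpha> \<longlonglongrightarrow> 0" and \<beta>0: "\<beta> \<longlonglongrightarrow> 0"
    by (rule tendsto_sandwich[OF _ _ tendsto_const assms(8)]; auto simp: \<alpha>_def \<beta>_def)+
  have ev_pos: "\<forall>\<^sub>F n in sequentially. 1 \<le> k n \<and> 1
      \<le> m n \<and> k n < n - m n \<and> 0 < \<alpha> n \<and> \<alpha> n < 1
      \<and> 0 < \<beta> n \<and> \<beta> n < 1"
    using ev_km[of 1] eventually_ge_at_top[of 1] order_tendstoD(2)[OF \<alpha>0 zero_less_one]
      order_tendstoD(2)[OF \<beta>0 zero_less_one]
  proof eventually_elim
    case (elim n)
    then show ?case using assms(5)[of n] by (auto simp: \<alpha>_def \<beta>_def)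
  qed
  have ev_large: "\<forall>\<^sub>F n in sequentially. R \<le> AL n \<and> R \<le> AR n" for R
  proof -
    have "\<forall>\<^sub>F n in sequentially. \<alpha> n < F (- R)"
        "\<forall>\<^sub>F n in sequentially. \<beta> n < 1 - F R"
      using order_tendstoD(2)[OF \<alpha>0 F_pos] order_tendstoD(2)[OF \<beta>0, of "1 - F R"] F_less_1[of R] by auto
    then show ?thesis
      using ev_pos
    proof eventually_elim
      case (elim n)
      have "quantile (cdf N) (\<alpha> n)
          \<le> - R" using quantile_le_iff[OF N, of "\<alpha> n" "- R"] elim FN by simp
      moreover have "\<not> quantile (cdf N) (1 - \<beta> n) \<le> R"
        using quantile_le_iff[OF N, of "1 - \<beta> n" R] elim FN by simp
      ultimately show ?case using FN by (simp add: AL_def AR_def)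
    qed
  qed
  let ?rate = "\<lambda>n. 1 / sqrt (real (k n)) + 1 / sqrt (real (m n))"
    and ?total = "\<lambda>n. (AL n + AR n) / (sd n * sqrt n) + 1 / real (k n) + 1 / real (m n)"
  \<comment> \<open>The part \<open>2 * a0\<close> keeps \<open>AR n * (1 + s)\<close> beyond
    \<open>a0\<close> for |s| \<le> \<delta> \<le> 1 / 2; the part \<open>4 * K\<close> puts
    \<open>K\<close> below a quarter of both quantile sizes.\<close>
  define R where "R = max (2 * a0) (4 * K)"
  have good: "\<forall>\<^sub>F n in sequentially. 1 \<le> k n \<and> 1
      \<le> m n \<and> 0 < AL n \<and> 0 < AR n \<and> 0 < sd n
      \<and> \<alpha> n * (AL n)^2 \<le> 32 * (sd n)^2 \<and> \<beta> n * (AR n)^2 \<le> 32 * (sd n)^2 \<and>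
      (\<forall>x. \<bar>trimmed_cdf M X F k m n x - \<Phi> x\<bar>
        \<le> trim_const c \<delta> * ?total n)"
    using ev_pos ev_large[of R]
  proof eventually_elim
    case (elim n)
    have large: "2 * a0 \<le> AL n" "4 * K \<le> AL n" "2 * a0 \<le> AR n" "4 * K \<le> AR n"
      using elim by (auto simp: R_def)
    have pos: "0 < AL n" "0 < AR n" using large a0 by linarith+
    have Q: "quantile F (\<alpha> n) = - AL n" "quantile F (1 - \<beta> n) = AR n" by (simp_all add: AL_def AR_def)
    have FA: "F (- AL n) = \<alpha> n"
      using cdf_quantile_eq[OF N, of "\<alpha> n"] elim Q FN F_cont[of "- AL n"] large a0 by simp
    have FB: "F (AR n) = 1 - \<beta> n"
      using cdf_quantile_eq[OF N, of "1 - \<beta> n"] elim Q FN F_cont[of "AR n"] large a0 by simp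
    define W where "W x = max (- AL n) (min x (AR n))" for x
    have W_meas [measurable]: "W \<in> borel_measurable borel" unfolding W_def[abs_def] by measurable
    have W_bound: "\<bar>W x\<bar> \<le> AL n + AR n" for x using pos by (auto simp: W_def)
    define \<mu> where "\<mu> = winsorized_mean F (\<alpha> n) (1 - \<beta> n)"
    have sd_eq: "(sd n)^2 = (\<integral>x. (W x - \<mu>)^2 \<partial>N)"
      using winsorized_sd_square[OF N, of "\<alpha> n" "1 - \<beta> n"] FN Q by (simp add: sd_def \<mu>_def W_def)
    have meas_ge: "1 - F x \<le> measure N {x..}" for x
    proof -
      have "1 - F x = measure N (space N - {..x})"
        using N.prob_compl[of "{..x}"] fun_cong[OF FN, of x] by (simp add: cdf_def)
      also have "\<dots> \<le> measure N {x..}" by (rule N.finite_measure_mono) auto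
      finally show ?thesis .
    qed
    have left: "\<alpha> n * (AL n)^2 \<le> 32 * (sd n)^2"
      unfolding sd_eq
    proof (rule second_moment_ge[OF N W_meas W_bound])
      have "\<alpha> n = measure N {..- AL n}" using FA fun_cong[OF FN, of "- AL n"] by (simp add: cdf_def)
      also have "\<dots> \<le> measure N {x. W x \<le> - AL n}"
        by (rule N.finite_measure_mono) (auto simp: W_def)
      finally show "\<alpha> n \<le> measure N {x. W x \<le> - AL n}" .
      have "1 / 2 \<le> measure N {- K..}" using meas_ge[of "- K"] K by linarith
      also have "\<dots> \<le> measure N {x. - AL n / 4 \<le> W x}"
        using large pos K by (intro N.finite_measure_mono) (auto simp: W_def)
      finally show "1 / 2 \<le> measure N {x. - AL n / 4 \<le> W x}" .
    qed (use elim pos in auto)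
    have right: "\<beta> n * (AR n)^2 \<le> 32 * (sd n)^2"
    proof -
      have "\<beta> n * (AR n)^2 \<le> 32 * (\<integral>x. (- W x - (- \<mu>))^2 \<partial>N)"
      \<comment> \<open>The right tail is the left tail of the negated clipped variable.\<close>
      proof (rule second_moment_ge[OF N, where W="\<lambda>x. - W x" and B="AL n + AR n"])
        have "\<beta> n \<le> measure N {AR n..}" using meas_ge[of "AR n"] FB by simp
        also have "\<dots> \<le> measure N {x. - W x \<le> - AR n}"
          using pos by (intro N.finite_measure_mono) (auto simp: W_def)
        finally show "\<beta> n \<le> measure N {x. - W x \<le> - AR n}" .
        have "1 / 2 \<le> measure N {..K}" using K fun_cong[OF FN, of K] by (simp add: cdf_def)
        also have "\<dots> \<le> measure N {x. - AR n / 4 \<le> - W x}"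
          using large pos K by (intro N.finite_measure_mono) (auto simp: W_def)
        finally show "1 / 2 \<le> measure N {x. - AR n / 4 \<le> - W x}" .
      qed (use elim pos W_bound in auto)
      also have "(\<integral>x. (- W x - (- \<mu>))^2 \<partial>N) = (sd n)^2"
        unfolding sd_eq by (intro Bochner_Integration.integral_cong refl) (simp add: power2_eq_square algebra_simps)
      finally show ?thesis .
    qed
    have sd_pos: "0 < sd n"
    proof -
      have "0 < \<alpha> n * (AL n)^2" using elim pos by simp
      then have "0 < (sd n)^2" using left by linarith
      moreover have "0 \<le> sd n"
        unfolding sd_def winsorized_sd_def set_lebesgue_integral_def
        by (intro real_sqrt_ge_zero Bochner_Integration.integral_nonneg) auto
      ultimately show ?thesis by (cases "sd n = 0") auto
    qed
    have cont: "isCont F (AR n * (1 + s))" if "\<bar>s\<bar> \<le> \<delta>" for s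
    proof (rule F_cont)
      have "2 * a0 * (1 / 2) \<le> AR n * (1 + s)"
        using that \<delta> large a0 by (intro mult_mono) auto
      then show "a0 \<le> \<bar>AR n * (1 + s)\<bar>" by simp
    qed
    have "\<bar>trimmed_cdf M X F k m n x - \<Phi> x\<bar>
        \<le> trim_const c \<delta> * ?total n" for x
      unfolding sd_def \<alpha>_def \<beta>_def
    proof (rule trimmed_cdf_bound[OF indep F, where c=c and \<delta>=\<delta>], unfold
        \<alpha>_def[symmetric] \<beta>_def[symmetric])
      show "tail_regular c \<delta> (\<lambda>x. F (- x)) (AL n)" "tail_regular c \<delta>
          (\<lambda>x. 1 - F x) (AR n)"
        using large a0 by (intro regular; linarith)+
    qed (use elim pos Q FA FB c \<delta> cont sd_pos in \<open>auto simp: sd_def\<close>)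
    then show ?case using elim pos sd_pos left right by blast
  qed
  define C where "C = trim_const c \<delta>"
  have C: "0 < C"
  proof -
    have "0 \<le> 4 * ((1 + exp 2) + 5 * exp 3) / (1 - exp (- c / 4))"
      "0 \<le> 2 * exp 3 * (exp (c / 2) * (8 / (c^2 * \<delta>^2)))"
      using c by (auto intro!: divide_nonneg_nonneg add_nonneg_nonneg)
    then show ?thesis unfolding C_def trim_const_def using gauss_const_pos by linarith
  qed
  \<comment> \<open>The parameter \<open>q\<close> serves both claims: a fixed value for the first,
    an arbitrarily small one for the second. The assumption \<open>large\<close> amounts to
    \<open>1 / k \<le> q / sqrt k\<close>, and likewise for \<open>m\<close>.\<close>
  have main: "\<bar>SUP x. \<bar>trimmed_cdf M X F k m n x - \<Phi> x\<bar>\<bar> \<le> 2 * C * q * ?rate n"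
    if q: "0 < q" and n: "1 \<le> k n" "1 \<le> m n" "0 < n" and pos: "0 < AL n" "0 < AR n" "0 < sd n"
      and large: "1 \<le> q * sqrt (real (k n))" "1 \<le> q * sqrt (real (m n))"
      and sq: "\<alpha> n * (AL n)^2 \<le> q^2 * (sd n)^2" "\<beta> n * (AR n)^2 \<le> q^2 * (sd n)^2"
      and bound: "\<And>x. \<bar>trimmed_cdf M X F k m n x - \<Phi> x\<bar>
        \<le> C * ?total n" for q n
  proof (intro abs_SUP_abs_le order_trans[OF bound])
    have n\<alpha>: "real n * \<alpha> n = real (k n)" "real n * \<beta> n
        = real (m n)" and "0 < \<alpha> n" "0 < \<beta> n"
      using n by (auto simp: \<alpha>_def \<beta>_def)
    then have "AL n / (sd n * sqrt n)
        \<le> q * (1 / sqrt (n * \<alpha> n))" "AR n / (sd n * sqrt n) \<le> q * (1 / sqrt (n * \<beta> n))"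
      using n pos q sq by (intro divide_sqrt_le; simp)+
    note this[unfolded n\<alpha>]
    moreover have "1 / real l \<le> q * (1 / sqrt (real l))" if "1 \<le> q * sqrt (real l)" "1 \<le> l" for l
    proof -
      have "1 / real l = (1 / sqrt (real l)) * (1 / sqrt (real l))" using that by simp
      also have "\<dots> \<le> q * (1 / sqrt (real l))"
        using that by (intro mult_right_mono) (auto simp: pos_divide_le_eq)
      finally show ?thesis .
    qed
    note this[OF large(1) n(1)] this[OF large(2) n(2)]
    ultimately have "?total n
        \<le> 2 * q * ?rate n"
      unfolding add_divide_distrib distrib_left by linarith
    then have "C * ?total n
        \<le> C * (2 * q * ?rate n)"
      using C by (intro mult_left_mono) auto
    then show "C * ?total n
        \<le> 2 * C * q * ?rate n"
      by (simp only: mult_ac)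
  qed
  show ?thesis
  \<comment> \<open>The value \<open>q = 6\<close> is admissible because
    \<open>32 \<le> 6^2\<close>.\<close>
  proof (intro conjI impI exI[of _ "2 * C * 6"])
    show "0 < 2 * C * 6" using C by simp
    show "\<forall>\<^sub>F n in sequentially. (SUP x. \<bar>trimmed_cdf M X F k m n x - \<Phi> x\<bar>)
      \<le> 2 * C * 6 * ?rate n"
      using good eventually_gt_at_top[of 0]
    proof eventually_elim
      case (elim n)
      have "32 * (sd n)^2 \<le> 6^2 * (sd n)^2" by (intro mult_right_mono) auto
      moreover have "1 \<le> sqrt (real (k n))" "1 \<le> sqrt (real (m n))" using elim by auto
      ultimately show ?case
        using elim unfolding C_def[symmetric]
        by (intro order_trans[OF abs_ge_self main]) (linarith | blast)+
    qed
  next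
    assume "\<gamma> = 2 \<and> trimmed_variance F 0 1 < \<infinity>"
    then have fin: "trimmed_variance (cdf N) 0 1 < \<infinity>" using FN by simp
    \<comment> \<open>The lower bound on the scale converts convergence of
      \<open>\<alpha> n * (AL n)^2\<close> to 0 into smallness relative to
      \<open>(sd n)^2\<close>.\<close>
    obtain s0 where s0: "0 < s0" "\<forall>\<^sub>F n in sequentially. s0 < sd n"
    proof -
      obtain s :: real where s: "0 < s" "ereal s < Liminf sequentially (\<lambda>n. ereal (sd n))"
        using assms(7) ereal_dense2[of 0 "Liminf sequentially (\<lambda>n. ereal (sd n))"]
        unfolding sd_def \<alpha>_def \<beta>_def by auto
      from less_LiminfD[OF s(2)] have "\<forall>\<^sub>F n in sequentially. s < sd n" by simp
      with s(1) show ?thesis by (rule that)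
    qed
    have at_right: "filterlim u (at_right 0) sequentially"
      if "u \<longlonglongrightarrow> 0"
          "\<forall>\<^sub>F n in sequentially. 0 < u n" for u :: "nat \<Rightarrow> real"
      using that by (auto simp: filterlim_at elim: eventually_mono)
    have lim: "(\<lambda>n. \<alpha> n
        * (AL n)^2) \<longlonglongrightarrow> 0" "(\<lambda>n. \<beta> n * (AR n)^2) \<longlonglongrightarrow> 0"
      using filterlim_compose[OF quantile_square_tendsto_0(1)[OF N fin] at_right[OF \<alpha>0]]
        filterlim_compose[OF quantile_square_tendsto_0(2)[OF N fin] at_right[OF \<beta>0]]
        eventually_mono[OF ev_pos] FN by (auto simp: AL_def AR_def)
    show "(\<lambda>n. SUP x. \<bar>trimmed_cdf M X F k m n x - \<Phi> x\<bar>)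
      \<in> o(\<lambda>n. 1 / sqrt (real (k n)) + 1 / sqrt (real (m n)))"
    proof (rule landau_o.smallI)
      fix e :: real assume "0 < e"
      \<comment> \<open>This makes the constant \<open>2 * C * q\<close> equal to \<open>e\<close>;
        the conditions on \<open>q\<close> then hold from some index on.\<close>
      define q where "q = e / (2 * C)"
      have q: "0 < q" using \<open>0 < e\<close> C by (simp add: q_def)
      have qs: "0 < q^2 * s0^2" using q s0 by simp
      obtain L :: nat where L: "(1 / q)^2 \<le> real L" using real_arch_simple by blast
      show "\<forall>\<^sub>F n in sequentially. norm (SUP x. \<bar>trimmed_cdf M X F k m n x - \<Phi> x\<bar>)
        \<le> e * norm (?rate n)"
        using good eventually_gt_at_top[of 0] s0(2) ev_km[of L]
          order_tendstoD(2)[OF lim(1) qs] order_tendstoD(2)[OF lim(2) qs]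
      proof eventually_elim
        case (elim n)
        have "s0^2 \<le> (sd n)^2" using elim s0 by (intro power_mono) auto
        then have "q^2 * s0^2 \<le> q^2 * (sd n)^2" by (intro mult_left_mono) auto
        moreover have "1 \<le> q * sqrt (real l)" if "L \<le> l" for l
        proof -
          have "(1 / q)^2 \<le> real l" using L that by (meson of_nat_le_iff order_trans)
          then have "1 / q \<le> sqrt (real l)" by (rule real_le_rsqrt)
          then show ?thesis using q by (simp add: pos_divide_le_eq mult.commute)
        qed
        then have "1 \<le> q * sqrt (real (k n))" "1 \<le> q * sqrt (real (m n))" using elim by auto
        ultimately have "\<bar>SUP x. \<bar>trimmed_cdf M X F k m n x - \<Phi> x\<bar>\<bar>
            \<le> 2 * C * q * ?rate n"
          using elim q unfolding C_def[symmetric] by (intro main) (linarith | blast)+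
        moreover have "2 * C * q = e" using C by (simp add: q_def)
        ultimately show ?case by simp
      qed
    qed
  qed
qed

end
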